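(* Let $X$ be a locally compact Hausdorff space and $\kappa$ a perfect kernel on $X$. Let $f=\psi+U^\vartheta$ with $\psi\in\Phi(X)$ and $\vartheta\in\mathcal E$. Then for any quasicompact $A\subset X$ with $-\infty<w_f(A)<\infty$ there exists a unique $\lambda_{A,f}\in\breve{\mathcal E}^+_f(A)$ with $I_f(\lambda_{A,f})=w_f(A)$.
   Context: Measures: $\mathfrak M$ is the space of real-valued (signed) Radon measures on $X$ with the vague (weak$^*$) topology of pointwise convergence on continuous functions of compact support; $\mathfrak M^+$ is the cone of positive ones. A measure $\mu\in\mathfrak M^+$ is concentrated on $A\subset X$ if $X\setminus A$ is locally $\mu$-negligible. $\Phi(Y)$ is the set of lower semicontinuous functions $g:Y\to(-\infty,\infty]$ which are $\geqslant0$ unless the topological space $Y$ is compact. A kernel is a symmetric function $\kappa\in\Phi(X\times X)$. For $\mu\in\mathfrak M$, $U^\mu(x)=\int\kappa(x,y)\,d\mu(y)$ is the potential, $I(\mu,\nu)=\int\kappa\,d(\mu\otimes\nu)$ the mutual energy, $I(\mu)=I(\mu,\mu)$ the energy, whenever well defined. Energy principle: $I(\mu)\geqslant0$ for all $\mu\in\mathfrak M$ for which $I(\mu)$ is well defined, and $I(\mu)=0$ only for $\mu=0$. Then $\mathcal E=\{\mu\in\mathfrak M: I(\mu)\text{ well defined},\ I(\mu)<\infty\}$ is a pre-Hilbert space with inner product $I(\mu,\nu)$ and norm $\|\mu\|=\sqrt{I(\mu)}$; the norm topology is called strong. $\mathcal E^+=\mathcal E\cap\mathfrak M^+$. The kernel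 is perfect if it satisfies the energy principle, $\mathcal E^+$ is strongly complete, and the strong topology on $\mathcal E^+$ is finer than the vague topology. $\mathcal E^+(A)$ is the set of $\mu\in\mathcal E^+$ concentrated on $A$; $\breve{\mathcal E}^+(A)=\{\mu\in\mathcal E^+(A):\mu(X)=1\}$. Inner capacity: ${\rm cap}_*(A)=1/w(A)$ with $w(A)=\inf_{\mu\in\breve{\mathcal E}^+(A)}I(\mu)$ ($\inf\varnothing=+\infty$, $1/(+\infty)=0$, $1/0=+\infty$). Outer capacity: ${\rm cap}^*(A)=\inf\{{\rm cap}_*(D): D\supset A\text{ open}\}$. $A$ is quasicompact if $\inf\{{\rm cap}^*(A\bigtriangleup F): F\subset X\text{ compact}\}=0$, $\bigtriangleup$ being the symmetric difference. The function $f=\psi+U^\vartheta$ is well defined with values in $(-\infty,\infty]$ except on a set of inner capacity zero (such sets, when $\mu$-measurable, are negligible for bounded $\mu\in\mathcal E^+$). $\breve{\mathcal E}^+_f(A)$ is the set of $\mu\in\breve{\mathcal E}^+(A)$ for which $f$ is $\mu$-integrable; $I_f(\mu)=I(\mu)+2\int f\,d\mu$; $w_f(A)=\inf_{\mu\in\breve{\mathcal E}^+_f(A)}I_f(\mu)$. *)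

theory Defs
  imports "HOL-Analysis.Analysis"
begin

section \<open>Radon measures\<close>

definition Cc :: "('a::topological_space \<Rightarrow> real) set" where
  "Cc = {\<phi>. continuous_on UNIV \<phi> \<and> compact (closure {x. \<phi> x \<noteq> 0})}"

text \<open>
  A real-valued Radon measure is a linear functional on \<open>Cc\<close> that is continuous for the inductive
  limit topology, i.e. bounded on the functions supported by any given compact set.
  (When the space is not \<open>\<sigma>\<close>-compact, both parts of a signed Radon measure may have infinite total
  mass, so it need not be a set function on all Borel sets.)
  Functionals take the value 0 outside \<open>Cc\<close>, so that equality of Radon measures is equality of HOL
  functions and the pointwise difference of Radon measures is again one.
\<close>

type_synonym 'a functional = "('a \<Rightarrow> real) \<Rightarrow> real"

definition radon :: "'a::topological_space functional set" where
  "radon = {\<mu>.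
     (\<forall>\<phi>\<in>Cc. \<forall>\<psi>\<in>Cc. \<mu> (\<lambda>x. \<phi> x + \<psi> x) = \<mu> \<phi> + \<mu> \<psi>) \<and>
     (\<forall>c. \<forall>\<phi>\<in>Cc. \<mu> (\<lambda>x. c * \<phi> x) = c * \<mu> \<phi>) \<and>
     (\<forall>K. compact K \<longrightarrow> (\<exists>B. \<forall>\<phi>\<in>Cc. {x. \<phi> x \<noteq> 0} \<subseteq> K \<longrightarrow> \<bar>\<mu> \<phi>\<bar> \<le> B * (SUP x. \<bar>\<phi> x\<bar>))) \<and>
     (\<forall>\<phi>. \<phi> \<notin> Cc \<longrightarrow> \<mu> \<phi> = 0)}"

definition radon_pos :: "'a::topological_space functional set" where
  "radon_pos = {\<mu> \<in> radon. \<forall>\<phi>\<in>Cc. (\<forall>x. 0 \<le> \<phi> x) \<longrightarrow> 0 \<le> \<mu> \<phi>}"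

definition vague_topology :: "'a::topological_space functional topology" where
  "vague_topology =
     topology_generated_by {{\<mu> \<in> radon. \<mu> \<phi> \<in> V} | \<phi> V. \<phi> \<in> Cc \<and> open V}"

text \<open>Jordan decomposition \<open>\<mu> = \<mu>\<^sup>+ - \<mu>\<^sup>-\<close>: for \<open>\<phi> \<ge> 0\<close> one has
  \<open>\<mu>\<^sup>+(\<phi>) = sup {\<mu>(\<psi>) | 0 \<le> \<psi> \<le> \<phi>}\<close>, extended by linearity.\<close>

definition pos_part :: "'a::topological_space functional \<Rightarrow> 'a functional" where
  "pos_part \<mu> = (\<lambda>\<phi>. if \<phi> \<in> Cc
     then Sup {\<mu> \<psi> | \<psi>. \<psi> \<in> Cc \<and> (\<forall>x. 0 \<le> \<psi> x \<and> \<psi> x \<le> max 0 (\<phi> x))}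
        - Sup {\<mu> \<psi> | \<psi>. \<psi> \<in> Cc \<and> (\<forall>x. 0 \<le> \<psi> x \<and> \<psi> x \<le> max 0 (- \<phi> x))}
     else 0)"

definition neg_part :: "'a::topological_space functional \<Rightarrow> 'a functional" where
  "neg_part \<mu> = pos_part (\<lambda>\<phi>. - \<mu> \<phi>)"

text \<open>The Borel measure representing a positive Radon measure on a locally compact Hausdorff space
  (Riesz--Markov--Kakutani): the restriction to the Borel sets of Bourbaki's outer measure
  \<open>\<mu>\<^sup>*(A) = inf {\<mu>\<^sup>*(U) | U \<supseteq> A open}\<close>, \<open>\<mu>\<^sup>*(U) = sup {\<mu>(\<phi>) | 0 \<le> \<phi> \<le> 1\<^sub>U}\<close>.\<close>

definition borel_measure :: "'a::topological_space functional \<Rightarrow> 'a measure" where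
  "borel_measure \<mu> = measure_of UNIV (sets borel)
     (\<lambda>A. INF U\<in>{U. open U \<and> A \<subseteq> U}.
            SUP \<phi>\<in>{\<phi> \<in> Cc. \<forall>x. 0 \<le> \<phi> x \<and> \<phi> x \<le> indicator U x}. ennreal (\<mu> \<phi>))"

text \<open>\<open>X - A\<close> is locally negligible: its trace on every compact set is negligible.
  The set \<open>A\<close> is arbitrary, whence the completion.\<close>

definition concentrated_on :: "'a::topological_space functional \<Rightarrow> 'a set \<Rightarrow> bool" where
  "concentrated_on \<mu> A \<longleftrightarrow>
     (\<forall>K. compact K \<longrightarrow> K \<inter> (UNIV - A) \<in> null_sets (completion (borel_measure \<mu>)))"

definition tensor ::
  "'a::topological_space functional \<Rightarrow> 'b::topological_space functional \<Rightarrow> ('a \<times> 'b) functional" where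
  "tensor \<mu> \<nu> = (\<lambda>F. if F \<in> Cc then \<mu> (\<lambda>x. \<nu> (\<lambda>y. F (x, y))) else 0)"


section \<open>Integration of extended real-valued functions\<close>

definition Phi :: "('b::topological_space \<Rightarrow> ereal) set" where
  "Phi = {g. (\<forall>a. open {x. a < g x}) \<and> (\<forall>x. g x \<noteq> -\<infinity>) \<and>
             (\<not> compact (UNIV :: 'b set) \<longrightarrow> (\<forall>x. 0 \<le> g x))}"

text \<open>Used below for \<open>g \<in> Phi\<close> and positive Radon measures only; then the subtrahend is finite, being
  0 unless the space is compact, in which case \<open>g\<close> is bounded below and the measure is finite.\<close>

definition ext_integral :: "'b measure \<Rightarrow> ('b \<Rightarrow> ereal) \<Rightarrow> ereal" where
  "ext_integral M g = enn2ereal (\<integral>\<^sup>+x. e2ennreal (g x) \<partial>M) - enn2ereal (\<integral>\<^sup>+x. e2ennreal (- g x) \<partial>M)"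

definition signed_integral_defined ::
  "'b::topological_space functional \<Rightarrow> ('b \<Rightarrow> ereal) \<Rightarrow> bool" where
  "signed_integral_defined \<mu> g \<longleftrightarrow>
     \<not> (ext_integral (borel_measure (pos_part \<mu>)) g = \<infinity> \<and>
        ext_integral (borel_measure (neg_part \<mu>)) g = \<infinity>)"

text \<open>Where the integral is not defined this has the value \<open>\<infinity> - \<infinity>\<close>, which is \<open>\<infinity>\<close> in type
  \<^typ>\<open>ereal\<close>.\<close>

definition signed_integral :: "'b::topological_space functional \<Rightarrow> ('b \<Rightarrow> ereal) \<Rightarrow> ereal" where
  "signed_integral \<mu> g =
     ext_integral (borel_measure (pos_part \<mu>)) g - ext_integral (borel_measure (neg_part \<mu>)) g"

text \<open>Integrability of an extended real-valued function; it forces the function to be finite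
  almost everywhere.\<close>

definition ext_integrable :: "'b measure \<Rightarrow> ('b \<Rightarrow> ereal) \<Rightarrow> bool" where
  "ext_integrable M f \<longleftrightarrow>
     (AE x in completion M. \<bar>f x\<bar> \<noteq> \<infinity>) \<and> integrable (completion M) (\<lambda>x. real_of_ereal (f x))"


section \<open>Kernels, potentials, energy\<close>

definition is_kernel :: "('a::topological_space \<times> 'a \<Rightarrow> ereal) \<Rightarrow> bool" where
  "is_kernel \<kappa> \<longleftrightarrow> \<kappa> \<in> Phi \<and> (\<forall>x y. \<kappa> (x, y) = \<kappa> (y, x))"

definition potential ::
  "('a::topological_space \<times> 'a \<Rightarrow> ereal) \<Rightarrow> 'a functional \<Rightarrow> 'a \<Rightarrow> ereal" where
  "potential \<kappa> \<mu> x = signed_integral \<mu> (\<lambda>y. \<kappa> (x, y))"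

definition mutual_energy ::
  "('a::topological_space \<times> 'a \<Rightarrow> ereal) \<Rightarrow> 'a functional \<Rightarrow> 'a functional \<Rightarrow> ereal" where
  "mutual_energy \<kappa> \<mu> \<nu> = signed_integral (tensor \<mu> \<nu>) \<kappa>"

definition energy_defined ::
  "('a::topological_space \<times> 'a \<Rightarrow> ereal) \<Rightarrow> 'a functional \<Rightarrow> bool" where
  "energy_defined \<kappa> \<mu> \<longleftrightarrow> signed_integral_defined (tensor \<mu> \<mu>) \<kappa>"

definition energy :: "('a::topological_space \<times> 'a \<Rightarrow> ereal) \<Rightarrow> 'a functional \<Rightarrow> ereal" where
  "energy \<kappa> \<mu> = mutual_energy \<kappa> \<mu> \<mu>"

definition energy_principle :: "('a::topological_space \<times> 'a \<Rightarrow> ereal) \<Rightarrow> bool" where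
  "energy_principle \<kappa> \<longleftrightarrow>
     (\<forall>\<mu>\<in>radon. energy_defined \<kappa> \<mu> \<longrightarrow>
        0 \<le> energy \<kappa> \<mu> \<and> (energy \<kappa> \<mu> = 0 \<longrightarrow> \<mu> = (\<lambda>_. 0)))"

definition finite_energy :: "('a::topological_space \<times> 'a \<Rightarrow> ereal) \<Rightarrow> 'a functional set" where
  "finite_energy \<kappa> = {\<mu> \<in> radon. energy_defined \<kappa> \<mu> \<and> energy \<kappa> \<mu> < \<infinity>}"

definition finite_energy_pos :: "('a::topological_space \<times> 'a \<Rightarrow> ereal) \<Rightarrow> 'a functional set" where
  "finite_energy_pos \<kappa> = finite_energy \<kappa> \<inter> radon_pos"

definition energy_norm :: "('a::topological_space \<times> 'a \<Rightarrow> ereal) \<Rightarrow> 'a functional \<Rightarrow> real" where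
  "energy_norm \<kappa> \<mu> = sqrt (real_of_ereal (energy \<kappa> \<mu>))"

definition energy_dist ::
  "('a::topological_space \<times> 'a \<Rightarrow> ereal) \<Rightarrow> 'a functional \<Rightarrow> 'a functional \<Rightarrow> real" where
  "energy_dist \<kappa> \<mu> \<nu> =
     (if \<mu> \<in> finite_energy_pos \<kappa> \<and> \<nu> \<in> finite_energy_pos \<kappa>
      then energy_norm \<kappa> (\<lambda>\<phi>. \<mu> \<phi> - \<nu> \<phi>) else 0)"

text \<open>Under the energy principle \<open>energy_dist \<kappa>\<close> is a metric on \<open>finite_energy_pos \<kappa>\<close>, and its
  metric topology is the strong topology there. The value 0 outside this set is immaterial; it is
  there because the locale \<^locale>\<open>Metric_space\<close> requires a distance that is nonnegative and
  symmetric on the whole type.\<close>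

definition perfect :: "('a::topological_space \<times> 'a \<Rightarrow> ereal) \<Rightarrow> bool" where
  "perfect \<kappa> \<longleftrightarrow>
     energy_principle \<kappa> \<and>
     Metric_space.mcomplete (finite_energy_pos \<kappa>) (energy_dist \<kappa>) \<and>
     (\<forall>U. openin (subtopology vague_topology (finite_energy_pos \<kappa>)) U \<longrightarrow>
          openin (Metric_space.mtopology (finite_energy_pos \<kappa>) (energy_dist \<kappa>)) U)"


section \<open>Capacities\<close>

definition unit_measures ::
  "('a::topological_space \<times> 'a \<Rightarrow> ereal) \<Rightarrow> 'a set \<Rightarrow> 'a functional set" where
  "unit_measures \<kappa> A =
     {\<mu> \<in> finite_energy_pos \<kappa>. concentrated_on \<mu> A \<and> emeasure (borel_measure \<mu>) UNIV = 1}"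

definition min_energy :: "('a::topological_space \<times> 'a \<Rightarrow> ereal) \<Rightarrow> 'a set \<Rightarrow> ereal" where
  "min_energy \<kappa> A = (INF \<mu>\<in>unit_measures \<kappa> A. energy \<kappa> \<mu>)"

text \<open>In \<^typ>\<open>ereal\<close>, \<open>inverse \<infinity> = 0\<close> and \<open>inverse 0 = \<infinity>\<close>.\<close>

definition inner_capacity :: "('a::topological_space \<times> 'a \<Rightarrow> ereal) \<Rightarrow> 'a set \<Rightarrow> ereal" where
  "inner_capacity \<kappa> A = inverse (min_energy \<kappa> A)"

definition outer_capacity :: "('a::topological_space \<times> 'a \<Rightarrow> ereal) \<Rightarrow> 'a set \<Rightarrow> ereal" where
  "outer_capacity \<kappa> A = (INF D\<in>{D. open D \<and> A \<subseteq> D}. inner_capacity \<kappa> D)"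

definition quasicompact :: "('a::topological_space \<times> 'a \<Rightarrow> ereal) \<Rightarrow> 'a set \<Rightarrow> bool" where
  "quasicompact \<kappa> A \<longleftrightarrow> (INF F\<in>{F. compact F}. outer_capacity \<kappa> (sym_diff A F)) = 0"


section \<open>The Gauss variational problem\<close>

text \<open>At the points where \<open>\<psi> + U\<^sup>\<theta>\<close> is not defined, the conventions of type \<^typ>\<open>ereal\<close> give
  the value \<open>\<infinity>\<close>. Since \<open>ext_integrable\<close> requires finiteness almost everywhere, a measure for which
  the field is integrable does not charge the set of these points.\<close>

definition external_field ::
  "('a::topological_space \<times> 'a \<Rightarrow> ereal) \<Rightarrow> ('a \<Rightarrow> ereal) \<Rightarrow> 'a functional \<Rightarrow> 'a \<Rightarrow> ereal" where
  "external_field \<kappa> \<psi> \<theta> x = \<psi> x + potential \<kappa> \<theta> x"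

definition unit_measures_field ::
  "('a::topological_space \<times> 'a \<Rightarrow> ereal) \<Rightarrow> ('a \<Rightarrow> ereal) \<Rightarrow> 'a set \<Rightarrow> 'a functional set" where
  "unit_measures_field \<kappa> f A = {\<mu> \<in> unit_measures \<kappa> A. ext_integrable (borel_measure \<mu>) f}"

definition gauss_functional ::
  "('a::topological_space \<times> 'a \<Rightarrow> ereal) \<Rightarrow> ('a \<Rightarrow> ereal) \<Rightarrow> 'a functional \<Rightarrow> ereal" where
  "gauss_functional \<kappa> f \<mu> =
     energy \<kappa> \<mu> + ereal (2 * (LINT x|completion (borel_measure \<mu>). real_of_ereal (f x)))"

definition min_gauss ::
  "('a::topological_space \<times> 'a \<Rightarrow> ereal) \<Rightarrow> ('a \<Rightarrow> ereal) \<Rightarrow> 'a set \<Rightarrow> ereal" where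
  "min_gauss \<kappa> f A = (INF \<mu>\<in>unit_measures_field \<kappa> f A. gauss_functional \<kappa> f \<mu>)"

end

theory Submission
  imports Defs
begin

text \<open>
  Everything rests on the formula \<open>\<integral> g d\<mu> = sup {\<mu>(\<phi>) | \<phi> \<in> Cc, \<phi> \<le> g}\<close> for positive \<open>\<mu>\<close> and lower
  semicontinuous \<open>g\<close>, which gives additivity of the integral in \<open>\<mu>\<close> and in \<open>g\<close>, Fubini's theorem for
  the kernel and lower semicontinuity of the integral in the vague topology. Applied to \<open>\<mu> - \<nu>\<close>, the
  energy principle shows that mutual energies are finite and satisfy the Cauchy--Schwarz inequality.

  A minimizing sequence is strongly Cauchy by the parallelogram identity
  \<open>\<parallel>\<mu> - \<nu>\<parallel>\<^sup>2 = 2 I\<^sub>f(\<mu>) + 2 I\<^sub>f(\<nu>) - 4 I\<^sub>f((\<mu> + \<nu>)/2)\<close>, which also gives uniqueness. By perfectness it has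
  a strong and vague limit, and \<open>I\<^sub>f\<close> is lower semicontinuous along it. That the limit has mass 1 and is
  concentrated on \<open>A\<close> follows from quasicompactness: choose \<open>F\<close> compact and \<open>D\<close> open of small capacity
  with \<open>A \<triangle> F \<subseteq> D\<close>. A measure \<open>\<mu>\<close> of bounded energy has mass \<open>O(cap(D)\<^sup>1\<^sup>/\<^sup>2)\<close> on \<open>D\<close>, so almost all the
  mass of the minimizing sequence sits on the compact set \<open>F\<close>, and almost none of it off \<open>F\<close>.
\<close>

section \<open>Continuous functions of compact support\<close>

text \<open>The space need not have a countable base, so directed families in \<open>Cc\<close> take
  the place of monotone sequences: a supremum is exchanged with an integral by Dini's theorem, and
  Fubini's theorem is proved for functionals, without product \<sigma>-algebras. The notions of the
  statement (energies, masses, null sets, integrability of the field) speak of Borel measures; the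
  Riesz representation translates them into functionals. Three obstacles shape the rest. Finite
  energy of the signed measure \<theta> concerns the Jordan parts of \<theta> \<otimes> \<theta>,
  whereas its potential is made of the parts of \<theta>; relating the two takes an approximate form
  of mutual singularity. On a compact space the kernel may be negative, bounded below by some -c;
  cutting a measure down may then increase its energy, and the term c \<mu>(1)^2 in the capacity
  estimates pays for that. Finally \<open>A\<close> is arbitrary, neither Borel nor closed:
  concentration on \<open>A\<close> is expressed by outer masses, and a vague limit could lose mass
  or leave \<open>A\<close>.\<close>

lemma CcI:
  fixes \<phi> :: "'a::t2_space \<Rightarrow> real"
  assumes "continuous_on UNIV \<phi>" "compact K" "\<And>x. x \<notin> K \<Longrightarrow> \<phi> x = 0"
  shows "\<phi> \<in> Cc"
proof -
  have "closure {x. \<phi> x \<noteq> 0} \<subseteq> K"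
    using assms(3) compact_imp_closed[OF assms(2)] by (intro closure_minimal) auto
  then have "compact (closure {x. \<phi> x \<noteq> 0})"
    using compact_Int_closed[OF assms(2) closed_closure, of "{x. \<phi> x \<noteq> 0}"] by (simp add: inf.absorb2)
  then show ?thesis
    using assms(1) by (simp add: Cc_def)
qed

lemma Cc_continuous: "\<phi> \<in> Cc \<Longrightarrow> continuous_on UNIV \<phi>"
  by (simp add: Cc_def)

lemma CcE:
  assumes "\<phi> \<in> Cc"
  obtains K where "compact K" "\<And>x. x \<notin> K \<Longrightarrow> \<phi> x = 0"
proof (rule that)
  show "compact (closure {x. \<phi> x \<noteq> 0})"
    using assms by (simp add: Cc_def)
  show "\<phi> x = 0" if "x \<notin> closure {x. \<phi> x \<noteq> 0}" for x
    using that closure_subset[of "{x. \<phi> x \<noteq> 0}"] by auto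
qed

lemma Cc_support2:
  assumes "\<phi> \<in> Cc" "\<psi> \<in> Cc"
  obtains K where "compact K" "\<And>x. x \<notin> K \<Longrightarrow> \<phi> x = 0" "\<And>x. x \<notin> K \<Longrightarrow> \<psi> x = 0"
proof -
  obtain K where "compact K" "\<And>x. x \<notin> K \<Longrightarrow> \<phi> x = 0" using CcE[OF assms(1)] by blast
  moreover obtain L where "compact L" "\<And>x. x \<notin> L \<Longrightarrow> \<psi> x = 0" using CcE[OF assms(2)] by blast
  ultimately show ?thesis using that[of "K \<union> L"] by auto
qed

lemma Cc_zero [simp]: "(\<lambda>x::'a::t2_space. 0) \<in> Cc"
  by (rule CcI[where K="{}"]) auto

lemma Cc_add:
  fixes \<phi> \<psi> :: "'a::t2_space \<Rightarrow> real"
  assumes "\<phi> \<in> Cc" "\<psi> \<in> Cc"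
  shows "(\<lambda>x. \<phi> x + \<psi> x) \<in> Cc"
proof -
  obtain K where "compact K" "\<And>x. x \<notin> K \<Longrightarrow> \<phi> x = 0" "\<And>x. x \<notin> K \<Longrightarrow> \<psi> x = 0"
    using Cc_support2[OF assms] by blast
  then show ?thesis
    by (intro CcI[OF continuous_on_add[OF assms[THEN Cc_continuous]]]) auto
qed

lemma Cc_mult:
  fixes \<phi> g :: "'a::t2_space \<Rightarrow> real"
  assumes "\<phi> \<in> Cc" "continuous_on UNIV g"
  shows "(\<lambda>x. g x * \<phi> x) \<in> Cc"
proof (rule CcE[OF assms(1)])
  fix K assume "compact K" "\<And>x. x \<notin> K \<Longrightarrow> \<phi> x = 0"
  then show ?thesis
    by (intro CcI[OF continuous_on_mult[OF assms(2) Cc_continuous[OF assms(1)]]]) auto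
qed

lemma Cc_scale: "\<phi> \<in> Cc \<Longrightarrow> (\<lambda>x::'a::t2_space. c * \<phi> x) \<in> Cc"
  by (rule Cc_mult) auto

lemma Cc_minus: "\<phi> \<in> Cc \<Longrightarrow> (\<lambda>x::'a::t2_space. - \<phi> x) \<in> Cc"
  using Cc_scale[of \<phi> "-1"] by simp

lemma Cc_diff: "\<phi> \<in> Cc \<Longrightarrow> \<psi> \<in> Cc \<Longrightarrow> (\<lambda>x::'a::t2_space. \<phi> x - \<psi> x) \<in> Cc"
  using Cc_add[OF _ Cc_minus, of \<phi> \<psi>] by simp

lemma Cc_max:
  fixes \<phi> \<psi> :: "'a::t2_space \<Rightarrow> real"
  assumes "\<phi> \<in> Cc" "\<psi> \<in> Cc"
  shows "(\<lambda>x. max (\<phi> x) (\<psi> x)) \<in> Cc"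
proof -
  obtain K where "compact K" "\<And>x. x \<notin> K \<Longrightarrow> \<phi> x = 0" "\<And>x. x \<notin> K \<Longrightarrow> \<psi> x = 0"
    using Cc_support2[OF assms] by blast
  then show ?thesis
    by (intro CcI[OF continuous_on_max[OF assms[THEN Cc_continuous]]]) auto
qed

lemma Cc_min: "\<phi> \<in> Cc \<Longrightarrow> \<psi> \<in> Cc \<Longrightarrow> (\<lambda>x::'a::t2_space. min (\<phi> x) (\<psi> x)) \<in> Cc"
  using Cc_minus[OF Cc_max[OF Cc_minus Cc_minus, of \<phi> \<psi>]]
  by (simp add: minus_max_eq_min)

lemma Cc_pos: "\<phi> \<in> Cc \<Longrightarrow> (\<lambda>x::'a::t2_space. max 0 (\<phi> x)) \<in> Cc"
  by (rule Cc_max) auto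

lemma Cc_bounded:
  fixes \<phi> :: "'a::t2_space \<Rightarrow> real"
  assumes "\<phi> \<in> Cc"
  obtains B where "0 \<le> B" "\<And>x. \<bar>\<phi> x\<bar> \<le> B"
proof -
  obtain K where K: "compact K" "\<And>x. x \<notin> K \<Longrightarrow> \<phi> x = 0"
    using CcE[OF assms] by blast
  have "bounded (\<phi> ` K)"
    using K(1) Cc_continuous[OF assms] by (meson compact_continuous_image compact_imp_bounded continuous_on_subset top_greatest)
  then obtain B where "\<And>x. x \<in> K \<Longrightarrow> \<bar>\<phi> x\<bar> \<le> B"
    by (auto simp: bounded_iff)
  then have "\<bar>\<phi> x\<bar> \<le> max B 0" for x
    using K(2)[of x] by (cases "x \<in> K") (auto simp: le_max_iff_disj)
  then show ?thesis
    using that[of "max B 0"] by simp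
qed

lemma Cc_le_SUP:
  fixes \<phi> :: "'a::t2_space \<Rightarrow> real"
  assumes "\<phi> \<in> Cc"
  shows "\<bar>\<phi> x\<bar> \<le> (SUP x. \<bar>\<phi> x\<bar>)"
proof -
  obtain B where "\<And>x. \<bar>\<phi> x\<bar> \<le> B"
    using Cc_bounded[OF assms] by metis
  then show ?thesis
    by (intro cSUP_upper bdd_aboveI[where M=B]) auto
qed

lemma Cc_const: "compact (UNIV :: 'a::t2_space set) \<Longrightarrow> (\<lambda>_::'a. c) \<in> Cc"
  by (rule CcI[where K=UNIV]) auto

text \<open>Urysohn's lemma in the form used throughout: local compactness supplies a compact
  neighbourhood of \<open>K\<close> and complete regularity a separating function.\<close>

lemma Cc_bump:
  fixes K U :: "'a::t2_space set"
  assumes lc: "locally_compact_space (euclidean :: 'a topology)"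
    and "compact K" "open U" "K \<subseteq> U"
  obtains \<beta> L where "\<beta> \<in> Cc" "\<And>x. 0 \<le> \<beta> x" "\<And>x. \<beta> x \<le> 1" "\<And>x. x \<in> K \<Longrightarrow> \<beta> x = 1"
    "compact L" "L \<subseteq> U" "\<And>x. x \<notin> L \<Longrightarrow> \<beta> x = 0"
proof -
  have H: "Hausdorff_space (euclidean :: 'a topology)"
    unfolding Hausdorff_space_def by (metis separation_t2 open_openin disjnt_def)
  obtain V M where VM: "open V" "compact M" "K \<subseteq> V" "V \<subseteq> M"
    using lc assms(2) unfolding locally_compact_space_compact_closed_compact[OF disjI1[OF H]]
    by (metis compactin_euclidean_iff open_openin)
  have cr: "completely_regular_space (euclidean :: 'a topology)"
    using lc H locally_compact_regular_imp_completely_regular_space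
    by (metis locally_compact_Hausdorff_imp_regular_space)
  have "disjnt (- (U \<inter> V)) K"
    using VM assms(4) by (auto simp: disjnt_def)
  then obtain h where h: "continuous_map euclidean (top_of_set {0..1::real}) h"
      "h ` K \<subseteq> {0}" "h ` (- (U \<inter> V)) \<subseteq> {1}"
    using Urysohn_completely_regular_closed_compact[OF _ cr, of 0 1 "- (U \<inter> V)" K]
      assms VM by (auto simp: closed_Compl open_Int)
  have hc: "continuous_on UNIV h" and h01: "\<And>x. 0 \<le> h x" "\<And>x. h x \<le> 1"
    using h(1) by (auto simp: continuous_map_in_subtopology image_subset_iff)
  \<comment> \<open>The factor 2 leaves room: \<open>\<beta>\<close> vanishes already where h > 1/2,
    so the set off which it vanishes can be taken closed and still inside \<open>U\<close>, as h = 1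
    off \<open>U \<inter> V\<close>.\<close>
  define \<beta> where "\<beta> x = max 0 (1 - 2 * h x)" for x
  define L where "L = M \<inter> {x. h x \<le> 1/2}"
  have L: "compact L"
    unfolding L_def using VM(2) hc by (intro compact_Int_closed closed_Collect_le continuous_intros) auto
  have LU: "L \<subseteq> U"
    using h(3) unfolding L_def by force
  have 0: "\<beta> x = 0" if "x \<notin> L" for x
    using that h(3) VM(4) unfolding L_def \<beta>_def by force
  have "\<beta> \<in> Cc"
    unfolding \<beta>_def by (rule CcI[OF _ L]) (use hc 0 in \<open>auto simp: \<beta>_def intro!: continuous_intros\<close>)
  then show ?thesis
    using that[of \<beta> L] h01 h(2) L LU 0 by (force simp: \<beta>_def)
qed

section \<open>Positive Radon measures as functionals\<close>

lemma radon_add: "\<mu> \<in> radon \<Longrightarrow> \<phi> \<in> Cc \<Longrightarrow> \<psi> \<in> Cc \<Longrightarrow> \<mu> (\<lambda>x. \<phi> x + \<psi> x) = \<mu> \<phi> + \<mu> \<psi>"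
  and radon_scale: "\<mu> \<in> radon \<Longrightarrow> \<phi> \<in> Cc \<Longrightarrow> \<mu> (\<lambda>x. c * \<phi> x) = c * \<mu> \<phi>"
  and radon_outside: "\<mu> \<in> radon \<Longrightarrow> \<phi> \<notin> Cc \<Longrightarrow> \<mu> \<phi> = 0"
  and radon_bounded: "\<mu> \<in> radon \<Longrightarrow> compact K \<Longrightarrow>
    \<exists>B. \<forall>\<phi>\<in>Cc. {x. \<phi> x \<noteq> 0} \<subseteq> K \<longrightarrow> \<bar>\<mu> \<phi>\<bar> \<le> B * (SUP x. \<bar>\<phi> x\<bar>)"
  and radon_pos_radon: "\<mu> \<in> radon_pos \<Longrightarrow> \<mu> \<in> radon"
  by (simp_all add: radon_def radon_pos_def)

lemma radon_pos_nonneg: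
  assumes "\<mu> \<in> radon_pos" "\<And>x. 0 \<le> \<phi> x"
  shows "0 \<le> \<mu> \<phi>"
  using assms by (cases "\<phi> \<in> Cc") (auto simp: radon_pos_def radon_outside)

lemma radon_diff:
  fixes \<phi> \<psi> :: "'a::t2_space \<Rightarrow> real"
  assumes "\<mu> \<in> radon" "\<phi> \<in> Cc" "\<psi> \<in> Cc"
  shows "\<mu> (\<lambda>x. \<phi> x - \<psi> x) = \<mu> \<phi> - \<mu> \<psi>"
  using radon_add[OF assms(1,2) Cc_scale[OF assms(3), of "-1"]] radon_scale[OF assms(1,3), of "-1"]
  by simp

lemma radon_zero: "\<mu> \<in> radon \<Longrightarrow> \<mu> (\<lambda>x::'a::t2_space. 0) = 0"
  using radon_scale[of \<mu> "\<lambda>_. 0" 0] by simp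

lemma radon_pos_mono:
  fixes \<phi> \<psi> :: "'a::t2_space \<Rightarrow> real"
  assumes "\<mu> \<in> radon_pos" "\<phi> \<in> Cc" "\<psi> \<in> Cc" "\<And>x. \<phi> x \<le> \<psi> x"
  shows "\<mu> \<phi> \<le> \<mu> \<psi>"
  using radon_pos_nonneg[OF assms(1), of "\<lambda>x. \<psi> x - \<phi> x"] radon_diff[of \<mu> \<psi> \<phi>] assms
  by (auto simp: radon_pos_radon)

section \<open>Constructing positive measures\<close>

text \<open>Positivity implies boundedness: if \<open>\<beta>\<close> is 1 on \<open>K\<close>, then
  |\<phi>| is at most sup |\<phi>| times \<open>\<beta>\<close> for every \<open>\<phi>\<close>
  supported by \<open>K\<close>, and \<open>\<mu> \<beta>\<close> is the required bound. This
  relieves all later constructions of positive measures of the third condition in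
  \<open>radon\<close>.\<close>

lemma radon_posI:
  fixes \<mu> :: "'a::t2_space functional"
  assumes lc: "locally_compact_space (euclidean :: 'a topology)"
    and add: "\<And>\<phi> \<psi>. \<phi> \<in> Cc \<Longrightarrow> \<psi> \<in> Cc \<Longrightarrow> \<mu> (\<lambda>x. \<phi> x + \<psi> x) = \<mu> \<phi> + \<mu> \<psi>"
    and scale: "\<And>c \<phi>. \<phi> \<in> Cc \<Longrightarrow> \<mu> (\<lambda>x. c * \<phi> x) = c * \<mu> \<phi>"
    and pos: "\<And>\<phi>. \<phi> \<in> Cc \<Longrightarrow> (\<And>x. 0 \<le> \<phi> x) \<Longrightarrow> 0 \<le> \<mu> \<phi>"
    and outside: "\<And>\<phi>. \<phi> \<notin> Cc \<Longrightarrow> \<mu> \<phi> = 0"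
  shows "\<mu> \<in> radon_pos"
proof -
  have "\<exists>B. \<forall>\<phi>\<in>Cc. {x. \<phi> x \<noteq> 0} \<subseteq> K \<longrightarrow> \<bar>\<mu> \<phi>\<bar> \<le> B * (SUP x. \<bar>\<phi> x\<bar>)" if K: "compact K" for K
  proof -
    obtain \<beta> where \<beta>: "\<beta> \<in> Cc" "\<And>x. 0 \<le> \<beta> x" "\<And>x. x \<in> K \<Longrightarrow> \<beta> x = 1"
      using Cc_bump[OF lc K open_UNIV] by (metis UNIV_I subsetI)
    have "\<bar>\<mu> \<phi>\<bar> \<le> \<mu> \<beta> * (SUP x. \<bar>\<phi> x\<bar>)" if \<phi>: "\<phi> \<in> Cc" "{x. \<phi> x \<noteq> 0} \<subseteq> K" for \<phi>
    proof -
      define s where "s = (SUP x. \<bar>\<phi> x\<bar>)"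
      have s: "\<bar>\<phi> x\<bar> \<le> s * \<beta> x" for x
      proof (cases "x \<in> K")
        case True
        then show ?thesis using Cc_le_SUP[OF \<phi>(1), of x] \<beta>(3) by (simp add: s_def)
      next
        case False
        have "0 \<le> s" using Cc_le_SUP[OF \<phi>(1), of x] by (simp add: s_def)
        moreover have "\<phi> x = 0" using False \<phi>(2) by auto
        ultimately show ?thesis using \<beta>(2)[of x] by simp
      qed
      have sc: "(\<lambda>x. s * \<beta> x) \<in> Cc"
        using \<beta>(1) by (rule Cc_scale)
      have 1: "0 \<le> \<mu> (\<lambda>x. s * \<beta> x + c * \<phi> x)" if "\<bar>c\<bar> = 1" for c
      proof (rule pos)
        show "(\<lambda>x. s * \<beta> x + c * \<phi> x) \<in> Cc"
          by (intro Cc_add Cc_scale \<beta> \<phi>)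
        show "0 \<le> s * \<beta> x + c * \<phi> x" for x
        proof -
          have "\<bar>c * \<phi> x\<bar> = \<bar>\<phi> x\<bar>" by (simp add: abs_mult that)
          then show ?thesis using s[of x] by linarith
        qed
      qed
      have "\<mu> (\<lambda>x. s * \<beta> x + c * \<phi> x) = s * \<mu> \<beta> + c * \<mu> \<phi>" for c
        using add[OF sc Cc_scale[OF \<phi>(1), of c]] scale \<beta>(1) \<phi>(1) by simp
      then have "0 \<le> s * \<mu> \<beta> + \<mu> \<phi>" "0 \<le> s * \<mu> \<beta> - \<mu> \<phi>"
        using 1[of 1] 1[of "-1"] by (metis abs_one mult_1, metis abs_minus abs_one diff_conv_add_uminus mult_minus1)
      then show ?thesis
        unfolding s_def[symmetric] by (simp add: mult.commute abs_le_iff)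
    qed
    then show ?thesis by blast
  qed
  then show ?thesis
    using assms by (auto simp: radon_pos_def radon_def)
qed

lemma radon_pos_zero [simp]: "(\<lambda>_. 0) \<in> (radon_pos :: 'a::t2_space functional set)"
  by (auto simp: radon_pos_def radon_def intro!: exI[of _ 0])

lemma radon_pos_add:
  fixes \<mu> \<nu> :: "'a::t2_space functional"
  assumes lc: "locally_compact_space (euclidean :: 'a topology)"
    and "\<mu> \<in> radon_pos" "\<nu> \<in> radon_pos"
  shows "(\<lambda>\<phi>. \<mu> \<phi> + \<nu> \<phi>) \<in> radon_pos"
proof (rule radon_posI[OF lc])
  have \<mu>: "\<mu> \<in> radon" and \<nu>: "\<nu> \<in> radon" using assms by (auto simp: radon_pos_radon)
  show "0 \<le> \<mu> \<phi> + \<nu> \<phi>" if "\<And>x. 0 \<le> \<phi> x" for \<phi>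
    using that assms(2,3) by (simp add: radon_pos_nonneg)
qed (use assms in \<open>simp_all add: radon_add radon_scale radon_outside radon_pos_radon distrib_left\<close>)

lemma radon_pos_scale:
  fixes \<mu> :: "'a::t2_space functional"
  assumes lc: "locally_compact_space (euclidean :: 'a topology)"
    and "\<mu> \<in> radon_pos" "0 \<le> c"
  shows "(\<lambda>\<phi>. c * \<mu> \<phi>) \<in> radon_pos"
proof (rule radon_posI[OF lc])
  show "0 \<le> c * \<mu> \<phi>" if "\<And>x. 0 \<le> \<phi> x" for \<phi>
    using that assms(2,3) by (simp add: radon_pos_nonneg)
qed (use assms in \<open>simp_all add: radon_add radon_scale radon_outside radon_pos_radon distrib_left\<close>)

lemma radon_pos_diff:
  fixes \<mu> \<nu> :: "'a::t2_space functional"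
  assumes lc: "locally_compact_space (euclidean :: 'a topology)"
    and "\<mu> \<in> radon" "\<nu> \<in> radon" "\<And>\<phi>. \<phi> \<in> Cc \<Longrightarrow> (\<And>x. 0 \<le> \<phi> x) \<Longrightarrow> \<nu> \<phi> \<le> \<mu> \<phi>"
  shows "(\<lambda>\<phi>. \<mu> \<phi> - \<nu> \<phi>) \<in> radon_pos"
  using assms(2-4)
  by (intro radon_posI lc) (simp_all add: radon_add radon_scale radon_outside right_diff_distrib)

lemma radon_diff_radon:
  fixes \<mu> \<nu> :: "'a::t2_space functional"
  assumes "\<mu> \<in> radon" "\<nu> \<in> radon"
  shows "(\<lambda>\<phi>. \<mu> \<phi> - \<nu> \<phi>) \<in> radon"
proof -
  have "\<exists>B. \<forall>\<phi>\<in>Cc. {x. \<phi> x \<noteq> 0} \<subseteq> K \<longrightarrow> \<bar>\<mu> \<phi> - \<nu> \<phi>\<bar> \<le> B * (SUP x. \<bar>\<phi> x\<bar>)" if K: "compact K" for K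
  proof -
    obtain B where B: "\<And>\<phi>. \<phi> \<in> Cc \<Longrightarrow> {x. \<phi> x \<noteq> 0} \<subseteq> K \<Longrightarrow> \<bar>\<mu> \<phi>\<bar> \<le> B * (SUP x. \<bar>\<phi> x\<bar>)"
      using radon_bounded[OF assms(1) K] by blast
    obtain C where C: "\<And>\<phi>. \<phi> \<in> Cc \<Longrightarrow> {x. \<phi> x \<noteq> 0} \<subseteq> K \<Longrightarrow> \<bar>\<nu> \<phi>\<bar> \<le> C * (SUP x. \<bar>\<phi> x\<bar>)"
      using radon_bounded[OF assms(2) K] by blast
    have "\<bar>\<mu> \<phi> - \<nu> \<phi>\<bar> \<le> (B + C) * (SUP x. \<bar>\<phi> x\<bar>)" if "\<phi> \<in> Cc" "{x. \<phi> x \<noteq> 0} \<subseteq> K" for \<phi>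
      using B[OF that] C[OF that] abs_triangle_ineq4[of "\<mu> \<phi>" "\<nu> \<phi>"] unfolding distrib_right by linarith
    then show ?thesis by blast
  qed
  moreover have "\<mu> (\<lambda>x. \<phi> x + \<psi> x) - \<nu> (\<lambda>x. \<phi> x + \<psi> x) = \<mu> \<phi> - \<nu> \<phi> + (\<mu> \<psi> - \<nu> \<psi>)"
    if "\<phi> \<in> Cc" "\<psi> \<in> Cc" for \<phi> \<psi>
    using radon_add[OF assms(1) that] radon_add[OF assms(2) that] by simp
  moreover have "\<mu> (\<lambda>x. c * \<phi> x) - \<nu> (\<lambda>x. c * \<phi> x) = c * (\<mu> \<phi> - \<nu> \<phi>)"
    if "\<phi> \<in> Cc" for c \<phi>
    using radon_scale[OF assms(1) that] radon_scale[OF assms(2) that] by (simp add: right_diff_distrib)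
  moreover have "\<mu> \<phi> - \<nu> \<phi> = 0" if "\<phi> \<notin> Cc" for \<phi>
    using radon_outside[OF assms(1) that] radon_outside[OF assms(2) that] by simp
  ultimately show ?thesis
    unfolding radon_def by simp
qed

lemma radon_eqI:
  assumes "\<mu> \<in> radon" "\<nu> \<in> radon" "\<And>\<phi>. \<phi> \<in> Cc \<Longrightarrow> \<mu> \<phi> = \<nu> \<phi>"
  shows "\<mu> = \<nu>"
  using assms by (auto simp: fun_eq_iff) (metis radon_outside)

text \<open>The measure with density \<open>\<eta>\<close>. For \<open>\<eta>\<close> below the
  indicator of an open set it is a continuous substitute for the restriction to that set.\<close>

lemma radon_pos_density:
  fixes \<mu> :: "'a::t2_space functional"
  assumes lc: "locally_compact_space (euclidean :: 'a topology)"
    and "\<mu> \<in> radon_pos" "\<eta> \<in> Cc" "\<And>x. 0 \<le> \<eta> x"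
  shows "(\<lambda>\<phi>. if \<phi> \<in> Cc then \<mu> (\<lambda>x. \<eta> x * \<phi> x) else 0) \<in> radon_pos"
proof -
  have [simp]: "(\<lambda>x. \<eta> x * \<phi> x) \<in> Cc" if "\<phi> \<in> Cc" for \<phi>
    using that assms(3) by (intro Cc_mult Cc_continuous)
  have *: "\<mu> (\<lambda>x. \<eta> x * (c * \<phi> x)) = c * \<mu> (\<lambda>x. \<eta> x * \<phi> x)" if "\<phi> \<in> Cc" for c \<phi>
    using radon_scale[of \<mu> "\<lambda>x. \<eta> x * \<phi> x" c] that assms(2) by (simp add: radon_pos_radon algebra_simps)
  show ?thesis
  proof (rule radon_posI[OF lc])
    fix \<phi> :: "'a \<Rightarrow> real" assume "\<phi> \<in> Cc" "\<And>x. 0 \<le> \<phi> x"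
    then show "0 \<le> (if \<phi> \<in> Cc then \<mu> (\<lambda>x. \<eta> x * \<phi> x) else 0)"
      using radon_pos_nonneg[OF assms(2), of "\<lambda>x. \<eta> x * \<phi> x"] assms(4) by simp
  next
    fix \<phi> \<psi> :: "'a \<Rightarrow> real" assume "\<phi> \<in> Cc" "\<psi> \<in> Cc"
    then show "(if (\<lambda>x. \<phi> x + \<psi> x) \<in> Cc then \<mu> (\<lambda>x. \<eta> x * (\<phi> x + \<psi> x)) else 0) =
        (if \<phi> \<in> Cc then \<mu> (\<lambda>x. \<eta> x * \<phi> x) else 0) + (if \<psi> \<in> Cc then \<mu> (\<lambda>x. \<eta> x * \<psi> x) else 0)"
      using radon_add[OF radon_pos_radon[OF assms(2)], of "\<lambda>x. \<eta> x * \<phi> x" "\<lambda>x. \<eta> x * \<psi> x"]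
      by (simp add: distrib_left Cc_add)
  qed (simp_all add: * Cc_scale)
qed

section \<open>Integrals of lower semicontinuous functions\<close>

text \<open>Bourbaki's integral of a lower semicontinuous function. The test functions may take
  negative values, which accommodates functions that are merely bounded below on a compact
  space.\<close>

definition lsc_integral :: "'a::topological_space functional \<Rightarrow> ('a \<Rightarrow> ereal) \<Rightarrow> ereal" where
  "lsc_integral \<mu> g = (SUP \<phi>\<in>{\<phi> \<in> Cc. \<forall>x. ereal (\<phi> x) \<le> g x}. ereal (\<mu> \<phi>))"

definition directed :: "('a \<Rightarrow> real) set \<Rightarrow> bool" where
  "directed D \<longleftrightarrow> D \<noteq> {} \<and> (\<forall>a\<in>D. \<forall>b\<in>D. \<exists>c\<in>D. \<forall>x. a x \<le> c x \<and> b x \<le> c x)"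

lemma directed_finite:
  assumes "directed D" "finite S" "S \<subseteq> D"
  shows "\<exists>d\<in>D. \<forall>s\<in>S. \<forall>x. s x \<le> d x"
  using assms(2,3)
proof (induction S)
  case empty
  then show ?case using assms(1) by (auto simp: directed_def)
next
  case (insert s S)
  then obtain d where "d \<in> D" "\<forall>s\<in>S. \<forall>x. s x \<le> d x" by auto
  moreover obtain c where "c \<in> D" "\<forall>x. s x \<le> c x \<and> d x \<le> c x"
    using assms(1) insert.prems \<open>d \<in> D\<close> unfolding directed_def by (meson insert_subset)
  ultimately show ?case
    by (intro bexI[of _ c]) (auto intro: order_trans)
qed

text \<open>By Dini's theorem. This replaces countable monotone convergence for the nets of functions that
  define integrals on a space without a countable base.\<close>

lemma radon_pos_le_SUP_directed:
  fixes \<mu> :: "'a::t2_space functional"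
  assumes lc: "locally_compact_space (euclidean :: 'a topology)"
    and \<mu>: "\<mu> \<in> radon_pos" and D: "D \<subseteq> Cc" "directed D"
    and \<phi>: "\<phi> \<in> Cc" "\<And>x. ereal (\<phi> x) \<le> (SUP d\<in>D. ereal (d x))"
  shows "ereal (\<mu> \<phi>) \<le> (SUP d\<in>D. ereal (\<mu> d))"
proof (rule ereal_le_epsilon2)
  fix \<epsilon> :: real assume "0 < \<epsilon>"
  obtain d0 where d0: "d0 \<in> D" using D by (auto simp: directed_def)
  obtain K where K: "compact K" "\<And>x. x \<notin> K \<Longrightarrow> \<phi> x = 0" "\<And>x. x \<notin> K \<Longrightarrow> d0 x = 0"
    using Cc_support2[OF \<phi>(1), of d0] d0 D(1) by blast
  obtain \<beta> where \<beta>: "\<beta> \<in> Cc" "\<And>x. 0 \<le> \<beta> x" "\<And>x. x \<in> K \<Longrightarrow> \<beta> x = 1"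
    using Cc_bump[OF lc K(1) open_UNIV] by (metis UNIV_I subsetI)
  have \<mu>\<beta>: "0 \<le> \<mu> \<beta>" using \<mu> \<beta>(2) by (rule radon_pos_nonneg)
  \<comment> \<open>\<open>e\<close> is the uniform error allowed on \<open>K\<close>; dominated by
    \<open>e * \<beta>\<close>, it costs at most \<open>\<epsilon>\<close> after integration. The
    summand 1 covers the case \<open>\<mu> \<beta> = 0\<close>.\<close>
  define e where "e = \<epsilon> / (\<mu> \<beta> + 1)"
  have e: "0 < e" "e * \<mu> \<beta> \<le> \<epsilon>"
    using \<open>0 < \<epsilon>\<close> \<mu>\<beta> by (auto simp: e_def field_simps)
  have cover: "K \<subseteq> (\<Union>d\<in>D. {x. \<phi> x - d x < e})"
  proof
    fix x assume "x \<in> K"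
    have "ereal (\<phi> x - e) < (SUP d\<in>D. ereal (d x))"
      using \<phi>(2)[of x] e(1) by (intro less_le_trans[OF _ \<phi>(2)[of x]]) simp
    then show "x \<in> (\<Union>d\<in>D. {x. \<phi> x - d x < e})"
      by (auto simp: less_SUP_iff algebra_simps)
  qed
  have op: "open {x. \<phi> x - d x < e}" if "d \<in> D" for d
    using that D \<phi>(1) by (intro open_Collect_less continuous_on_diff continuous_on_const Cc_continuous) auto
  obtain S where S: "S \<subseteq> D" "finite S" "K \<subseteq> (\<Union>d\<in>S. {x. \<phi> x - d x < e})"
    by (rule compactE_image[of K D "\<lambda>d. {x. \<phi> x - d x < e}", OF K(1) op cover])
  \<comment> \<open>The cover controls \<phi> - d on \<open>K\<close> only. Including
    \<open>d0\<close>, which vanishes off \<open>K\<close>, makes \<open>d\<close> nonnegative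
    there, where \<open>\<phi>\<close> is 0.\<close>
  obtain d where d: "d \<in> D" "\<forall>s\<in>insert d0 S. \<forall>x. s x \<le> d x"
    using directed_finite[OF D(2), of "insert d0 S"] S d0 by auto
  have dC: "d \<in> Cc" using d D by auto
  have "\<phi> x \<le> d x + e * \<beta> x" for x
  proof (cases "x \<in> K")
    case True
    then obtain s where "s \<in> S" "\<phi> x - s x < e" using S by blast
    moreover have "s x \<le> d x" using d(2) \<open>s \<in> S\<close> by simp
    ultimately show ?thesis using \<beta>(3)[OF True] by simp
  next
    case False
    have "d0 x \<le> d x" using d(2) by simp
    moreover have "0 \<le> e * \<beta> x" using \<beta>(2)[of x] e(1) by simp
    ultimately show ?thesis using K(2,3)[OF False] by simp
  qed
  then have "\<mu> \<phi> \<le> \<mu> (\<lambda>x. d x + e * \<beta> x)"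
    by (intro radon_pos_mono[OF \<mu>] \<phi>(1) Cc_add dC Cc_scale \<beta>(1))
  also have "\<dots> = \<mu> d + e * \<mu> \<beta>"
    using radon_add[OF radon_pos_radon[OF \<mu>] dC Cc_scale[OF \<beta>(1)]]
      radon_scale[OF radon_pos_radon[OF \<mu>] \<beta>(1)] by simp
  also have "\<dots> \<le> \<mu> d + \<epsilon>" using e by simp
  finally have "ereal (\<mu> \<phi>) \<le> ereal (\<mu> d) + ereal \<epsilon>" by simp
  also have "\<dots> \<le> (SUP d\<in>D. ereal (\<mu> d)) + ereal \<epsilon>"
    by (intro add_right_mono SUP_upper d)
  finally show "ereal (\<mu> \<phi>) \<le> (SUP d\<in>D. ereal (\<mu> d)) + ereal \<epsilon>" .
qed

lemma lsc_integral_upper: "\<phi> \<in> Cc \<Longrightarrow> (\<And>x. ereal (\<phi> x) \<le> g x) \<Longrightarrow> ereal (\<mu> \<phi>) \<le> lsc_integral \<mu> g"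
  unfolding lsc_integral_def by (rule SUP_upper) auto

lemma lsc_integral_least:
  "(\<And>\<phi>. \<phi> \<in> Cc \<Longrightarrow> (\<And>x. ereal (\<phi> x) \<le> g x) \<Longrightarrow> ereal (\<mu> \<phi>) \<le> u) \<Longrightarrow> lsc_integral \<mu> g \<le> u"
  unfolding lsc_integral_def by (rule SUP_least) auto

lemma lsc_integral_mono: "(\<And>x. g x \<le> h x) \<Longrightarrow> lsc_integral \<mu> g \<le> lsc_integral \<mu> h"
  by (intro lsc_integral_least lsc_integral_upper) (auto intro: order_trans)

text \<open>The freedom to compute the supremum over any directed family with pointwise supremum
  \<open>g\<close> is what gives additivity in \<open>g\<close> and Fubini's theorem: there the
  natural test functions are sums and slices.\<close>

lemma lsc_integral_directed:
  fixes \<mu> :: "'a::t2_space functional"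
  assumes lc: "locally_compact_space (euclidean :: 'a topology)"
    and "\<mu> \<in> radon_pos" "D \<subseteq> Cc" "directed D" "\<And>x. g x = (SUP d\<in>D. ereal (d x))"
  shows "lsc_integral \<mu> g = (SUP d\<in>D. ereal (\<mu> d))"
proof (rule antisym)
  show "lsc_integral \<mu> g \<le> (SUP d\<in>D. ereal (\<mu> d))"
    using assms(5) by (intro lsc_integral_least radon_pos_le_SUP_directed[OF lc assms(2-4)]) auto
  show "(SUP d\<in>D. ereal (\<mu> d)) \<le> lsc_integral \<mu> g"
    using assms(3,5) by (intro SUP_least lsc_integral_upper) (auto intro: SUP_upper)
qed

lemma lsc_integral_Cc:
  fixes \<mu> :: "'a::t2_space functional"
  assumes "\<mu> \<in> radon_pos" "\<phi> \<in> Cc"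
  shows "lsc_integral \<mu> (\<lambda>x. ereal (\<phi> x)) = ereal (\<mu> \<phi>)"
  using assms by (intro antisym lsc_integral_least lsc_integral_upper) (auto intro: radon_pos_mono[OF assms(1)])

section \<open>The class \<open>Phi\<close> and additivity of the integral\<close>

lemma Phi_lsc: "g \<in> Phi \<Longrightarrow> open {x. a < g x}"
  and Phi_not_MInf: "g \<in> Phi \<Longrightarrow> g x \<noteq> -\<infinity>"
  by (auto simp: Phi_def)

text \<open>On a compact space finitely many of the open sets {g > -n} cover. The disjunction ties
  \<open>c\<close> to compactness so that the constant \<open>- c\<close> lies in \<open>Cc\<close>
  in either case.\<close>

lemma Phi_bounded_below:
  fixes g :: "'a::topological_space \<Rightarrow> ereal"
  assumes "g \<in> Phi"
  obtains c where "0 \<le> c" "c = 0 \<or> compact (UNIV :: 'a set)" "\<And>x. ereal (- c) \<le> g x"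
proof (cases "compact (UNIV :: 'a set)")
  case True
  have "UNIV \<subseteq> (\<Union>n::nat. {x. ereal (- real n) < g x})"
  proof
    fix x
    obtain n :: nat where "ereal (- real n) < g x"
    proof (cases "g x")
      case (real r)
      obtain n :: nat where "- r < real n" using reals_Archimedean2 by blast
      then show ?thesis using that real by (metis ereal_less(2) less_ereal.simps(1) minus_less_iff)
    next
      case PInf
      then show ?thesis using that by simp
    next
      case MInf
      then show ?thesis using assms Phi_not_MInf by blast
    qed
    then show "x \<in> (\<Union>n::nat. {x. ereal (- real n) < g x})" by blast
  qed
  then obtain S :: "nat set" where S: "finite S" "UNIV \<subseteq> (\<Union>n\<in>S. {x. ereal (- real n) < g x})"
    by (rule compactE_image[of UNIV UNIV "\<lambda>n::nat. {x. ereal (- real n) < g x}", OF True Phi_lsc[OF assms]])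
  have "ereal (- real (Max S)) \<le> g x" for x
  proof -
    obtain n where n: "n \<in> S" "ereal (- real n) < g x" using S by blast
    then have "- real (Max S) \<le> - real n" using S by simp
    then show ?thesis using n(2) by (meson ereal_less_eq(3) less_imp_le order_trans)
  qed
  then show ?thesis using that[of "real (Max S)"] True by simp
next
  case False
  then show ?thesis using assms that[of 0] by (auto simp: Phi_def zero_ereal_def)
qed

lemma below_directed:
  fixes g :: "'a::t2_space \<Rightarrow> ereal"
  assumes "g \<in> Phi"
  shows "directed {\<phi> \<in> Cc. \<forall>x. ereal (\<phi> x) \<le> g x}"
proof -
  obtain c where c: "0 \<le> c" "c = 0 \<or> compact (UNIV :: 'a set)" "\<And>x. ereal (- c) \<le> g x"
    using Phi_bounded_below[OF assms] by blast
  have "(\<lambda>_. - c) \<in> {\<phi> \<in> Cc. \<forall>x. ereal (\<phi> x) \<le> g x}"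
    using c Cc_const[of "- c"] by auto
  moreover have "\<exists>d\<in>{\<phi> \<in> Cc. \<forall>x. ereal (\<phi> x) \<le> g x}. \<forall>x. a x \<le> d x \<and> b x \<le> d x"
    if "a \<in> {\<phi> \<in> Cc. \<forall>x. ereal (\<phi> x) \<le> g x}" "b \<in> {\<phi> \<in> Cc. \<forall>x. ereal (\<phi> x) \<le> g x}" for a b
    using that by (intro bexI[of _ "\<lambda>x. max (a x) (b x)"]) (auto intro: Cc_max split: split_max)
  ultimately show ?thesis
    unfolding directed_def by blast
qed

lemma Phi_eq_SUP:
  fixes g :: "'a::t2_space \<Rightarrow> ereal"
  assumes lc: "locally_compact_space (euclidean :: 'a topology)" and g: "g \<in> Phi"
  shows "g x = (SUP \<phi>\<in>{\<phi> \<in> Cc. \<forall>x. ereal (\<phi> x) \<le> g x}. ereal (\<phi> x))"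
proof (rule antisym)
  obtain c where c: "0 \<le> c" "c = 0 \<or> compact (UNIV :: 'a set)" "\<And>x. ereal (- c) \<le> g x"
    using Phi_bounded_below[OF g] by blast
  have cC: "(\<lambda>_::'a. - c) \<in> Cc" using c Cc_const[of "- c"] by auto
  show "g x \<le> (SUP \<phi>\<in>{\<phi> \<in> Cc. \<forall>x. ereal (\<phi> x) \<le> g x}. ereal (\<phi> x))"
  proof (rule dense_le)
    fix a assume a: "a < g x"
    show "a \<le> (SUP \<phi>\<in>{\<phi> \<in> Cc. \<forall>x. ereal (\<phi> x) \<le> g x}. ereal (\<phi> x))"
    proof (cases "a \<le> ereal (- c)")
      case True
      then show ?thesis using cC c(3) by (intro SUP_upper2[of "\<lambda>_. - c"]) auto
    next
      case False
      then obtain r where r: "a = ereal r" "- c < r" using a by (cases a) auto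
      obtain \<beta> L where \<beta>: "\<beta> \<in> Cc" "\<And>x. 0 \<le> \<beta> x" "\<And>x. \<beta> x \<le> 1" "\<And>y. y \<in> {x} \<Longrightarrow> \<beta> y = 1"
        "compact L" "L \<subseteq> {y. a < g y}" "\<And>y. y \<notin> L \<Longrightarrow> \<beta> y = 0"
        using Cc_bump[OF lc _ Phi_lsc[OF g, of a], of "{x}"] a by auto
      \<comment> \<open>Rises from the global lower bound \<open>- c\<close> off \<open>L\<close> to
        the value \<open>r\<close>, that is \<open>a\<close>, at the given point; on
        \<open>L\<close> the function \<open>g\<close> exceeds \<open>a\<close> anyway.\<close>
      define \<phi> where "\<phi> y = - c + (r + c) * \<beta> y" for y
      have "ereal (\<phi> y) \<le> g y" for y
      proof (cases "y \<in> L")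
        case True
        have "(r + c) * \<beta> y \<le> (r + c) * 1" using \<beta>(3) r by (intro mult_left_mono) auto
        then have "ereal (\<phi> y) \<le> a" by (simp add: \<phi>_def r)
        then show ?thesis using True \<beta>(6) by (metis less_imp_le mem_Collect_eq order_trans subsetD)
      next
        case False
        then show ?thesis using \<beta>(7) c(3) by (simp add: \<phi>_def)
      qed
      moreover have "\<phi> \<in> Cc" unfolding \<phi>_def by (intro Cc_add cC Cc_scale \<beta>)
      moreover have "ereal (\<phi> x) = a" using \<beta>(4) r by (simp add: \<phi>_def)
      ultimately show ?thesis by (intro SUP_upper2[of \<phi>]) auto
    qed
  qed
qed (auto intro: SUP_least)

lemma lsc_integral_not_MInf:
  fixes g :: "'a::t2_space \<Rightarrow> ereal"
  assumes "g \<in> Phi"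
  shows "lsc_integral \<mu> g \<noteq> -\<infinity>"
proof -
  obtain \<phi> where "\<phi> \<in> Cc" "\<And>x. ereal (\<phi> x) \<le> g x"
    using below_directed[OF assms] by (auto simp: directed_def)
  then have "ereal (\<mu> \<phi>) \<le> lsc_integral \<mu> g" by (rule lsc_integral_upper)
  then show ?thesis by auto
qed

lemma SUP_add_SUP_ereal:
  fixes f g :: "_ \<Rightarrow> real"
  assumes "I \<noteq> {}" "J \<noteq> {}"
  shows "(SUP i\<in>I. ereal (f i)) + (SUP j\<in>J. ereal (g j)) = (SUP i\<in>I. SUP j\<in>J. ereal (f i + g j))"
proof -
  have "(SUP j\<in>J. ereal (g j)) \<noteq> -\<infinity>"
    using assms(2) by (metis MInfty_neq_ereal(1) SUP_eq_const bot_ereal_def ex_in_conv SUP_bot_conv(1))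
  then have "(SUP i\<in>I. ereal (f i)) + (SUP j\<in>J. ereal (g j)) = (SUP i\<in>I. ereal (f i) + (SUP j\<in>J. ereal (g j)))"
    using assms(1) by (simp add: SUP_ereal_add_left)
  also have "\<dots> = (SUP i\<in>I. SUP j\<in>J. ereal (f i + g j))"
    using SUP_ereal_add_right[OF assms(2), of "ereal (f _)" "\<lambda>j. ereal (g j)"] by simp
  finally show ?thesis .
qed

text \<open>Subadditivity holds test function by test function. For the converse, two test
  functions, one for each measure, are replaced by a common upper bound below
  \<open>g\<close>.\<close>

lemma lsc_integral_add_measure:
  fixes \<mu> \<nu> :: "'a::t2_space functional"
  assumes "\<mu> \<in> radon_pos" "\<nu> \<in> radon_pos" "g \<in> Phi"
  shows "lsc_integral (\<lambda>\<phi>. \<mu> \<phi> + \<nu> \<phi>) g = lsc_integral \<mu> g + lsc_integral \<nu> g"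
proof (rule antisym)
  show "lsc_integral (\<lambda>\<phi>. \<mu> \<phi> + \<nu> \<phi>) g \<le> lsc_integral \<mu> g + lsc_integral \<nu> g"
  proof (rule lsc_integral_least)
    fix \<phi> :: "'a \<Rightarrow> real" assume "\<phi> \<in> Cc" "\<And>x. ereal (\<phi> x) \<le> g x"
    then show "ereal (\<mu> \<phi> + \<nu> \<phi>) \<le> lsc_integral \<mu> g + lsc_integral \<nu> g"
      unfolding plus_ereal.simps(1)[symmetric] by (intro add_mono lsc_integral_upper)
  qed
  let ?D = "{\<phi> \<in> Cc. \<forall>x. ereal (\<phi> x) \<le> g x}"
  have ne: "?D \<noteq> {}" and dir: "directed ?D"
    using below_directed[OF assms(3)] by (auto simp: directed_def)
  have "ereal (\<mu> \<phi> + \<nu> \<psi>) \<le> lsc_integral (\<lambda>\<phi>. \<mu> \<phi> + \<nu> \<phi>) g" if "\<phi> \<in> ?D" "\<psi> \<in> ?D" for \<phi> \<psi>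
  proof -
    obtain \<eta> where \<eta>: "\<eta> \<in> ?D" "\<forall>x. \<phi> x \<le> \<eta> x \<and> \<psi> x \<le> \<eta> x"
      using dir \<open>\<phi> \<in> ?D\<close> \<open>\<psi> \<in> ?D\<close> unfolding directed_def by blast
    have "ereal (\<mu> \<phi> + \<nu> \<psi>) \<le> ereal (\<mu> \<eta> + \<nu> \<eta>)"
      unfolding ereal_less_eq using that \<eta>
      by (intro add_mono radon_pos_mono[OF assms(1)] radon_pos_mono[OF assms(2)]) auto
    also have "\<dots> \<le> lsc_integral (\<lambda>\<phi>. \<mu> \<phi> + \<nu> \<phi>) g"
      using \<eta> by (intro lsc_integral_upper) auto
    finally show ?thesis .
  qed
  then show "lsc_integral \<mu> g + lsc_integral \<nu> g \<le> lsc_integral (\<lambda>\<phi>. \<mu> \<phi> + \<nu> \<phi>) g"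
    unfolding lsc_integral_def[of \<mu>] lsc_integral_def[of \<nu>] SUP_add_SUP_ereal[OF ne ne]
    by (intro SUP_least) auto
qed

lemma lsc_integral_scale_measure:
  fixes \<mu> :: "'a::t2_space functional"
  assumes "g \<in> Phi" "0 \<le> c"
  shows "lsc_integral (\<lambda>\<phi>. c * \<mu> \<phi>) g = ereal c * lsc_integral \<mu> g"
  unfolding lsc_integral_def
  using below_directed[OF assms(1)] assms(2) by (subst Sup_ereal_mult_left') (auto simp: directed_def)

lemma Phi_add:
  fixes g h :: "'a::topological_space \<Rightarrow> ereal"
  assumes "g \<in> Phi" "h \<in> Phi"
  shows "(\<lambda>x. g x + h x) \<in> Phi"
proof -
  have eq: "{x. a < g x + h x} = (\<Union>(p,q)\<in>{(p,q). a < p + q \<and> p \<noteq> -\<infinity> \<and> q \<noteq> -\<infinity>}. {x. p < g x} \<inter> {x. q < h x})" for a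
  proof (intro equalityI subsetI)
    fix x assume "x \<in> {x. a < g x + h x}"
    then have lt: "a < g x + h x" by simp
    have fin: "g x \<noteq> -\<infinity>" "h x \<noteq> -\<infinity>" using assms Phi_not_MInf by auto
    have "\<exists>p q::real. a < ereal p + ereal q \<and> ereal p < g x \<and> ereal q < h x"
    proof -
      obtain r where r: "a < ereal r" "ereal r < g x + h x"
        using lt ereal_dense2 by blast
      show ?thesis
      proof (cases "g x"; cases "h x")
        \<comment> \<open>The slack u + v - r is shared equally, so that the two bounds add up to r,
          which exceeds \<open>a\<close>.\<close>
        fix u v assume "g x = ereal u" "h x = ereal v"
        then show ?thesis using r
          by (intro exI[of _ "u - (u + v - r)/2"] exI[of _ "v - (u + v - r)/2"]) (auto simp: field_simps)
      next
        fix u assume "g x = ereal u" "h x = \<infinity>"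
        then show ?thesis using r by (intro exI[of _ "u - 1"] exI[of _ "r - u + 1"]) auto
      next
        fix v assume "g x = \<infinity>" "h x = ereal v"
        then show ?thesis using r by (intro exI[of _ "r - v + 1"] exI[of _ "v - 1"]) auto
      next
        assume "g x = \<infinity>" "h x = \<infinity>"
        then show ?thesis using r by (intro exI[of _ r] exI[of _ 0]) auto
      qed (use fin in auto)
    qed
    then show "x \<in> (\<Union>(p,q)\<in>{(p,q). a < p + q \<and> p \<noteq> -\<infinity> \<and> q \<noteq> -\<infinity>}. {x. p < g x} \<inter> {x. q < h x})"
      by fastforce
  next
    fix x assume "x \<in> (\<Union>(p,q)\<in>{(p,q). a < p + q \<and> p \<noteq> -\<infinity> \<and> q \<noteq> -\<infinity>}. {x. p < g x} \<inter> {x. q < h x})"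
    then obtain p q where "a < p + q" "p < g x" "q < h x" by auto
    then show "x \<in> {x. a < g x + h x}"
      using add_mono[of p "g x" q "h x"] by (auto intro: less_le_trans)
  qed
  have "open {x. a < g x + h x}" for a
    unfolding eq using assms by (auto intro!: open_UN open_Int Phi_lsc)
  then show ?thesis
    using assms by (auto simp: Phi_def intro: add_nonneg_nonneg)
qed

text \<open>No test function below \<open>g + h\<close> has to be split into two. The sums of test
  functions below \<open>g\<close> and below \<open>h\<close> form a directed family with supremum
  \<open>g + h\<close>, and any such family computes the integral.\<close>

lemma lsc_integral_add:
  fixes \<mu> :: "'a::t2_space functional"
  assumes lc: "locally_compact_space (euclidean :: 'a topology)"
    and \<mu>: "\<mu> \<in> radon_pos" and g: "g \<in> Phi" and h: "h \<in> Phi"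
  shows "lsc_integral \<mu> (\<lambda>x. g x + h x) = lsc_integral \<mu> g + lsc_integral \<mu> h"
proof -
  let ?G = "{\<phi> \<in> Cc. \<forall>x. ereal (\<phi> x) \<le> g x}" and ?H = "{\<phi> \<in> Cc. \<forall>x. ereal (\<phi> x) \<le> h x}"
  have dir: "directed ?G" "directed ?H" and ne: "?G \<noteq> {}" "?H \<noteq> {}"
    using below_directed[OF g] below_directed[OF h] by (auto simp: directed_def)
  define D where "D = (\<lambda>(\<phi>, \<psi>). \<lambda>x. \<phi> x + \<psi> x) ` (?G \<times> ?H)"
  have "directed D"
    unfolding directed_def
  proof safe
    assume "D = {}"
    then show False using ne by (auto simp: D_def)
  next
    fix a b assume "a \<in> D" "b \<in> D"
    then obtain \<phi>1 \<psi>1 \<phi>2 \<psi>2 where *: "\<phi>1 \<in> ?G" "\<psi>1 \<in> ?H" "\<phi>2 \<in> ?G" "\<psi>2 \<in> ?H"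
      "a = (\<lambda>x. \<phi>1 x + \<psi>1 x)" "b = (\<lambda>x. \<phi>2 x + \<psi>2 x)" by (auto simp: D_def)
    obtain \<phi> where "\<phi> \<in> ?G" "\<forall>x. \<phi>1 x \<le> \<phi> x \<and> \<phi>2 x \<le> \<phi> x"
      using dir(1) *(1,3) unfolding directed_def by blast
    moreover obtain \<psi> where "\<psi> \<in> ?H" "\<forall>x. \<psi>1 x \<le> \<psi> x \<and> \<psi>2 x \<le> \<psi> x"
      using dir(2) *(2,4) unfolding directed_def by blast
    ultimately show "\<exists>c\<in>D. \<forall>x. a x \<le> c x \<and> b x \<le> c x"
      using * by (intro bexI[of _ "\<lambda>x. \<phi> x + \<psi> x"]) (auto simp: D_def add_mono)
  qed
  moreover have "D \<subseteq> Cc" by (auto simp: D_def intro: Cc_add)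
  moreover have "g x + h x = (SUP d\<in>D. ereal (d x))" for x
  proof -
    have "g x + h x = (SUP \<phi>\<in>?G. SUP \<psi>\<in>?H. ereal (\<phi> x + \<psi> x))"
      unfolding Phi_eq_SUP[OF lc g, of x] Phi_eq_SUP[OF lc h, of x] SUP_add_SUP_ereal[OF ne] ..
    also have "\<dots> = (SUP d\<in>D. ereal (d x))"
      unfolding D_def image_image SUP_pair by (simp add: case_prod_beta)
    finally show ?thesis .
  qed
  ultimately have "lsc_integral \<mu> (\<lambda>x. g x + h x) = (SUP d\<in>D. ereal (\<mu> d))"
    by (intro lsc_integral_directed[OF lc \<mu>]) auto
  also have "\<dots> = (SUP \<phi>\<in>?G. SUP \<psi>\<in>?H. ereal (\<mu> \<phi> + \<mu> \<psi>))"
    unfolding D_def image_image SUP_pair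
    using \<mu> by (intro SUP_cong refl) (auto simp: radon_add radon_pos_radon)
  also have "\<dots> = lsc_integral \<mu> g + lsc_integral \<mu> h"
    unfolding lsc_integral_def SUP_add_SUP_ereal[OF ne] ..
  finally show ?thesis .
qed

lemma Phi_indicator:
  assumes "open U"
  shows "(\<lambda>x::'a::topological_space. indicator U x :: ereal) \<in> Phi"
proof -
  have "open {x. a < (indicator U x :: ereal)}" for a
  proof -
    have "{x. a < (indicator U x :: ereal)} = (if a < 0 then UNIV else if a < 1 then U else {})"
      using order.strict_trans[of a 0 1] by (auto simp: indicator_def)
    then show ?thesis using assms by simp
  qed
  then show ?thesis by (simp add: Phi_def indicator_def)
qed

lemma Phi_const:
  assumes "0 \<le> c \<or> compact (UNIV :: 'a::topological_space set)"
  shows "(\<lambda>x::'a. ereal c) \<in> Phi"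
  using assms by (auto simp: Phi_def)

lemma Phi_zero: "(\<lambda>x::'a::topological_space. 0) \<in> Phi"
  using Phi_const[of 0] by (simp add: zero_ereal_def)

lemma Phi_scale:
  fixes g :: "'a::topological_space \<Rightarrow> ereal"
  assumes "g \<in> Phi" "0 < c"
  shows "(\<lambda>x. ereal c * g x) \<in> Phi"
proof -
  have "a < ereal c * t \<longleftrightarrow> a / ereal c < t" for a t
    using assms(2) by (simp add: ereal_divide_less_iff ereal_less_divide_iff mult.commute)
  then have "open {x. a < ereal c * g x}" for a
    using Phi_lsc[OF assms(1)] by simp
  moreover have "ereal c * g x \<noteq> -\<infinity>" for x
    using Phi_not_MInf[OF assms(1), of x] assms(2) by (cases "g x") auto
  moreover have "0 \<le> ereal c * g x" if "0 \<le> g x" for x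
    using that assms(2) by simp
  ultimately show ?thesis
    using assms(1) by (simp add: Phi_def)
qed

lemma lsc_integral_scale:
  fixes \<mu> :: "'a::t2_space functional"
  assumes \<mu>: "\<mu> \<in> radon_pos" and c: "0 < c"
  shows "lsc_integral \<mu> (\<lambda>x. ereal c * g x) = ereal c * lsc_integral \<mu> g"
proof -
  \<comment> \<open>Proved for all factors and functions, because the converse inequality is the
    same one applied to the factor \<open>1/c\<close> and the function \<open>c * g\<close>.\<close>
  have le: "ereal c * lsc_integral \<mu> g \<le> lsc_integral \<mu> (\<lambda>x. ereal c * g x)" if c: "0 < c" for c g
  proof -
    have "lsc_integral \<mu> g \<le> lsc_integral \<mu> (\<lambda>x. ereal c * g x) / ereal c"
    proof (rule lsc_integral_least)
      fix \<phi> :: "'a \<Rightarrow> real" assume \<phi>: "\<phi> \<in> Cc" "\<And>x. ereal (\<phi> x) \<le> g x"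
      have "ereal (\<mu> (\<lambda>x. c * \<phi> x)) \<le> lsc_integral \<mu> (\<lambda>x. ereal c * g x)"
      proof (rule lsc_integral_upper)
        show "(\<lambda>x. c * \<phi> x) \<in> Cc" using \<phi>(1) by (rule Cc_scale)
        show "ereal (c * \<phi> x) \<le> ereal c * g x" for x
          using ereal_mult_left_mono[OF \<phi>(2)[of x], of "ereal c"] c by simp
      qed
      then show "ereal (\<mu> \<phi>) \<le> lsc_integral \<mu> (\<lambda>x. ereal c * g x) / ereal c"
        using c radon_scale[OF radon_pos_radon[OF \<mu>] \<phi>(1), of c]
        by (simp add: ereal_le_divide_pos mult.commute)
    qed
    then show ?thesis using c by (simp add: ereal_le_divide_pos mult.commute)
  qed
  have "ereal (1/c) * lsc_integral \<mu> (\<lambda>x. ereal c * g x) \<le> lsc_integral \<mu> (\<lambda>x. ereal (1/c) * (ereal c * g x))"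
    using c by (intro le) auto
  also have "(\<lambda>x. ereal (1/c) * (ereal c * g x)) = g"
    using c by (simp add: mult.assoc[symmetric] one_ereal_def[symmetric])
  finally have "ereal c * (ereal (1/c) * lsc_integral \<mu> (\<lambda>x. ereal c * g x)) \<le> ereal c * lsc_integral \<mu> g"
    using c by (intro ereal_mult_left_mono) auto
  then have "lsc_integral \<mu> (\<lambda>x. ereal c * g x) \<le> ereal c * lsc_integral \<mu> g"
    using c by (simp add: mult.assoc[symmetric] one_ereal_def[symmetric])
  then show ?thesis using le[OF c] by (intro antisym)
qed

lemma lsc_integral_zero:
  fixes \<mu> :: "'a::t2_space functional"
  assumes "\<mu> \<in> radon_pos"
  shows "lsc_integral \<mu> (\<lambda>x. 0) = 0"
  using lsc_integral_Cc[OF assms Cc_zero] radon_zero[OF radon_pos_radon[OF assms]]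
  by (simp add: zero_ereal_def)

lemma lsc_integral_nonneg:
  fixes \<mu> :: "'a::t2_space functional"
  assumes "\<mu> \<in> radon_pos" "\<And>x. 0 \<le> g x"
  shows "0 \<le> lsc_integral \<mu> g"
  using lsc_integral_mono[of "\<lambda>x. 0" g \<mu>, OF assms(2)] lsc_integral_zero[OF assms(1)] by simp

section \<open>The Riesz representation\<close>

definition open_mass :: "'a::topological_space functional \<Rightarrow> 'a set \<Rightarrow> ennreal" where
  "open_mass \<mu> U = (SUP \<phi>\<in>{\<phi> \<in> Cc. \<forall>x. 0 \<le> \<phi> x \<and> \<phi> x \<le> indicator U x}. ennreal (\<mu> \<phi>))"

text \<open>Kept as a function on all subsets, so that \<open>K - A\<close> has an outer mass for
  arbitrary \<open>A\<close>; \<open>borel_measure\<close> retains only the values on Borel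
  sets.\<close>

definition outer_mass :: "'a::topological_space functional \<Rightarrow> 'a set \<Rightarrow> ennreal" where
  "outer_mass \<mu> A = (INF U\<in>{U. open U \<and> A \<subseteq> U}. open_mass \<mu> U)"

lemma borel_measure_eq: "borel_measure \<mu> = measure_of UNIV (sets borel) (outer_mass \<mu>)"
  unfolding borel_measure_def outer_mass_def open_mass_def ..

lemma open_mass_mono: "U \<subseteq> V \<Longrightarrow> open_mass \<mu> U \<le> open_mass \<mu> V"
  unfolding open_mass_def
proof (rule SUP_subset_mono)
  assume "U \<subseteq> V"
  then have "indicator U x \<le> (indicator V x :: real)" for x by (auto simp: indicator_def)
  then show "{\<phi> \<in> Cc. \<forall>x. 0 \<le> \<phi> x \<and> \<phi> x \<le> indicator U x} \<subseteq> {\<phi> \<in> Cc. \<forall>x. 0 \<le> \<phi> x \<and> \<phi> x \<le> indicator V x}"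
    by (blast intro: order_trans)
qed simp

lemma outer_mass_open: "open U \<Longrightarrow> outer_mass \<mu> U = open_mass \<mu> U"
  unfolding outer_mass_def by (intro antisym INF_lower INF_greatest open_mass_mono) auto

lemma outer_mass_le: "open U \<Longrightarrow> A \<subseteq> U \<Longrightarrow> outer_mass \<mu> A \<le> open_mass \<mu> U"
  unfolding outer_mass_def by (intro INF_lower) auto

lemma outer_mass_less: "outer_mass \<mu> A < r \<Longrightarrow> \<exists>U. open U \<and> A \<subseteq> U \<and> open_mass \<mu> U < r"
  unfolding outer_mass_def INF_less_iff by simp

lemma outer_mass_mono: "A \<subseteq> B \<Longrightarrow> outer_mass \<mu> A \<le> outer_mass \<mu> B"
  unfolding outer_mass_def by (rule INF_superset_mono) auto

text \<open>Passing to the positive part keeps a test function below the indicator and does not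
  decrease its integral. Through this identity open sets inherit the additivity of
  \<open>lsc_integral\<close>.\<close>

lemma enn2ereal_open_mass:
  fixes \<mu> :: "'a::t2_space functional"
  assumes \<mu>: "\<mu> \<in> radon_pos"
  shows "enn2ereal (open_mass \<mu> U) = lsc_integral \<mu> (\<lambda>x. indicator U x)"
proof (rule antisym)
  have 0: "0 \<le> lsc_integral \<mu> (\<lambda>x. indicator U x)"
    by (rule lsc_integral_nonneg[OF \<mu>]) simp
  have "open_mass \<mu> U \<le> e2ennreal (lsc_integral \<mu> (\<lambda>x. indicator U x))"
    unfolding open_mass_def
  proof (rule SUP_least)
    fix \<phi> assume "\<phi> \<in> {\<phi> \<in> Cc. \<forall>x. 0 \<le> \<phi> x \<and> \<phi> x \<le> indicator U x}"
    then have \<phi>: "\<phi> \<in> Cc" "\<And>x. \<phi> x \<le> indicator U x" by auto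
    have "ereal (\<mu> \<phi>) \<le> lsc_integral \<mu> (\<lambda>x. indicator U x)"
    proof (rule lsc_integral_upper[OF \<phi>(1)])
      show "ereal (\<phi> x) \<le> indicator U x" for x
        using \<phi>(2)[of x] by (auto simp: indicator_def one_ereal_def zero_ereal_def split: if_splits)
    qed
    then have "e2ennreal (ereal (\<mu> \<phi>)) \<le> e2ennreal (lsc_integral \<mu> (\<lambda>x. indicator U x))"
      by (rule e2ennreal_mono)
    then show "ennreal (\<mu> \<phi>) \<le> e2ennreal (lsc_integral \<mu> (\<lambda>x. indicator U x))" by simp
  qed
  then have "enn2ereal (open_mass \<mu> U) \<le> enn2ereal (e2ennreal (lsc_integral \<mu> (\<lambda>x. indicator U x)))"
    by (simp add: less_eq_ennreal.rep_eq)
  then show "enn2ereal (open_mass \<mu> U) \<le> lsc_integral \<mu> (\<lambda>x. indicator U x)"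
    using 0 by (simp add: enn2ereal_e2ennreal)
  show "lsc_integral \<mu> (\<lambda>x. indicator U x) \<le> enn2ereal (open_mass \<mu> U)"
  proof (rule lsc_integral_least)
    fix \<phi> :: "'a \<Rightarrow> real" assume \<phi>: "\<phi> \<in> Cc" "\<And>x. ereal (\<phi> x) \<le> indicator U x"
    have 1: "max 0 (\<phi> x) \<le> indicator U x" for x
      using \<phi>(2)[of x] by (auto simp: indicator_def one_ereal_def zero_ereal_def split: if_splits)
    have "ennreal (\<mu> (\<lambda>x. max 0 (\<phi> x))) \<le> open_mass \<mu> U"
      unfolding open_mass_def using 1 Cc_pos[OF \<phi>(1)] by (intro SUP_upper) auto
    then have "ereal (\<mu> (\<lambda>x. max 0 (\<phi> x))) \<le> enn2ereal (open_mass \<mu> U)"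
      using radon_pos_nonneg[OF \<mu>, of "\<lambda>x. max 0 (\<phi> x)"]
      by (simp add: less_eq_ennreal.rep_eq)
    moreover have "\<mu> \<phi> \<le> \<mu> (\<lambda>x. max 0 (\<phi> x))"
      by (rule radon_pos_mono[OF \<mu> \<phi>(1) Cc_pos[OF \<phi>(1)]]) simp
    ultimately show "ereal (\<mu> \<phi>) \<le> enn2ereal (open_mass \<mu> U)"
      by (meson ereal_less_eq(3) order_trans)
  qed
qed

lemma open_mass_eq:
  fixes \<mu> :: "'a::t2_space functional"
  assumes "\<mu> \<in> radon_pos"
  shows "open_mass \<mu> U = e2ennreal (lsc_integral \<mu> (\<lambda>x. indicator U x))"
  using enn2ereal_open_mass[OF assms, of U] by (metis e2ennreal_enn2ereal)

lemma open_mass_empty: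
  fixes \<mu> :: "'a::t2_space functional"
  assumes "\<mu> \<in> radon_pos"
  shows "open_mass \<mu> {} = 0"
  using lsc_integral_zero[OF assms] by (simp add: open_mass_eq[OF assms] e2ennreal_neg)

lemma open_mass_Un:
  fixes \<mu> :: "'a::t2_space functional"
  assumes lc: "locally_compact_space (euclidean :: 'a topology)"
    and \<mu>: "\<mu> \<in> radon_pos" and "open U" "open V"
  shows "open_mass \<mu> (U \<union> V) \<le> open_mass \<mu> U + open_mass \<mu> V"
proof -
  have "lsc_integral \<mu> (\<lambda>x. indicator (U \<union> V) x) \<le> lsc_integral \<mu> (\<lambda>x. indicator U x + indicator V x)"
    by (rule lsc_integral_mono) (auto simp: indicator_def)
  also have "\<dots> = lsc_integral \<mu> (\<lambda>x. indicator U x) + lsc_integral \<mu> (\<lambda>x. indicator V x)"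
    by (rule lsc_integral_add[OF lc \<mu> Phi_indicator Phi_indicator]) fact+
  finally show ?thesis
    unfolding enn2ereal_open_mass[OF \<mu>, symmetric] by (simp add: less_eq_ennreal.rep_eq plus_ennreal.rep_eq)
qed

text \<open>The test functions in \<open>open_mass\<close> vanish off \<open>U\<close>, but their
  closed supports may meet the boundary. Those vanishing off a compact subset of \<open>U\<close>
  still form a directed family with supremum the indicator. Countable unions need the compact set
  for a finite subcover, Caratheodory's condition needs the open complement.\<close>

lemma open_mass_compact_support:
  fixes \<mu> :: "'a::t2_space functional"
  assumes lc: "locally_compact_space (euclidean :: 'a topology)"
    and \<mu>: "\<mu> \<in> radon_pos" and U: "open U"
  shows "open_mass \<mu> U = (SUP \<phi>\<in>{\<phi> \<in> Cc. (\<forall>x. 0 \<le> \<phi> x \<and> \<phi> x \<le> 1) \<and>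
    (\<exists>L. compact L \<and> L \<subseteq> U \<and> (\<forall>x. x \<notin> L \<longrightarrow> \<phi> x = 0))}. ennreal (\<mu> \<phi>))"
    (is "_ = (SUP \<phi>\<in>?D. _)")
proof (rule antisym)
  have "directed ?D"
    unfolding directed_def
  proof (intro conjI ballI)
    have "(\<lambda>_. 0) \<in> ?D" by (auto intro!: exI[of _ "{}"])
    then show "?D \<noteq> {}" by blast
    fix a b assume "a \<in> ?D" "b \<in> ?D"
    then obtain K L where a: "a \<in> Cc" "\<And>x. 0 \<le> a x" "\<And>x. a x \<le> 1" "compact K" "K \<subseteq> U" "\<And>x. x \<notin> K \<Longrightarrow> a x = 0"
      and b: "b \<in> Cc" "\<And>x. 0 \<le> b x" "\<And>x. b x \<le> 1" "compact L" "L \<subseteq> U" "\<And>x. x \<notin> L \<Longrightarrow> b x = 0"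
      by blast
    have "compact (K \<union> L) \<and> K \<union> L \<subseteq> U \<and> (\<forall>x. x \<notin> K \<union> L \<longrightarrow> max (a x) (b x) = 0)"
      using a b by auto
    then have "(\<lambda>x. max (a x) (b x)) \<in> ?D"
      using a b by (blast intro: Cc_max max.boundedI order_trans[OF _ max.cobounded1])
    then show "\<exists>c\<in>?D. \<forall>x. a x \<le> c x \<and> b x \<le> c x" by (rule bexI[rotated]) simp
  qed
  moreover have "indicator U x = (SUP d\<in>?D. ereal (d x))" for x
  proof (rule antisym)
    show "indicator U x \<le> (SUP d\<in>?D. ereal (d x))"
    proof (cases "x \<in> U")
      case True
      have c: "compact {x}" "{x} \<subseteq> U" using True by auto
      obtain \<beta> L where \<beta>: "\<beta> \<in> Cc" "\<And>x. 0 \<le> \<beta> x" "\<And>x. \<beta> x \<le> 1" "\<And>y. y \<in> {x} \<Longrightarrow> \<beta> y = 1"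
        "compact L" "L \<subseteq> U" "\<And>x. x \<notin> L \<Longrightarrow> \<beta> x = 0"
        using Cc_bump[OF lc c(1) U c(2)] by blast
      then have "\<beta> \<in> ?D" by blast
      then show ?thesis using \<beta>(4)[of x] True by (intro SUP_upper2[of \<beta>]) (auto simp: one_ereal_def)
    next
      case False
      have "(\<lambda>_. 0) \<in> ?D" by (auto intro!: exI[of _ "{}"])
      then show ?thesis using False by (intro SUP_upper2[of "\<lambda>_. 0"]) (auto simp: zero_ereal_def)
    qed
    show "(SUP d\<in>?D. ereal (d x)) \<le> indicator U x"
      by (rule SUP_least) (auto simp: indicator_def one_ereal_def)
  qed
  moreover have "?D \<subseteq> Cc" by auto
  ultimately have *: "lsc_integral \<mu> (\<lambda>x. indicator U x) = (SUP d\<in>?D. ereal (\<mu> d))"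
    by (intro lsc_integral_directed[OF lc \<mu>])
  have "enn2ereal (open_mass \<mu> U) \<le> enn2ereal (SUP \<phi>\<in>?D. ennreal (\<mu> \<phi>))"
    unfolding enn2ereal_open_mass[OF \<mu>] *
  proof (rule SUP_least)
    fix d assume d: "d \<in> ?D"
    then have "0 \<le> \<mu> d" by (intro radon_pos_nonneg[OF \<mu>]) blast
    moreover have "ennreal (\<mu> d) \<le> (SUP \<phi>\<in>?D. ennreal (\<mu> \<phi>))" using d by (rule SUP_upper)
    ultimately show "ereal (\<mu> d) \<le> enn2ereal (SUP \<phi>\<in>?D. ennreal (\<mu> \<phi>))"
      by (simp add: less_eq_ennreal.rep_eq)
  qed
  then show "open_mass \<mu> U \<le> (SUP \<phi>\<in>?D. ennreal (\<mu> \<phi>))"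
    by (simp add: less_eq_ennreal.rep_eq)
  show "(SUP \<phi>\<in>?D. ennreal (\<mu> \<phi>)) \<le> open_mass \<mu> U"
    unfolding open_mass_def
    by (rule SUP_subset_mono) (auto simp: indicator_def)
qed

text \<open>A test function that vanishes off a compact subset of the union sees only finitely many
  of the \<open>U i\<close>, which reduces the claim to finite subadditivity.\<close>

lemma open_mass_UN:
  fixes \<mu> :: "'a::t2_space functional" and U :: "nat \<Rightarrow> 'a set"
  assumes lc: "locally_compact_space (euclidean :: 'a topology)"
    and \<mu>: "\<mu> \<in> radon_pos" and U: "\<And>i. open (U i)"
  shows "open_mass \<mu> (\<Union>i. U i) \<le> (\<Sum>i. open_mass \<mu> (U i))"
proof -
  have fin: "open_mass \<mu> (\<Union>i<n. U i) \<le> (\<Sum>i<n. open_mass \<mu> (U i))" for n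
  proof (induction n)
    case 0
    then show ?case using open_mass_empty[OF \<mu>] by simp
  next
    case (Suc n)
    have "open_mass \<mu> (\<Union>i<Suc n. U i) = open_mass \<mu> ((\<Union>i<n. U i) \<union> U n)"
      by (simp add: lessThan_Suc Un_commute)
    also have "\<dots> \<le> open_mass \<mu> (\<Union>i<n. U i) + open_mass \<mu> (U n)"
      using U by (intro open_mass_Un[OF lc \<mu>]) auto
    also have "\<dots> \<le> (\<Sum>i<n. open_mass \<mu> (U i)) + open_mass \<mu> (U n)"
      using Suc by (rule add_right_mono)
    finally show ?case by simp
  qed
  have "open (\<Union>i. U i)" using U by blast
  show ?thesis
    unfolding open_mass_compact_support[OF lc \<mu> \<open>open (\<Union>i. U i)\<close>]
  proof (rule SUP_least)
    fix \<phi> assume "\<phi> \<in> {\<phi> \<in> Cc. (\<forall>x. 0 \<le> \<phi> x \<and> \<phi> x \<le> 1) \<and>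
      (\<exists>L. compact L \<and> L \<subseteq> (\<Union>i. U i) \<and> (\<forall>x. x \<notin> L \<longrightarrow> \<phi> x = 0))}"
    then obtain L where \<phi>: "\<phi> \<in> Cc" "\<And>x. 0 \<le> \<phi> x" "\<And>x. \<phi> x \<le> 1"
      and L: "compact L" "L \<subseteq> (\<Union>i. U i)" "\<And>x. x \<notin> L \<Longrightarrow> \<phi> x = 0" by blast
    obtain S :: "nat set" where S: "S \<subseteq> UNIV" "finite S" "L \<subseteq> (\<Union>i\<in>S. U i)"
      by (rule compactE_image[of L UNIV U, OF L(1) U L(2)])
    obtain n where n: "S \<subseteq> {..<n}" using finite_nat_bounded[OF S(2)] by blast
    have "\<phi> x \<le> indicator (\<Union>i<n. U i) x" for x
    proof (cases "x \<in> L")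
      case True
      then have "x \<in> (\<Union>i<n. U i)" using S(3) n by blast
      then show ?thesis using \<phi>(3) by simp
    next
      case False
      then show ?thesis using L(3) by simp
    qed
    then have "ennreal (\<mu> \<phi>) \<le> open_mass \<mu> (\<Union>i<n. U i)"
      unfolding open_mass_def using \<phi> by (intro SUP_upper) auto
    also have "\<dots> \<le> (\<Sum>i<n. open_mass \<mu> (U i))" by (rule fin)
    also have "\<dots> \<le> (\<Sum>i. open_mass \<mu> (U i))" by (rule sum_le_suminf) auto
    finally show "ennreal (\<mu> \<phi>) \<le> (\<Sum>i. open_mass \<mu> (U i))" .
  qed
qed

lemma outer_mass_UN:
  fixes \<mu> :: "'a::t2_space functional" and A :: "nat \<Rightarrow> 'a set"
  assumes lc: "locally_compact_space (euclidean :: 'a topology)"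
    and \<mu>: "\<mu> \<in> radon_pos"
  shows "outer_mass \<mu> (\<Union>i. A i) \<le> (\<Sum>i. outer_mass \<mu> (A i))"
proof (rule ennreal_le_epsilon)
  fix e :: real assume e: "0 < e" and fin: "(\<Sum>i. outer_mass \<mu> (A i)) < top"
  have "\<exists>U. open U \<and> A i \<subseteq> U \<and> open_mass \<mu> U \<le> outer_mass \<mu> (A i) + ennreal (e * (1/2)^Suc i)" for i
  proof -
    have "outer_mass \<mu> (A i) \<noteq> top"
      using fin ennreal_suminf_lessD[of "\<lambda>i. outer_mass \<mu> (A i)" top i] by (simp add: less_top)
    moreover have "0 < ennreal (e * (1/2)^Suc i)" using e by (simp add: ennreal_zero_less_mult_iff)
    ultimately have "outer_mass \<mu> (A i) < outer_mass \<mu> (A i) + ennreal (e * (1/2)^Suc i)"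
      using ennreal_add_left_cancel_less[of "outer_mass \<mu> (A i)" 0] by simp
    then show ?thesis using outer_mass_less[of \<mu> "A i"] by (meson less_imp_le)
  qed
  then obtain U where U: "\<And>i. open (U i)" "\<And>i. A i \<subseteq> U i"
    "\<And>i. open_mass \<mu> (U i) \<le> outer_mass \<mu> (A i) + ennreal (e * (1/2)^Suc i)" by metis
  have "outer_mass \<mu> (\<Union>i. A i) \<le> open_mass \<mu> (\<Union>i. U i)"
    using U by (intro outer_mass_le) auto
  also have "\<dots> \<le> (\<Sum>i. open_mass \<mu> (U i))" by (rule open_mass_UN[OF lc \<mu> U(1)])
  also have "\<dots> \<le> (\<Sum>i. outer_mass \<mu> (A i) + ennreal (e * (1/2)^Suc i))"
    using U(3) by (intro suminf_le) auto
  also have "\<dots> = (\<Sum>i. outer_mass \<mu> (A i)) + (\<Sum>i. ennreal (e * (1/2)^Suc i))"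
    by (rule suminf_add[symmetric]) auto
  also have "(\<Sum>i. ennreal (e * (1/2)^Suc i)) = ennreal e"
    using e sums_mult[OF power_half_series, of e]
    by (subst suminf_ennreal2) (auto simp: sums_iff)
  finally show "outer_mass \<mu> (\<Union>i. A i) \<le> (\<Sum>i. outer_mass \<mu> (A i)) + ennreal e" .
qed

lemma outer_mass_Un:
  fixes \<mu> :: "'a::t2_space functional"
  assumes lc: "locally_compact_space (euclidean :: 'a topology)"
    and \<mu>: "\<mu> \<in> radon_pos"
  shows "outer_mass \<mu> (A \<union> B) \<le> outer_mass \<mu> A + outer_mass \<mu> B"
proof -
  have e: "outer_mass \<mu> {} = 0" using open_mass_empty[OF \<mu>] by (simp add: outer_mass_open)
  have "outer_mass \<mu> (\<Union>i. binaryset A B i) \<le> (\<Sum>i. outer_mass \<mu> (binaryset A B i))"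
    by (rule outer_mass_UN[OF lc \<mu>])
  also have "\<dots> = outer_mass \<mu> A + outer_mass \<mu> B"
    by (rule suminf_binaryset_eq[where f="outer_mass \<mu>", OF e])
  finally show ?thesis by (simp add: UN_binaryset_eq)
qed

text \<open>The nontrivial half of Caratheodory's condition. Let \<open>V\<close> be open with A
  \<subseteq> V. A function \<phi> vanishing off a compact L \<subseteq> U \<inter> V and a function
  \<psi> below the indicator of V - L have a sum below the indicator of \<open>V\<close>, and A - U
  \<subseteq> V - L because L \<subseteq> U.\<close>

lemma outer_mass_split_open:
  fixes \<mu> :: "'a::t2_space functional"
  assumes lc: "locally_compact_space (euclidean :: 'a topology)"
    and \<mu>: "\<mu> \<in> radon_pos" and U: "open U"
  shows "outer_mass \<mu> (U \<inter> A) + outer_mass \<mu> (A - U) \<le> outer_mass \<mu> A"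
  unfolding outer_mass_def[of \<mu> A]
proof (rule INF_greatest)
  fix V assume "V \<in> {U. open U \<and> A \<subseteq> U}"
  then have V: "open V" "A \<subseteq> V" by auto
  have UV: "open (U \<inter> V)" using U V(1) by blast
  let ?D = "{\<phi> \<in> Cc. (\<forall>x. 0 \<le> \<phi> x \<and> \<phi> x \<le> 1) \<and>
      (\<exists>L. compact L \<and> L \<subseteq> U \<inter> V \<and> (\<forall>x. x \<notin> L \<longrightarrow> \<phi> x = 0))}"
  have "(\<lambda>_. 0) \<in> ?D" by (auto intro!: exI[of _ "{}"])
  then have ne: "?D \<noteq> {}" by blast
  have "outer_mass \<mu> (U \<inter> A) + outer_mass \<mu> (A - U) \<le> open_mass \<mu> (U \<inter> V) + outer_mass \<mu> (A - U)"
    using V UV by (intro add_right_mono outer_mass_le) auto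
  also have "\<dots> = (SUP \<phi>\<in>?D. ennreal (\<mu> \<phi>) + outer_mass \<mu> (A - U))"
    unfolding open_mass_compact_support[OF lc \<mu> UV] using ne by (rule ennreal_SUP_add_left[symmetric])
  also have "\<dots> \<le> open_mass \<mu> V"
  proof (rule SUP_least)
    fix \<phi> assume "\<phi> \<in> ?D"
    then obtain L where \<phi>: "\<phi> \<in> Cc" "\<And>x. 0 \<le> \<phi> x" "\<And>x. \<phi> x \<le> 1"
      and L: "compact L" "L \<subseteq> U \<inter> V" "\<And>x. x \<notin> L \<Longrightarrow> \<phi> x = 0" by blast
    have oVL: "open (V - L)" using V(1) compact_imp_closed[OF L(1)] by (rule open_Diff)
    let ?E = "{\<psi> \<in> Cc. \<forall>x. 0 \<le> \<psi> x \<and> \<psi> x \<le> indicator (V - L) x}"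
    have "(\<lambda>_. 0) \<in> ?E" by auto
    then have ne': "?E \<noteq> {}" by blast
    have "ennreal (\<mu> \<phi>) + outer_mass \<mu> (A - U) \<le> ennreal (\<mu> \<phi>) + open_mass \<mu> (V - L)"
      using V L oVL by (intro add_left_mono outer_mass_le) auto
    also have "\<dots> = (SUP \<psi>\<in>?E. ennreal (\<mu> \<phi>) + ennreal (\<mu> \<psi>))"
      unfolding open_mass_def using ne' by (rule ennreal_SUP_add_right)
    also have "\<dots> \<le> open_mass \<mu> V"
    proof (rule SUP_least)
      fix \<psi> assume "\<psi> \<in> ?E"
      then have \<psi>: "\<psi> \<in> Cc" "\<And>x. 0 \<le> \<psi> x" "\<And>x. \<psi> x \<le> indicator (V - L) x" by auto
      have le: "\<phi> x + \<psi> x \<le> indicator V x" for x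
        using \<phi>(3)[of x] L(3)[of x] \<psi>(3)[of x] \<psi>(2)[of x] L(2)
        by (cases "x \<in> L") (auto simp: indicator_def split: if_splits)
      have "ennreal (\<mu> \<phi>) + ennreal (\<mu> \<psi>) = ennreal (\<mu> (\<lambda>x. \<phi> x + \<psi> x))"
        using radon_pos_nonneg[OF \<mu>, of \<phi>] radon_pos_nonneg[OF \<mu>, of \<psi>] \<phi>(2) \<psi>(2)
        by (simp add: radon_add[OF radon_pos_radon[OF \<mu>] \<phi>(1) \<psi>(1)])
      also have "\<dots> \<le> open_mass \<mu> V"
        unfolding open_mass_def using le \<phi> \<psi> by (intro SUP_upper) (auto intro: Cc_add)
      finally show "ennreal (\<mu> \<phi>) + ennreal (\<mu> \<psi>) \<le> open_mass \<mu> V" .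
    qed
    finally show "ennreal (\<mu> \<phi>) + outer_mass \<mu> (A - U) \<le> open_mass \<mu> V" .
  qed
  finally show "outer_mass \<mu> (U \<inter> A) + outer_mass \<mu> (A - U) \<le> open_mass \<mu> V" .
qed

text \<open>\<open>measure_of\<close> collapses to the zero measure when its set function is not a
  measure, so values of \<open>borel_measure\<close> become accessible only through this.
  Caratheodory's construction is run on the power set; open sets satisfy his condition, hence so do
  Borel sets.\<close>

lemma measure_space_outer_mass:
  fixes \<mu> :: "'a::t2_space functional"
  assumes lc: "locally_compact_space (euclidean :: 'a topology)"
    and \<mu>: "\<mu> \<in> radon_pos"
  shows "measure_space UNIV (sets borel) (outer_mass \<mu>)"
proof -
  interpret S: sigma_algebra UNIV "UNIV :: 'a set set"
    using sigma_algebra_Pow[of "UNIV :: 'a set"] by simp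
  let ?L = "lambda_system UNIV UNIV (outer_mass \<mu>)"
  have "outer_measure_space UNIV (outer_mass \<mu>)"
    unfolding outer_measure_space_def positive_def increasing_def countably_subadditive_def
    using open_mass_empty[OF \<mu>] outer_mass_mono outer_mass_UN[OF lc \<mu>]
    by (auto simp: outer_mass_open)
  then have L: "measure_space UNIV ?L (outer_mass \<mu>)"
    by (rule S.caratheodory_lemma)
  then have sigma: "sigma_algebra UNIV ?L"
    by (simp add: measure_space_def)
  have op: "U \<in> ?L" if "open U" for U
    unfolding lambda_system_def
  proof (safe, simp)
    fix A
    show "outer_mass \<mu> (U \<inter> A) + outer_mass \<mu> ((UNIV - U) \<inter> A) = outer_mass \<mu> A"
    proof (rule antisym)
      have "(UNIV - U) \<inter> A = A - U" by auto
      then show "outer_mass \<mu> (U \<inter> A) + outer_mass \<mu> ((UNIV - U) \<inter> A) \<le> outer_mass \<mu> A"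
        using outer_mass_split_open[OF lc \<mu> that, of A] by simp
      have "A = (U \<inter> A) \<union> ((UNIV - U) \<inter> A)" by blast
      then show "outer_mass \<mu> A \<le> outer_mass \<mu> (U \<inter> A) + outer_mass \<mu> ((UNIV - U) \<inter> A)"
        using outer_mass_Un[OF lc \<mu>] by metis
    qed
  qed
  have sub: "sets borel \<subseteq> ?L"
  proof -
    have "sets (borel :: 'a measure) = sigma_sets UNIV {U. open U}"
      unfolding borel_def by (simp add: sets_measure_of)
    also have "\<dots> \<subseteq> ?L"
      using op by (intro sigma_algebra.sigma_sets_subset[OF sigma]) blast
    finally show ?thesis .
  qed
  have "countably_additive (sets borel) (outer_mass \<mu>)"
    unfolding countably_additive_def
  proof (intro allI impI)
    fix A :: "nat \<Rightarrow> 'a set" assume A: "range A \<subseteq> sets borel" "disjoint_family A" "(\<Union>i. A i) \<in> sets borel"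
    have "countably_additive ?L (outer_mass \<mu>)" using L by (simp add: measure_space_def)
    then show "(\<Sum>i. outer_mass \<mu> (A i)) = outer_mass \<mu> (\<Union>i. A i)"
      unfolding countably_additive_def using A sub by (meson order_trans subsetD)
  qed
  moreover have "positive (sets borel) (outer_mass \<mu>)"
    using open_mass_empty[OF \<mu>] by (simp add: positive_def outer_mass_open)
  moreover have "sigma_algebra UNIV (sets (borel :: 'a measure))"
    using sets.sigma_algebra_axioms[of "borel :: 'a measure"] by simp
  ultimately show ?thesis
    by (simp add: measure_space_def)
qed

section \<open>The Borel measure of a functional and its null sets\<close>

lemma sets_borel_measure [simp, measurable_cong]: "sets (borel_measure \<mu>) = sets borel"
  and space_borel_measure [simp]: "space (borel_measure \<mu>) = UNIV"
proof -
  have "sigma_sets UNIV (sets borel) = sets (borel :: 'a measure)"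
    using sets.sigma_sets_eq[of "borel :: 'a measure"] by simp
  then show "sets (borel_measure \<mu>) = sets borel" "space (borel_measure \<mu>) = UNIV"
    unfolding borel_measure_def by (simp_all add: sets_measure_of space_measure_of)
qed

lemma emeasure_borel_measure:
  fixes \<mu> :: "'a::t2_space functional"
  assumes lc: "locally_compact_space (euclidean :: 'a topology)"
    and \<mu>: "\<mu> \<in> radon_pos" and A: "A \<in> sets borel"
  shows "emeasure (borel_measure \<mu>) A = outer_mass \<mu> A"
  using measure_space_outer_mass[OF lc \<mu>] A unfolding borel_measure_eq measure_space_def
  by (intro emeasure_measure_of_sigma) auto

text \<open>Open neighbourhoods of \<open>N\<close> of mass below 1/(n+1) intersect in a Borel null
  set. This turns concentration on a set that need not be Borel into a statement about open
  neighbourhoods.\<close>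

lemma null_sets_borel_measure:
  fixes \<mu> :: "'a::t2_space functional"
  assumes lc: "locally_compact_space (euclidean :: 'a topology)"
    and \<mu>: "\<mu> \<in> radon_pos"
  shows "N \<in> null_sets (completion (borel_measure \<mu>)) \<longleftrightarrow> outer_mass \<mu> N = 0"
proof
  assume "N \<in> null_sets (completion (borel_measure \<mu>))"
  then obtain N' where N': "N' \<in> null_sets (borel_measure \<mu>)" "N \<subseteq> N'"
    unfolding null_sets_completion_iff2 by blast
  then have "outer_mass \<mu> N' = 0"
    using emeasure_borel_measure[OF lc \<mu>, of N'] by (auto simp: null_sets_def)
  then show "outer_mass \<mu> N = 0" using outer_mass_mono[OF N'(2), of \<mu>] by simp
next
  assume 0: "outer_mass \<mu> N = 0"
  have "\<exists>U. open U \<and> N \<subseteq> U \<and> open_mass \<mu> U < ennreal (1 / real (Suc n))" for n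
  proof -
    have "outer_mass \<mu> N < ennreal (1 / real (Suc n))" using 0 by simp
    then show ?thesis by (rule outer_mass_less)
  qed
  then obtain U where U: "\<And>n. open (U n)" "\<And>n. N \<subseteq> U n" "\<And>n. open_mass \<mu> (U n) < ennreal (1 / real (Suc n))"
    by metis
  have B: "(\<Inter>n. U n) \<in> sets borel" using U(1) by (intro sets.countable_INT) auto
  have "outer_mass \<mu> (\<Inter>n. U n) = 0"
  proof (rule ccontr)
    assume "outer_mass \<mu> (\<Inter>n. U n) \<noteq> 0"
    then have pos: "0 < outer_mass \<mu> (\<Inter>n. U n)" by (simp add: zero_less_iff_neq_zero)
    have lt: "outer_mass \<mu> (\<Inter>n. U n) < ennreal (1 / real (Suc n))" for n
      using outer_mass_le[OF U(1)[of n], of "\<Inter>n. U n" \<mu>] U(3)[of n] by (auto intro: le_less_trans)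
    obtain r where r: "outer_mass \<mu> (\<Inter>n. U n) = ennreal r" "0 \<le> r"
      using lt[of 0] by (cases "outer_mass \<mu> (\<Inter>n. U n)") auto
    then obtain n where "1 / real (Suc n) < r" using pos by (metis ennreal_less_zero_iff nat_approx_posE)
    then show False using lt[of n] r by (simp add: ennreal_less_iff)
  qed
  then have "(\<Inter>n. U n) \<in> null_sets (borel_measure \<mu>)"
    using B emeasure_borel_measure[OF lc \<mu> B] by (auto simp: null_sets_def)
  then show "N \<in> null_sets (completion (borel_measure \<mu>))"
    unfolding null_sets_completion_iff2 using U(2) by blast
qed

lemma concentrated_on_iff:
  fixes \<mu> :: "'a::t2_space functional"
  assumes lc: "locally_compact_space (euclidean :: 'a topology)"
    and \<mu>: "\<mu> \<in> radon_pos"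
  shows "concentrated_on \<mu> A \<longleftrightarrow> (\<forall>K. compact K \<longrightarrow> outer_mass \<mu> (K - A) = 0)"
proof -
  have "K \<inter> (UNIV - A) = K - A" for K by auto
  then show ?thesis
    unfolding concentrated_on_def null_sets_borel_measure[OF lc \<mu>] by simp
qed

section \<open>Agreement of the two integrals\<close>

lemma Phi_measurable:
  assumes "g \<in> Phi"
  shows "g \<in> borel_measurable borel"
  by (rule borel_measurableI_greater) (use Phi_lsc[OF assms] in simp)

lemma e2ennreal_add: "0 \<le> a \<Longrightarrow> 0 \<le> b \<Longrightarrow> e2ennreal (a + b) = e2ennreal a + e2ennreal b"
  by (metis e2ennreal_enn2ereal enn2ereal_e2ennreal plus_ennreal.rep_eq)

text \<open>Steps of size 1/p up to the height p. The strict inequality matters: for lower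
  semicontinuous \<open>g\<close> the sets {k/p < g} are open, so \<open>staircase p (g x)\<close>
  is a finite combination of indicators of open sets, on which the two integrals agree by
  construction.\<close>

definition staircase :: "nat \<Rightarrow> ereal \<Rightarrow> real" where
  "staircase p t = (\<Sum>k=1..p*p. if ereal (real k / real p) < t then 1 / real p else 0)"

text \<open>The sum counts the integers in 1..N strictly below \<open>s\<close>. It therefore falls
  short of \<open>s\<close> by at most 1, unless it is saturated at N.\<close>

lemma staircase_aux:
  fixes s :: real
  assumes "0 \<le> s"
  shows "(\<Sum>k=1..N. if real k < s then 1 else 0) \<le> s \<and>
    ((\<Sum>k=1..N. if real k < s then 1 else 0) = real N \<or> s \<le> (\<Sum>k=1..N. if real k < s then 1 else 0) + 1)"
proof (induction N)
  case 0
  then show ?case using assms by simp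
next
  case (Suc N)
  have "(\<Sum>k=1..N. if real k < s then 1 else 0) \<le> (\<Sum>k=1..N. (1::real))"
    by (rule sum_mono) auto
  then have "(\<Sum>k=1..N. if real k < s then 1 else 0) \<le> real N" by simp
  then show ?case using Suc by (auto simp: sum.cl_ivl_Suc)
qed

lemma staircase_le:
  assumes "0 \<le> t" "0 < p"
  shows "ereal (staircase p t) \<le> t"
proof (cases t)
  case (real r)
  have r: "0 \<le> real p * r" using real assms by simp
  have "staircase p t = (\<Sum>k=1..p*p. if real k < real p * r then 1 else 0) / real p"
    unfolding staircase_def real sum_divide_distrib
    using assms(2) by (intro sum.cong) (auto simp: field_simps)
  also have "\<dots> \<le> real p * r / real p"
    using staircase_aux[OF r, of "p*p"] by (intro divide_right_mono) auto
  finally show ?thesis using real assms by simp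
qed (use assms in auto)

lemma staircase_ge:
  assumes "0 \<le> t" "0 < p"
  shows "min t (ereal (real p)) \<le> ereal (staircase p t + 1 / real p)"
proof (cases t)
  case (real r)
  have r: "0 \<le> real p * r" using real assms by simp
  define S where "S = (\<Sum>k=1..p*p. if real k < real p * r then 1 else (0::real))"
  have eq: "staircase p t = S / real p"
    unfolding staircase_def real sum_divide_distrib S_def
    using assms(2) by (intro sum.cong) (auto simp: field_simps)
  have "S = real (p*p) \<or> real p * r \<le> S + 1"
    using staircase_aux[OF r, of "p*p"] unfolding S_def by blast
  then show ?thesis
  proof
    assume "S = real (p*p)"
    then show ?thesis using assms(2) eq by (simp add: min_le_iff_disj)
  next
    assume "real p * r \<le> S + 1"
    then have "r \<le> S / real p + 1 / real p" using assms(2) by (simp add: field_simps)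
    then show ?thesis using eq real by (simp add: min_le_iff_disj)
  qed
next
  case PInf
  then have "staircase p t = real p" using assms(2) by (simp add: staircase_def)
  then show ?thesis using PInf by simp
qed (use assms in auto)

lemma nn_integral_staircase:
  fixes \<mu> :: "'a::t2_space functional"
  assumes lc: "locally_compact_space (euclidean :: 'a topology)"
    and \<mu>: "\<mu> \<in> radon_pos" and g: "g \<in> Phi" "\<And>x. 0 \<le> g x" and p: "0 < p"
  shows "(\<lambda>x. ereal (staircase p (g x))) \<in> Phi"
    and "(\<integral>\<^sup>+x. e2ennreal (ereal (staircase p (g x))) \<partial>borel_measure \<mu>)
      = e2ennreal (lsc_integral \<mu> (\<lambda>x. ereal (staircase p (g x))))"
proof -
  \<comment> \<open>Frees the number of steps from the mesh, so that the induction adds one open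
    level set at a time.\<close>
  define h where "h N x = (\<Sum>k=1..N. if ereal (real k / real p) < g x then 1 / real p else 0)" for N x
  have h0: "0 \<le> h N x" for N x unfolding h_def by (rule sum_nonneg) simp
  have "(\<lambda>x. ereal (h N x)) \<in> Phi \<and>
    (\<integral>\<^sup>+x. e2ennreal (ereal (h N x)) \<partial>borel_measure \<mu>) = e2ennreal (lsc_integral \<mu> (\<lambda>x. ereal (h N x)))" for N
  proof (induction N)
    case 0
    then show ?case using Phi_zero lsc_integral_zero[OF \<mu>] by (simp add: h_def zero_ereal_def[symmetric] e2ennreal_neg)
  next
    case (Suc N)
    define U where "U = {x. ereal (real (Suc N) / real p) < g x}"
    have U: "open U" unfolding U_def by (rule Phi_lsc[OF g(1)])
    let ?i = "\<lambda>x. ereal (1 / real p) * indicator U x"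
    have i: "?i \<in> Phi" using p by (intro Phi_scale Phi_indicator U) auto
    have eq: "ereal (h (Suc N) x) = ereal (h N x) + ?i x" for x
      unfolding h_def U_def by (simp add: indicator_def)
    have Phi: "(\<lambda>x. ereal (h N x)) \<in> Phi" using Suc by blast
    have 1: "(\<lambda>x. ereal (h (Suc N) x)) \<in> Phi"
      unfolding eq using Phi i by (rule Phi_add)
    have split: "e2ennreal (ereal (h (Suc N) x)) = e2ennreal (ereal (h N x)) + ennreal (1 / real p) * indicator U x" for x
    proof -
      have "h (Suc N) x = h N x + (1 / real p) * indicator U x"
        unfolding h_def U_def by (simp add: indicator_def)
      then show ?thesis using h0[of N x] by (simp add: indicator_def)
    qed
    have m: "(\<lambda>x. e2ennreal (ereal (h N x))) \<in> borel_measurable (borel_measure \<mu>)"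
      using Phi_measurable[OF Phi] by (simp add: measurable_cong_sets[OF sets_borel_measure refl])
    have "(\<integral>\<^sup>+x. e2ennreal (ereal (h (Suc N) x)) \<partial>borel_measure \<mu>)
      = (\<integral>\<^sup>+x. e2ennreal (ereal (h N x)) \<partial>borel_measure \<mu>) + ennreal (1 / real p) * emeasure (borel_measure \<mu>) U"
    proof -
      have "(\<lambda>x. ennreal (1 / real p) * indicator U x) \<in> borel_measurable (borel_measure \<mu>)"
        by (rule borel_measurable_times_ennreal[OF borel_measurable_const borel_measurable_indicator]) (use U in simp)
      then show ?thesis
        unfolding split using m U by (subst nn_integral_add) (simp_all add: nn_integral_cmult_indicator)
    qed
    also have "\<dots> = e2ennreal (lsc_integral \<mu> (\<lambda>x. ereal (h N x))) + ennreal (1 / real p) * open_mass \<mu> U"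
      using Suc U by (simp add: emeasure_borel_measure[OF lc \<mu>] outer_mass_open)
    also have "\<dots> = e2ennreal (lsc_integral \<mu> (\<lambda>x. ereal (h N x))) + e2ennreal (ereal (1 / real p) * lsc_integral \<mu> (\<lambda>x. indicator U x))"
      unfolding enn2ereal_open_mass[OF \<mu>, symmetric]
      by (metis e2ennreal_enn2ereal e2ennreal_ereal enn2ereal_ennreal divide_nonneg_nonneg of_nat_0_le_iff times_ennreal.rep_eq zero_le_one)
    also have "\<dots> = e2ennreal (lsc_integral \<mu> (\<lambda>x. ereal (h N x)) + ereal (1 / real p) * lsc_integral \<mu> (\<lambda>x. indicator U x))"
    proof (rule e2ennreal_add[symmetric])
      show "0 \<le> lsc_integral \<mu> (\<lambda>x. ereal (h N x))"
        using h0 by (intro lsc_integral_nonneg[OF \<mu>]) simp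
      show "0 \<le> ereal (1 / real p) * lsc_integral \<mu> (\<lambda>x. indicator U x)"
        using lsc_integral_nonneg[OF \<mu>, of "\<lambda>x. indicator U x"] by simp
    qed
    also have "\<dots> = e2ennreal (lsc_integral \<mu> (\<lambda>x. ereal (h (Suc N) x)))"
      unfolding eq using lsc_integral_scale[OF \<mu>, of "1 / real p"] p
      by (subst lsc_integral_add[OF lc \<mu> Phi i]) simp
    finally show ?case using 1 by blast
  qed
  from this[of "p*p"] show "(\<lambda>x. ereal (staircase p (g x))) \<in> Phi"
    "(\<integral>\<^sup>+x. e2ennreal (ereal (staircase p (g x))) \<partial>borel_measure \<mu>)
      = e2ennreal (lsc_integral \<mu> (\<lambda>x. ereal (staircase p (g x))))"
    unfolding staircase_def h_def by auto
qed

text \<open>Both directions go through staircases. They are not monotone in p, so the Lebesgue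
  integral is bounded above by Fatou's lemma. In the other direction the supremum in
  \<open>lsc_integral\<close> runs over an uncountable family; but a single test function is bounded
  with compact support, and one staircase approximates it up to \<beta>/p.\<close>

lemma nn_integral_lsc:
  fixes \<mu> :: "'a::t2_space functional"
  assumes lc: "locally_compact_space (euclidean :: 'a topology)"
    and \<mu>: "\<mu> \<in> radon_pos" and g: "g \<in> Phi" "\<And>x. 0 \<le> g x"
  shows "(\<integral>\<^sup>+x. e2ennreal (g x) \<partial>borel_measure \<mu>) = e2ennreal (lsc_integral \<mu> g)"
proof (rule antisym)
  let ?M = "borel_measure \<mu>"
  have le: "e2ennreal (g x) \<le> liminf (\<lambda>n. e2ennreal (ereal (staircase (Suc n) (g x))))" for x
    unfolding le_Liminf_iff
  proof (intro allI impI)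
    fix y assume y: "y < e2ennreal (g x)"
    have "enn2ereal y < g x"
      using y g(2)[of x] by (metis enn2ereal_e2ennreal less_ennreal.rep_eq)
    then obtain z where z: "enn2ereal y < ereal z" "ereal z < g x"
      using ereal_dense2 by blast
    obtain y' where y': "enn2ereal y = ereal y'" "0 \<le> y'"
      using z(1) enn2ereal_nonneg[of y] by (cases "enn2ereal y") auto
    obtain n0 :: nat where n0: "z \<le> real n0" using real_arch_simple by blast
    obtain n1 where n1: "1 / real (Suc n1) < z - y'"
      using z(1) y' nat_approx_posE[of "z - y'"] by auto
    show "\<forall>\<^sub>F n in sequentially. y < e2ennreal (ereal (staircase (Suc n) (g x)))"
    proof (rule eventually_sequentiallyI)
      fix n assume n: "max n0 n1 \<le> n"
      have "1 / real (Suc n) \<le> 1 / real (Suc n1)" using n by (simp add: frac_le)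
      then have "1 / real (Suc n) < z - y'" using n1 by simp
      moreover have "ereal z \<le> min (g x) (ereal (real (Suc n)))"
        using z(2) n0 n by (simp add: less_imp_le)
      then have "ereal z \<le> ereal (staircase (Suc n) (g x) + 1 / real (Suc n))"
        using staircase_ge[OF g(2)[of x], of "Suc n"] by (meson order_trans zero_less_Suc)
      ultimately have "y' < staircase (Suc n) (g x)" by simp
      then show "y < e2ennreal (ereal (staircase (Suc n) (g x)))"
        using y' by (simp add: less_ennreal.rep_eq)
    qed
  qed
  have m: "(\<lambda>x. e2ennreal (ereal (staircase (Suc n) (g x)))) \<in> borel_measurable ?M" for n
    using Phi_measurable[OF nn_integral_staircase(1)[OF lc \<mu> g, of "Suc n"]]
    by (simp add: measurable_cong_sets[OF sets_borel_measure refl])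
  have "(\<integral>\<^sup>+x. e2ennreal (g x) \<partial>?M) \<le> (\<integral>\<^sup>+x. liminf (\<lambda>n. e2ennreal (ereal (staircase (Suc n) (g x)))) \<partial>?M)"
    using le by (intro nn_integral_mono)
  also have "\<dots> \<le> liminf (\<lambda>n. \<integral>\<^sup>+x. e2ennreal (ereal (staircase (Suc n) (g x))) \<partial>?M)"
    using m by (rule nn_integral_liminf)
  also have "\<dots> \<le> liminf (\<lambda>n. e2ennreal (lsc_integral \<mu> g))"
  proof (rule Liminf_mono, rule always_eventually, rule allI)
    fix n
    have "lsc_integral \<mu> (\<lambda>x. ereal (staircase (Suc n) (g x))) \<le> lsc_integral \<mu> g"
      using staircase_le[OF g(2)] by (intro lsc_integral_mono) auto
    then show "(\<integral>\<^sup>+x. e2ennreal (ereal (staircase (Suc n) (g x))) \<partial>?M) \<le> e2ennreal (lsc_integral \<mu> g)"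
      unfolding nn_integral_staircase(2)[OF lc \<mu> g zero_less_Suc] by (rule e2ennreal_mono)
  qed
  also have "\<dots> = e2ennreal (lsc_integral \<mu> g)" by (simp add: Liminf_const)
  finally show "(\<integral>\<^sup>+x. e2ennreal (g x) \<partial>?M) \<le> e2ennreal (lsc_integral \<mu> g)" .
  have "lsc_integral \<mu> g \<le> enn2ereal (\<integral>\<^sup>+x. e2ennreal (g x) \<partial>?M)"
  proof (rule lsc_integral_least)
    fix \<phi> :: "'a \<Rightarrow> real" assume \<phi>: "\<phi> \<in> Cc" "\<And>x. ereal (\<phi> x) \<le> g x"
    define \<psi> where "\<psi> x = max 0 (\<phi> x)" for x
    have \<psi>: "\<psi> \<in> Cc" "\<And>x. 0 \<le> \<psi> x" "\<And>x. ereal (\<psi> x) \<le> g x"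
      unfolding \<psi>_def using Cc_pos[OF \<phi>(1)] \<phi>(2) g(2) by (auto simp: max_def zero_ereal_def)
    have \<psi>Phi: "(\<lambda>x. ereal (\<psi> x)) \<in> Phi"
    proof -
      have "open {x. a < ereal (\<psi> x)}" for a
        using open_Collect_less[of "\<lambda>_. a" "\<lambda>x. ereal (\<psi> x)"] Cc_continuous[OF \<psi>(1)]
        by (simp add: continuous_on_ereal)
      then show ?thesis using \<psi>(2) by (simp add: Phi_def)
    qed
    obtain B where B: "0 \<le> B" "\<And>x. \<bar>\<psi> x\<bar> \<le> B" using Cc_bounded[OF \<psi>(1)] by blast
    obtain K where K: "compact K" "\<And>x. x \<notin> K \<Longrightarrow> \<psi> x = 0" using CcE[OF \<psi>(1)] by blast
    obtain \<beta> where \<beta>: "\<beta> \<in> Cc" "\<And>x. 0 \<le> \<beta> x" "\<And>x. x \<in> K \<Longrightarrow> \<beta> x = 1"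
      using Cc_bump[OF lc K(1) open_UNIV] by (metis UNIV_I subsetI)
    show "ereal (\<mu> \<phi>) \<le> enn2ereal (\<integral>\<^sup>+x. e2ennreal (g x) \<partial>?M)"
    proof (rule ereal_le_epsilon2)
      fix e :: real assume e: "0 < e"
      \<comment> \<open>Two demands on \<open>p\<close>: at least \<open>B\<close>, so that the
        staircase does not truncate \<open>\<psi>\<close>, and at least
        \<open>\<mu> \<beta> / e\<close>, so that the error \<beta>/p integrates to at most
        \<open>e\<close>.\<close>
      obtain n0 :: nat where n0: "max B (\<mu> \<beta> / e) \<le> real n0" using real_arch_simple by blast
      define p where "p = Suc n0"
      have p: "0 < p" "B \<le> real p" "\<mu> \<beta> / e \<le> real p" using n0 by (auto simp: p_def)
      have \<beta>Phi: "(\<lambda>x. ereal (1 / real p * \<beta> x)) \<in> Phi"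
      proof -
        have "open {x. a < ereal (1 / real p * \<beta> x)}" for a
          using open_Collect_less[of "\<lambda>_. a" "\<lambda>x. ereal (1 / real p * \<beta> x)"] Cc_continuous[OF Cc_scale[OF \<beta>(1)], of "1 / real p"]
          by (simp add: continuous_on_ereal)
        then show ?thesis using \<beta>(2) by (simp add: Phi_def)
      qed
      have le: "ereal (\<psi> x) \<le> ereal (staircase p (ereal (\<psi> x))) + ereal (1 / real p * \<beta> x)" for x
      proof (cases "x \<in> K")
        case True
        have "min (ereal (\<psi> x)) (ereal (real p)) = ereal (\<psi> x)"
          using B(2)[of x] p(2) by (simp add: min_def)
        then show ?thesis using staircase_ge[of "ereal (\<psi> x)" p] \<psi>(2)[of x] p(1) \<beta>(3)[OF True] by simp
      next
        case False
        have "0 \<le> staircase p t" for t unfolding staircase_def by (rule sum_nonneg) simp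
        then show ?thesis using K(2)[OF False] \<beta>(2)[of x] by (simp add: zero_ereal_def[symmetric])
      qed
      have "ereal (\<mu> \<phi>) \<le> lsc_integral \<mu> (\<lambda>x. ereal (\<psi> x))"
        using \<phi>(1) by (rule lsc_integral_upper) (simp add: \<psi>_def)
      also have "\<dots> \<le> lsc_integral \<mu> (\<lambda>x. ereal (staircase p (ereal (\<psi> x))) + ereal (1 / real p * \<beta> x))"
        using le by (rule lsc_integral_mono)
      also have "\<dots> = lsc_integral \<mu> (\<lambda>x. ereal (staircase p (ereal (\<psi> x)))) + lsc_integral \<mu> (\<lambda>x. ereal (1 / real p * \<beta> x))"
        using nn_integral_staircase(1)[OF lc \<mu> \<psi>Phi _ p(1)] \<psi>(2) \<beta>Phi by (intro lsc_integral_add[OF lc \<mu>]) auto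
      also have "lsc_integral \<mu> (\<lambda>x. ereal (1 / real p * \<beta> x)) = ereal (1 / real p * \<mu> \<beta>)"
        unfolding lsc_integral_Cc[OF \<mu> Cc_scale[OF \<beta>(1)]] radon_scale[OF radon_pos_radon[OF \<mu>] \<beta>(1)] ..
      also have "\<dots> \<le> ereal e" using p e by (simp add: field_simps)
      also have "lsc_integral \<mu> (\<lambda>x. ereal (staircase p (ereal (\<psi> x)))) \<le> enn2ereal (\<integral>\<^sup>+x. e2ennreal (g x) \<partial>?M)"
      proof -
        have "0 \<le> lsc_integral \<mu> (\<lambda>x. ereal (staircase p (ereal (\<psi> x))))"
          by (rule lsc_integral_nonneg[OF \<mu>]) (simp add: staircase_def sum_nonneg)
        then have "lsc_integral \<mu> (\<lambda>x. ereal (staircase p (ereal (\<psi> x))))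
          = enn2ereal (\<integral>\<^sup>+x. e2ennreal (ereal (staircase p (ereal (\<psi> x)))) \<partial>?M)"
          using nn_integral_staircase(2)[OF lc \<mu> \<psi>Phi _ p(1)] \<psi>(2) by (simp add: enn2ereal_e2ennreal)
        also have "\<dots> \<le> enn2ereal (\<integral>\<^sup>+x. e2ennreal (g x) \<partial>?M)"
        proof -
          have "ereal (staircase p (ereal (\<psi> x))) \<le> g x" for x
            using order_trans[OF staircase_le[of "ereal (\<psi> x)" p] \<psi>(3)[of x]] \<psi>(2)[of x] p(1) by simp
          then show ?thesis
            unfolding less_eq_ennreal.rep_eq[symmetric] by (intro nn_integral_mono e2ennreal_mono)
        qed
        finally show ?thesis .
      qed
      finally show "ereal (\<mu> \<phi>) \<le> enn2ereal (\<integral>\<^sup>+x. e2ennreal (g x) \<partial>?M) + ereal e"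
        by (simp add: add_mono)
    qed
  qed
  then have "e2ennreal (lsc_integral \<mu> g) \<le> e2ennreal (enn2ereal (\<integral>\<^sup>+x. e2ennreal (g x) \<partial>?M))"
    by (rule e2ennreal_mono)
  then show "e2ennreal (lsc_integral \<mu> g) \<le> (\<integral>\<^sup>+x. e2ennreal (g x) \<partial>?M)" by simp
qed

lemma emeasure_borel_measure_UNIV:
  fixes \<mu> :: "'a::t2_space functional"
  assumes lc: "locally_compact_space (euclidean :: 'a topology)"
    and \<mu>: "\<mu> \<in> radon_pos"
  shows "emeasure (borel_measure \<mu>) UNIV = e2ennreal (lsc_integral \<mu> (\<lambda>x. 1))"
  by (simp add: emeasure_borel_measure[OF lc \<mu>] outer_mass_open open_mass_eq[OF \<mu>])

text \<open>If the space is not compact then the constant function 1 is not in \<^term>\<open>Cc\<close>, so that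
  \<open>\<mu> (\<lambda>x. 1)\<close> is a junk value; the total mass occurs only with a factor \<open>c\<close> that vanishes then.\<close>

lemma lsc_integral_const:
  fixes \<mu> :: "'a::t2_space functional"
  assumes \<mu>: "\<mu> \<in> radon_pos" and c: "c = 0 \<or> compact (UNIV :: 'a set)"
  shows "lsc_integral \<mu> (\<lambda>x. ereal c) = ereal (c * \<mu> (\<lambda>x. 1))"
proof -
  have "(\<lambda>x::'a. c) \<in> Cc" using c Cc_const[of c] by auto
  then have "lsc_integral \<mu> (\<lambda>x. ereal c) = ereal (\<mu> (\<lambda>x. c))" by (rule lsc_integral_Cc[OF \<mu>])
  moreover have "\<mu> (\<lambda>x. c) = c * \<mu> (\<lambda>x. 1)"
  proof (cases "c = 0")
    case True
    then show ?thesis using radon_zero[OF radon_pos_radon[OF \<mu>]] by simp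
  next
    case False
    then have "(\<lambda>x::'a. 1) \<in> Cc" using c Cc_const[of 1] by auto
    then show ?thesis using radon_scale[OF radon_pos_radon[OF \<mu>], of "\<lambda>x. 1" c] by simp
  qed
  ultimately show ?thesis by simp
qed

lemma nn_integral_const_borel_measure:
  fixes \<mu> :: "'a::t2_space functional"
  assumes lc: "locally_compact_space (euclidean :: 'a topology)"
    and \<mu>: "\<mu> \<in> radon_pos" and c: "0 \<le> c" "c = 0 \<or> compact (UNIV :: 'a set)"
  shows "(\<integral>\<^sup>+x. ennreal c \<partial>borel_measure \<mu>) = ennreal (c * \<mu> (\<lambda>x. 1))"
  using nn_integral_lsc[OF lc \<mu> Phi_const[of c]] c lsc_integral_const[OF \<mu> c(2)] by simp

text \<open>Adding the constant \<open>c\<close> reduces to nonnegative functions. The integral of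
  \<open>c\<close> is finite since \<open>c\<close> vanishes unless the space is compact, so it can
  be subtracted again.\<close>

lemma ext_integral_borel_measure:
  fixes \<mu> :: "'a::t2_space functional"
  assumes lc: "locally_compact_space (euclidean :: 'a topology)"
    and \<mu>: "\<mu> \<in> radon_pos" and g: "g \<in> Phi"
  shows "ext_integral (borel_measure \<mu>) g = lsc_integral \<mu> g"
    and "(\<integral>\<^sup>+x. e2ennreal (- g x) \<partial>borel_measure \<mu>) < top"
proof -
  let ?M = "borel_measure \<mu>"
  obtain c where c: "0 \<le> c" "c = 0 \<or> compact (UNIV :: 'a set)" "\<And>x. ereal (- c) \<le> g x"
    using Phi_bounded_below[OF g] by blast
  have cPhi: "(\<lambda>x::'a. ereal c) \<in> Phi" using c by (intro Phi_const) auto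
  have hPhi: "(\<lambda>x. g x + ereal c) \<in> Phi" using g cPhi by (rule Phi_add)
  have h0: "0 \<le> g x + ereal c" for x using c(1) c(3)[of x] by (cases "g x") auto
  have m1: "0 \<le> c * \<mu> (\<lambda>x. 1)" using c(1) radon_pos_nonneg[OF \<mu>, of "\<lambda>x. 1"] by simp
  have meas: "(\<lambda>x. e2ennreal (k (g x))) \<in> borel_measurable ?M" if "k \<in> borel_measurable borel" for k
    using measurable_compose[OF Phi_measurable[OF g] that] by (simp add: measurable_cong_sets[OF sets_borel_measure refl])
  \<comment> \<open>The identity (g + c) + g^- = g^+ + c, arranged so that all four terms are
    nonnegative and no subtraction of infinite values arises under the integral.\<close>
  have pt: "e2ennreal (g x + ereal c) + e2ennreal (- g x) = e2ennreal (g x) + ennreal c" for x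
  proof (cases "g x")
    case (real r)
    then show ?thesis using c(1) c(3)[of x]
      by (cases "0 \<le> r") (auto simp: ennreal_neg simp flip: ennreal_plus)
  qed (use c(3)[of x] in auto)
  have N: "(\<integral>\<^sup>+x. e2ennreal (- g x) \<partial>?M) \<le> ennreal (c * \<mu> (\<lambda>x. 1))"
  proof -
    have "e2ennreal (- g x) \<le> ennreal c" for x
    proof -
      have "- g x \<le> ereal c" using c(3)[of x] by (cases "g x") auto
      then show ?thesis using e2ennreal_mono[of "- g x" "ereal c"] by simp
    qed
    then have "(\<integral>\<^sup>+x. e2ennreal (- g x) \<partial>?M) \<le> (\<integral>\<^sup>+x. ennreal c \<partial>?M)" by (intro nn_integral_mono)
    then show ?thesis using nn_integral_const_borel_measure[OF lc \<mu> c(1,2)] by simp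
  qed
  then show "(\<integral>\<^sup>+x. e2ennreal (- g x) \<partial>?M) < top" by (rule le_less_trans) simp
  have "(\<integral>\<^sup>+x. e2ennreal (g x + ereal c) \<partial>?M) + (\<integral>\<^sup>+x. e2ennreal (- g x) \<partial>?M)
      = (\<integral>\<^sup>+x. e2ennreal (g x) \<partial>?M) + ennreal (c * \<mu> (\<lambda>x. 1))"
  proof -
    have "(\<integral>\<^sup>+x. e2ennreal (g x + ereal c) \<partial>?M) + (\<integral>\<^sup>+x. e2ennreal (- g x) \<partial>?M)
        = (\<integral>\<^sup>+x. e2ennreal (g x + ereal c) + e2ennreal (- g x) \<partial>?M)"
      using meas[of "\<lambda>t. t + ereal c"] meas[of uminus] by (intro nn_integral_add[symmetric]) auto
    also have "\<dots> = (\<integral>\<^sup>+x. e2ennreal (g x) \<partial>?M) + (\<integral>\<^sup>+x. ennreal c \<partial>?M)"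
      unfolding pt using meas[of "\<lambda>t. t"] by (intro nn_integral_add) auto
    finally show ?thesis unfolding nn_integral_const_borel_measure[OF lc \<mu> c(1,2)] .
  qed
  then have "enn2ereal (\<integral>\<^sup>+x. e2ennreal (g x + ereal c) \<partial>?M) + enn2ereal (\<integral>\<^sup>+x. e2ennreal (- g x) \<partial>?M)
      = enn2ereal (\<integral>\<^sup>+x. e2ennreal (g x) \<partial>?M) + ereal (c * \<mu> (\<lambda>x. 1))"
    using m1 by (metis enn2ereal_ennreal plus_ennreal.rep_eq)
  moreover have "enn2ereal (\<integral>\<^sup>+x. e2ennreal (g x + ereal c) \<partial>?M) = lsc_integral \<mu> g + ereal (c * \<mu> (\<lambda>x. 1))"
    using nn_integral_lsc[OF lc \<mu> hPhi h0] lsc_integral_nonneg[of \<mu> "\<lambda>x. g x + ereal c", OF \<mu> h0]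
      lsc_integral_add[OF lc \<mu> g cPhi] lsc_integral_const[OF \<mu> c(2)]
    by (simp add: enn2ereal_e2ennreal)
  ultimately have eq: "lsc_integral \<mu> g + ereal (c * \<mu> (\<lambda>x. 1)) + enn2ereal (\<integral>\<^sup>+x. e2ennreal (- g x) \<partial>?M)
      = enn2ereal (\<integral>\<^sup>+x. e2ennreal (g x) \<partial>?M) + ereal (c * \<mu> (\<lambda>x. 1))" by simp
  obtain n where n: "enn2ereal (\<integral>\<^sup>+x. e2ennreal (- g x) \<partial>?M) = ereal n"
    using N by (cases "\<integral>\<^sup>+x. e2ennreal (- g x) \<partial>?M") (auto simp: top_unique)
  show "ext_integral ?M g = lsc_integral \<mu> g"
    using eq unfolding ext_integral_def n
    by (cases "lsc_integral \<mu> g"; cases "enn2ereal (\<integral>\<^sup>+x. e2ennreal (g x) \<partial>?M)") auto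
qed

lemma ennreal_real_of_ereal: "\<bar>t\<bar> \<noteq> \<infinity> \<Longrightarrow> ennreal (real_of_ereal t) = e2ennreal t"
  by (cases t) auto

text \<open>The link to the Bochner integral in \<open>ext_integrable\<close> and
  \<open>gauss_functional\<close>. Since the negative part of \<open>g\<close> always has a finite
  integral, only the positive part is at stake.\<close>

lemma integrable_Phi:
  fixes \<mu> :: "'a::t2_space functional"
  assumes lc: "locally_compact_space (euclidean :: 'a topology)"
    and \<mu>: "\<mu> \<in> radon_pos" and g: "g \<in> Phi" and fin: "lsc_integral \<mu> g < \<infinity>"
  shows "AE x in borel_measure \<mu>. \<bar>g x\<bar> \<noteq> \<infinity>"
    and "integrable (borel_measure \<mu>) (\<lambda>x. real_of_ereal (g x))"
    and "ereal (LINT x|borel_measure \<mu>. real_of_ereal (g x)) = lsc_integral \<mu> g"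
proof -
  let ?M = "borel_measure \<mu>"
  have gm: "g \<in> borel_measurable ?M"
    using Phi_measurable[OF g] by (simp add: measurable_cong_sets[OF sets_borel_measure refl])
  have N: "(\<integral>\<^sup>+x. e2ennreal (- g x) \<partial>?M) < top" by (rule ext_integral_borel_measure(2)[OF lc \<mu> g])
  have J: "enn2ereal (\<integral>\<^sup>+x. e2ennreal (g x) \<partial>?M) - enn2ereal (\<integral>\<^sup>+x. e2ennreal (- g x) \<partial>?M) = lsc_integral \<mu> g"
    using ext_integral_borel_measure(1)[OF lc \<mu> g] by (simp add: ext_integral_def)
  have P: "(\<integral>\<^sup>+x. e2ennreal (g x) \<partial>?M) < top"
  proof (rule ccontr)
    assume "\<not> (\<integral>\<^sup>+x. e2ennreal (g x) \<partial>?M) < top"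
    then have "(\<integral>\<^sup>+x. e2ennreal (g x) \<partial>?M) = top" by (simp add: not_less top_unique)
    then show False using J fin by (simp add: minus_ereal_def)
  qed
  have "AE x in ?M. e2ennreal (g x) \<noteq> \<infinity>"
    using P gm by (intro nn_integral_noteq_infinite) (auto simp: less_top)
  then show AE: "AE x in ?M. \<bar>g x\<bar> \<noteq> \<infinity>"
    by eventually_elim (use Phi_not_MInf[OF g] in auto)
  have p: "(\<integral>\<^sup>+x. ennreal (real_of_ereal (g x)) \<partial>?M) = (\<integral>\<^sup>+x. e2ennreal (g x) \<partial>?M)"
    by (rule nn_integral_cong_AE, rule eventually_mono[OF AE]) (rule ennreal_real_of_ereal)
  have n: "(\<integral>\<^sup>+x. ennreal (- real_of_ereal (g x)) \<partial>?M) = (\<integral>\<^sup>+x. e2ennreal (- g x) \<partial>?M)"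
    by (rule nn_integral_cong_AE, rule eventually_mono[OF AE])
      (use ennreal_real_of_ereal[of "- g _"] in simp)
  have rm: "(\<lambda>x. real_of_ereal (g x)) \<in> borel_measurable ?M" using gm by measurable
  show int: "integrable ?M (\<lambda>x. real_of_ereal (g x))"
    unfolding real_integrable_def using rm p n P N by (auto simp: less_top)
  have "ereal (LINT x|?M. real_of_ereal (g x)) = enn2ereal (\<integral>\<^sup>+x. e2ennreal (g x) \<partial>?M) - enn2ereal (\<integral>\<^sup>+x. e2ennreal (- g x) \<partial>?M)"
    unfolding real_lebesgue_integral_def[OF int] p n
    using P N by (cases "\<integral>\<^sup>+x. e2ennreal (g x) \<partial>?M"; cases "\<integral>\<^sup>+x. e2ennreal (- g x) \<partial>?M") auto
  then show "ereal (LINT x|?M. real_of_ereal (g x)) = lsc_integral \<mu> g" using J by simp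
qed

lemma lsc_integral_finite_if_integrable:
  fixes \<mu> :: "'a::t2_space functional"
  assumes lc: "locally_compact_space (euclidean :: 'a topology)"
    and \<mu>: "\<mu> \<in> radon_pos" and g: "g \<in> Phi" and AE: "AE x in borel_measure \<mu>. \<bar>g x\<bar> \<noteq> \<infinity>"
    and int: "integrable (borel_measure \<mu>) (\<lambda>x. real_of_ereal (g x))"
  shows "lsc_integral \<mu> g < \<infinity>"
proof -
  let ?M = "borel_measure \<mu>"
  have p: "(\<integral>\<^sup>+x. ennreal (real_of_ereal (g x)) \<partial>?M) = (\<integral>\<^sup>+x. e2ennreal (g x) \<partial>?M)"
    by (rule nn_integral_cong_AE, rule eventually_mono[OF AE]) (rule ennreal_real_of_ereal)
  have "(\<integral>\<^sup>+x. e2ennreal (g x) \<partial>?M) < top"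
    using int unfolding real_integrable_def p by (simp add: less_top)
  then have "ext_integral ?M g < \<infinity>"
    unfolding ext_integral_def using enn2ereal_nonneg[of "\<integral>\<^sup>+x. e2ennreal (- g x) \<partial>?M"]
    by (cases "\<integral>\<^sup>+x. e2ennreal (g x) \<partial>?M"; cases "enn2ereal (\<integral>\<^sup>+x. e2ennreal (- g x) \<partial>?M)") auto
  then show ?thesis using ext_integral_borel_measure(1)[OF lc \<mu> g] by simp
qed

section \<open>The Jordan decomposition\<close>

definition pos_sup :: "'a::topological_space functional \<Rightarrow> ('a \<Rightarrow> real) \<Rightarrow> real" where
  "pos_sup \<mu> \<phi> = Sup {\<mu> \<psi> | \<psi>. \<psi> \<in> Cc \<and> (\<forall>x. 0 \<le> \<psi> x \<and> \<psi> x \<le> \<phi> x)}"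

lemma pos_part_eq:
  "pos_part \<mu> \<phi> = (if \<phi> \<in> Cc then pos_sup \<mu> (\<lambda>x. max 0 (\<phi> x)) - pos_sup \<mu> (\<lambda>x. max 0 (- \<phi> x)) else 0)"
  unfolding pos_part_def pos_sup_def ..

text \<open>All competitors are supported by one compact set and uniformly bounded, so the local
  bound of a Radon measure makes the set bounded above. Without that the supremum of reals would be
  an arbitrary value.\<close>

lemma pos_sup_upper:
  fixes \<mu> :: "'a::t2_space functional"
  assumes \<mu>: "\<mu> \<in> radon" and \<phi>: "\<phi> \<in> Cc" and \<psi>: "\<psi> \<in> Cc" "\<And>x. 0 \<le> \<psi> x" "\<And>x. \<psi> x \<le> \<phi> x"
  shows "\<mu> \<psi> \<le> pos_sup \<mu> \<phi>"
proof -
  obtain K where K: "compact K" "\<And>x. x \<notin> K \<Longrightarrow> \<phi> x = 0" using CcE[OF \<phi>] by blast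
  obtain B where B: "\<And>\<psi>. \<psi> \<in> Cc \<Longrightarrow> {x. \<psi> x \<noteq> 0} \<subseteq> K \<Longrightarrow> \<bar>\<mu> \<psi>\<bar> \<le> B * (SUP x. \<bar>\<psi> x\<bar>)"
    using radon_bounded[OF \<mu> K(1)] by blast
  obtain M where M: "0 \<le> M" "\<And>x. \<bar>\<phi> x\<bar> \<le> M" using Cc_bounded[OF \<phi>] by blast
  have "\<mu> \<psi> \<le> \<bar>B\<bar> * M" if \<psi>: "\<psi> \<in> Cc" "\<And>x. 0 \<le> \<psi> x" "\<And>x. \<psi> x \<le> \<phi> x" for \<psi>
  proof -
    have "{x. \<psi> x \<noteq> 0} \<subseteq> K"
      using K(2) \<psi>(2,3) by (metis (mono_tags, lifting) mem_Collect_eq order_antisym subsetI)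
    then have "\<mu> \<psi> \<le> B * (SUP x. \<bar>\<psi> x\<bar>)" using B[OF \<psi>(1)] by linarith
    also have "\<dots> \<le> \<bar>B\<bar> * M"
    proof (rule mult_mono)
      have le: "\<bar>\<psi> x\<bar> \<le> M" for x using \<psi>(2,3)[of x] M(2)[of x] by linarith
      show "(SUP x. \<bar>\<psi> x\<bar>) \<le> M" by (rule cSUP_least) (use le in auto)
      show "0 \<le> (SUP x. \<bar>\<psi> x\<bar>)" using Cc_le_SUP[OF \<psi>(1)] abs_ge_zero order_trans by blast
    qed auto
    finally show ?thesis .
  qed
  then have "bdd_above {\<mu> \<psi> | \<psi>. \<psi> \<in> Cc \<and> (\<forall>x. 0 \<le> \<psi> x \<and> \<psi> x \<le> \<phi> x)}"
    by (intro bdd_aboveI[where M="\<bar>B\<bar> * M"]) blast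
  then show ?thesis
    unfolding pos_sup_def using \<psi> by (intro cSup_upper) blast+
qed

lemma pos_sup_least:
  fixes \<mu> :: "'a::t2_space functional"
  assumes "\<And>x. 0 \<le> \<phi> x" "\<And>\<psi>. \<psi> \<in> Cc \<Longrightarrow> (\<And>x. 0 \<le> \<psi> x) \<Longrightarrow> (\<And>x. \<psi> x \<le> \<phi> x) \<Longrightarrow> \<mu> \<psi> \<le> u"
  shows "pos_sup \<mu> \<phi> \<le> u"
  unfolding pos_sup_def
proof (rule cSup_least)
  have "\<mu> (\<lambda>_. 0) \<in> {\<mu> \<psi> | \<psi>. \<psi> \<in> Cc \<and> (\<forall>x. 0 \<le> \<psi> x \<and> \<psi> x \<le> \<phi> x)}"
    using assms(1) by (auto intro!: exI[of _ "\<lambda>_. 0"])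
  then show "{\<mu> \<psi> | \<psi>. \<psi> \<in> Cc \<and> (\<forall>x. 0 \<le> \<psi> x \<and> \<psi> x \<le> \<phi> x)} \<noteq> {}"
    by blast
qed (use assms(2) in blast)

lemma pos_sup_add:
  fixes \<mu> :: "'a::t2_space functional"
  assumes \<mu>: "\<mu> \<in> radon" and \<phi>: "\<phi> \<in> Cc" "\<And>x. 0 \<le> \<phi> x" and \<psi>: "\<psi> \<in> Cc" "\<And>x. 0 \<le> \<psi> x"
  shows "pos_sup \<mu> (\<lambda>x. \<phi> x + \<psi> x) = pos_sup \<mu> \<phi> + pos_sup \<mu> \<psi>"
proof (rule antisym)
  show "pos_sup \<mu> (\<lambda>x. \<phi> x + \<psi> x) \<le> pos_sup \<mu> \<phi> + pos_sup \<mu> \<psi>"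
  proof (rule pos_sup_least)
    fix \<eta> assume \<eta>: "\<eta> \<in> Cc" "\<And>x. 0 \<le> \<eta> x" "\<And>x. \<eta> x \<le> \<phi> x + \<psi> x"
    \<comment> \<open>The Riesz decomposition property: a function between 0 and \<phi> + \<psi> is
      the sum of one below \<phi> and one below \<psi>.\<close>
    let ?a = "\<lambda>x. min (\<eta> x) (\<phi> x)" and ?b = "\<lambda>x. \<eta> x - min (\<eta> x) (\<phi> x)"
    have a: "?a \<in> Cc" using \<eta>(1) \<phi>(1) by (rule Cc_min)
    have b: "?b \<in> Cc" using \<eta>(1) a by (rule Cc_diff)
    have "\<mu> ?a \<le> pos_sup \<mu> \<phi>" using \<eta>(2) \<phi>(2) by (intro pos_sup_upper[OF \<mu> \<phi>(1) a]) auto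
    moreover have "\<mu> ?b \<le> pos_sup \<mu> \<psi>"
    proof (rule pos_sup_upper[OF \<mu> \<psi>(1) b])
      show "0 \<le> \<eta> x - min (\<eta> x) (\<phi> x)" for x by simp
      show "\<eta> x - min (\<eta> x) (\<phi> x) \<le> \<psi> x" for x using \<eta>(3)[of x] \<psi>(2)[of x] by (simp add: min_def)
    qed
    moreover have "\<mu> \<eta> = \<mu> ?a + \<mu> ?b" using radon_add[OF \<mu> a b] by simp
    ultimately show "\<mu> \<eta> \<le> pos_sup \<mu> \<phi> + pos_sup \<mu> \<psi>" by simp
  qed (use \<phi>(2) \<psi>(2) in simp)
  have "pos_sup \<mu> \<phi> \<le> pos_sup \<mu> (\<lambda>x. \<phi> x + \<psi> x) - pos_sup \<mu> \<psi>"
  proof (rule pos_sup_least[OF \<phi>(2)])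
    fix a assume a: "a \<in> Cc" "\<And>x. 0 \<le> a x" "\<And>x. a x \<le> \<phi> x"
    have "pos_sup \<mu> \<psi> \<le> pos_sup \<mu> (\<lambda>x. \<phi> x + \<psi> x) - \<mu> a"
    proof (rule pos_sup_least[OF \<psi>(2)])
      fix b assume b: "b \<in> Cc" "\<And>x. 0 \<le> b x" "\<And>x. b x \<le> \<psi> x"
      have "\<mu> (\<lambda>x. a x + b x) \<le> pos_sup \<mu> (\<lambda>x. \<phi> x + \<psi> x)"
        by (rule pos_sup_upper[OF \<mu> Cc_add[OF \<phi>(1) \<psi>(1)] Cc_add[OF a(1) b(1)]])
          (use a b in \<open>auto intro: add_mono add_nonneg_nonneg\<close>)
      then show "\<mu> b \<le> pos_sup \<mu> (\<lambda>x. \<phi> x + \<psi> x) - \<mu> a"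
        using radon_add[OF \<mu> a(1) b(1)] by simp
    qed
    then show "\<mu> a \<le> pos_sup \<mu> (\<lambda>x. \<phi> x + \<psi> x) - pos_sup \<mu> \<psi>" by simp
  qed
  then show "pos_sup \<mu> \<phi> + pos_sup \<mu> \<psi> \<le> pos_sup \<mu> (\<lambda>x. \<phi> x + \<psi> x)" by simp
qed

lemma pos_sup_zero:
  fixes \<mu> :: "'a::t2_space functional"
  assumes "\<mu> \<in> radon"
  shows "pos_sup \<mu> (\<lambda>x. 0) = 0"
  using pos_sup_add[OF assms, of "\<lambda>x. 0" "\<lambda>x. 0"] by simp

lemma pos_sup_scale:
  fixes \<mu> :: "'a::t2_space functional"
  assumes \<mu>: "\<mu> \<in> radon" and \<phi>: "\<phi> \<in> Cc" "\<And>x. 0 \<le> \<phi> x" and c: "0 \<le> c"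
  shows "pos_sup \<mu> (\<lambda>x. c * \<phi> x) = c * pos_sup \<mu> \<phi>"
proof (cases "c = 0")
  case True
  then show ?thesis using pos_sup_zero[OF \<mu>] by simp
next
  case False
  have le: "c * pos_sup \<mu> \<phi> \<le> pos_sup \<mu> (\<lambda>x. c * \<phi> x)"
    if c: "0 < c" and \<phi>: "\<phi> \<in> Cc" "\<And>x. 0 \<le> \<phi> x" for c \<phi>
  proof -
    have "pos_sup \<mu> \<phi> \<le> pos_sup \<mu> (\<lambda>x. c * \<phi> x) / c"
    proof (rule pos_sup_least[OF \<phi>(2)])
      fix a assume a: "a \<in> Cc" "\<And>x. 0 \<le> a x" "\<And>x. a x \<le> \<phi> x"
      have "\<mu> (\<lambda>x. c * a x) \<le> pos_sup \<mu> (\<lambda>x. c * \<phi> x)"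
        by (rule pos_sup_upper[OF \<mu> Cc_scale[OF \<phi>(1)] Cc_scale[OF a(1)]]) (use a c in auto)
      then show "\<mu> a \<le> pos_sup \<mu> (\<lambda>x. c * \<phi> x) / c"
        using radon_scale[OF \<mu> a(1), of c] c by (simp add: field_simps)
    qed
    then show ?thesis using c by (simp add: field_simps)
  qed
  have c: "0 < c" using c False by simp
  have "(1/c) * pos_sup \<mu> (\<lambda>x. c * \<phi> x) \<le> pos_sup \<mu> (\<lambda>x. (1/c) * (c * \<phi> x))"
    using c \<phi> by (intro le Cc_scale) auto
  then have "pos_sup \<mu> (\<lambda>x. c * \<phi> x) \<le> c * pos_sup \<mu> \<phi>"
    using c by (simp add: field_simps)
  then show ?thesis using le[OF c \<phi>] by simp
qed

text \<open>For \<phi> = a - b one has \<phi>^+ + b = \<phi>^- + a, and \<open>pos_sup\<close> is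
  additive on nonnegative functions. The freedom in choosing \<open>a\<close> and \<open>b\<close>
  makes linearity of \<open>pos_part\<close> immediate.\<close>

lemma pos_part_diff:
  fixes \<mu> :: "'a::t2_space functional"
  assumes \<mu>: "\<mu> \<in> radon" and a: "a \<in> Cc" "\<And>x. 0 \<le> a x" and b: "b \<in> Cc" "\<And>x. 0 \<le> b x"
  shows "pos_part \<mu> (\<lambda>x. a x - b x) = pos_sup \<mu> a - pos_sup \<mu> b"
proof -
  let ?p = "\<lambda>x. max 0 (a x - b x)" and ?n = "\<lambda>x. max 0 (- (a x - b x))"
  have d: "(\<lambda>x. a x - b x) \<in> Cc" using a(1) b(1) by (rule Cc_diff)
  have p: "?p \<in> Cc" using d by (rule Cc_pos)
  have n: "?n \<in> Cc" using Cc_minus[OF d] by (rule Cc_pos)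
  have "(\<lambda>x. ?p x + b x) = (\<lambda>x. ?n x + a x)" by (auto simp: max_def)
  moreover have "pos_sup \<mu> (\<lambda>x. ?p x + b x) = pos_sup \<mu> ?p + pos_sup \<mu> b"
    by (rule pos_sup_add[OF \<mu> p _ b]) simp
  moreover have "pos_sup \<mu> (\<lambda>x. ?n x + a x) = pos_sup \<mu> ?n + pos_sup \<mu> a"
    by (rule pos_sup_add[OF \<mu> n _ a]) simp
  ultimately have "pos_sup \<mu> ?p + pos_sup \<mu> b = pos_sup \<mu> ?n + pos_sup \<mu> a" by simp
  then show ?thesis using d by (simp add: pos_part_eq)
qed

lemma pos_part_nonneg:
  fixes \<mu> :: "'a::t2_space functional"
  assumes \<mu>: "\<mu> \<in> radon" and a: "a \<in> Cc" "\<And>x. 0 \<le> a x"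
  shows "pos_part \<mu> a = pos_sup \<mu> a"
  using pos_part_diff[OF \<mu> a, of "\<lambda>x. 0"] pos_sup_zero[OF \<mu>] by simp

lemma Cc_pos_neg:
  fixes \<phi> :: "'a::t2_space \<Rightarrow> real"
  assumes "\<phi> \<in> Cc"
  obtains a b where "a \<in> Cc" "\<And>x. 0 \<le> a x" "b \<in> Cc" "\<And>x. 0 \<le> b x" "\<phi> = (\<lambda>x. a x - b x)"
proof (rule that)
  show "(\<lambda>x. max 0 (\<phi> x)) \<in> Cc" "(\<lambda>x. max 0 (- \<phi> x)) \<in> Cc"
    using Cc_pos[OF assms] Cc_pos[OF Cc_minus[OF assms]] by auto
  show "\<phi> = (\<lambda>x. max 0 (\<phi> x) - max 0 (- \<phi> x))" by (auto simp: max_def)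
qed auto

lemma pos_part_radon_pos:
  fixes \<mu> :: "'a::t2_space functional"
  assumes lc: "locally_compact_space (euclidean :: 'a topology)" and \<mu>: "\<mu> \<in> radon"
  shows "pos_part \<mu> \<in> radon_pos"
proof (rule radon_posI[OF lc])
  fix \<phi> \<psi> :: "'a \<Rightarrow> real" assume \<phi>C: "\<phi> \<in> Cc" and \<psi>C: "\<psi> \<in> Cc"
  obtain a b where a: "a \<in> Cc" "\<And>x. 0 \<le> a x" and b: "b \<in> Cc" "\<And>x. 0 \<le> b x"
    and \<phi>: "\<phi> = (\<lambda>x. a x - b x)" using Cc_pos_neg[OF \<phi>C] by blast
  obtain a' b' where a': "a' \<in> Cc" "\<And>x. 0 \<le> a' x" and b': "b' \<in> Cc" "\<And>x. 0 \<le> b' x"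
    and \<psi>: "\<psi> = (\<lambda>x. a' x - b' x)" using Cc_pos_neg[OF \<psi>C] by blast
  have eq: "(\<lambda>x. \<phi> x + \<psi> x) = (\<lambda>x. (a x + a' x) - (b x + b' x))" by (auto simp: \<phi> \<psi>)
  have "pos_part \<mu> (\<lambda>x. \<phi> x + \<psi> x) = pos_sup \<mu> (\<lambda>x. a x + a' x) - pos_sup \<mu> (\<lambda>x. b x + b' x)"
    unfolding eq using a a' b b' by (intro pos_part_diff[OF \<mu>] Cc_add add_nonneg_nonneg)
  then show "pos_part \<mu> (\<lambda>x. \<phi> x + \<psi> x) = pos_part \<mu> \<phi> + pos_part \<mu> \<psi>"
    unfolding pos_sup_add[OF \<mu> a a'] pos_sup_add[OF \<mu> b b'] \<phi> \<psi>
      pos_part_diff[OF \<mu> a b] pos_part_diff[OF \<mu> a' b'] by simp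
next
  fix c :: real and \<phi> :: "'a \<Rightarrow> real" assume \<phi>C: "\<phi> \<in> Cc"
  obtain a b where a: "a \<in> Cc" "\<And>x. 0 \<le> a x" and b: "b \<in> Cc" "\<And>x. 0 \<le> b x"
    and \<phi>: "\<phi> = (\<lambda>x. a x - b x)" using Cc_pos_neg[OF \<phi>C] by blast
  show "pos_part \<mu> (\<lambda>x. c * \<phi> x) = c * pos_part \<mu> \<phi>"
  proof (cases "0 \<le> c")
    case True
    have eq: "(\<lambda>x. c * \<phi> x) = (\<lambda>x. c * a x - c * b x)" by (auto simp: \<phi> algebra_simps)
    have "pos_part \<mu> (\<lambda>x. c * \<phi> x) = pos_sup \<mu> (\<lambda>x. c * a x) - pos_sup \<mu> (\<lambda>x. c * b x)"
      unfolding eq using a b True by (intro pos_part_diff[OF \<mu>] Cc_scale mult_nonneg_nonneg)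
    then show ?thesis
      unfolding pos_sup_scale[OF \<mu> a True] pos_sup_scale[OF \<mu> b True] \<phi> pos_part_diff[OF \<mu> a b]
      by (simp add: algebra_simps)
  next
    case False
    then have c: "0 \<le> - c" by simp
    have eq: "(\<lambda>x. c * \<phi> x) = (\<lambda>x. (- c) * b x - (- c) * a x)" by (auto simp: \<phi> algebra_simps)
    have "pos_part \<mu> (\<lambda>x. c * \<phi> x) = pos_sup \<mu> (\<lambda>x. (- c) * b x) - pos_sup \<mu> (\<lambda>x. (- c) * a x)"
      unfolding eq using a b c by (intro pos_part_diff[OF \<mu>] Cc_scale mult_nonneg_nonneg)
    then show ?thesis
      unfolding pos_sup_scale[OF \<mu> a c] pos_sup_scale[OF \<mu> b c] \<phi> pos_part_diff[OF \<mu> a b]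
      by (simp add: algebra_simps)
  qed
next
  fix \<phi> :: "'a \<Rightarrow> real" assume \<phi>: "\<phi> \<in> Cc" "\<And>x. 0 \<le> \<phi> x"
  have "\<mu> (\<lambda>x. 0) \<le> pos_sup \<mu> \<phi>"
    using \<phi> by (intro pos_sup_upper[OF \<mu>]) auto
  then show "0 \<le> pos_part \<mu> \<phi>"
    using radon_zero[OF \<mu>] pos_part_nonneg[OF \<mu> \<phi>] by simp
next
  show "pos_part \<mu> \<phi> = 0" if "\<phi> \<notin> Cc" for \<phi> using that by (simp add: pos_part_eq)
qed

lemma radon_minus:
  fixes \<mu> :: "'a::t2_space functional"
  assumes "\<mu> \<in> radon"
  shows "(\<lambda>\<phi>. - \<mu> \<phi>) \<in> radon"
  using radon_diff_radon[OF radon_pos_radon[OF radon_pos_zero] assms] by simp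

lemma neg_part_radon_pos:
  fixes \<mu> :: "'a::t2_space functional"
  assumes "locally_compact_space (euclidean :: 'a topology)" "\<mu> \<in> radon"
  shows "neg_part \<mu> \<in> radon_pos"
  unfolding neg_part_def using assms(1) radon_minus[OF assms(2)] by (rule pos_part_radon_pos)

text \<open>Every \<psi> between 0 and \<phi> satisfies \<mu>(\<psi>) \<le> P(\<psi>) \<le>
  P(\<phi>). This is the minimality of the Jordan decomposition: \<open>pos_part \<mu>\<close> is
  the least positive measure above \<mu>.\<close>

lemma pos_part_le:
  fixes \<mu> P :: "'a::t2_space functional"
  assumes \<mu>: "\<mu> \<in> radon" and P: "P \<in> radon_pos"
    and le: "\<And>\<phi>. \<phi> \<in> Cc \<Longrightarrow> (\<And>x. 0 \<le> \<phi> x) \<Longrightarrow> \<mu> \<phi> \<le> P \<phi>"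
    and \<phi>: "\<phi> \<in> Cc" "\<And>x. 0 \<le> \<phi> x"
  shows "pos_part \<mu> \<phi> \<le> P \<phi>"
  unfolding pos_part_nonneg[OF \<mu> \<phi>]
proof (rule pos_sup_least[OF \<phi>(2)])
  fix \<psi> assume \<psi>: "\<psi> \<in> Cc" "\<And>x. 0 \<le> \<psi> x" "\<And>x. \<psi> x \<le> \<phi> x"
  then show "\<mu> \<psi> \<le> P \<phi>"
    using le[OF \<psi>(1,2)] radon_pos_mono[OF P \<psi>(1) \<phi>(1) \<psi>(3)] by linarith
qed

lemma pos_part_minus_neg_part:
  fixes \<mu> :: "'a::t2_space functional"
  assumes \<mu>: "\<mu> \<in> radon"
  shows "pos_part \<mu> \<phi> - neg_part \<mu> \<phi> = \<mu> \<phi>"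
proof (cases "\<phi> \<in> Cc")
  case False
  then show ?thesis by (simp add: neg_part_def pos_part_eq radon_outside[OF \<mu>])
next
  case True
  have m: "(\<lambda>\<phi>. - \<mu> \<phi>) \<in> radon" using \<mu> by (rule radon_minus)
  \<comment> \<open>The involution \<psi> \<mapsto> a - \<psi> of the order interval [0, a]
    exchanges the suprema for \<mu> and for -\<mu>, up to the constant \<mu>(a).\<close>
  have *: "pos_sup \<mu> a - pos_sup (\<lambda>\<phi>. - \<mu> \<phi>) a = \<mu> a" if a: "a \<in> Cc" "\<And>x. 0 \<le> a x" for a
  proof -
    have "pos_sup (\<lambda>\<phi>. - \<mu> \<phi>) a \<le> pos_sup \<mu> a - \<mu> a"
    proof (rule pos_sup_least[OF a(2)])
      fix \<psi> assume \<psi>: "\<psi> \<in> Cc" "\<And>x. 0 \<le> \<psi> x" "\<And>x. \<psi> x \<le> a x"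
      have "\<mu> (\<lambda>x. a x - \<psi> x) \<le> pos_sup \<mu> a"
        using \<psi> by (intro pos_sup_upper[OF \<mu> a(1)] Cc_diff a(1)) auto
      then show "- \<mu> \<psi> \<le> pos_sup \<mu> a - \<mu> a" using radon_diff[OF \<mu> a(1) \<psi>(1)] by simp
    qed
    moreover have "pos_sup \<mu> a \<le> pos_sup (\<lambda>\<phi>. - \<mu> \<phi>) a + \<mu> a"
    proof (rule pos_sup_least[OF a(2)])
      fix \<psi> assume \<psi>: "\<psi> \<in> Cc" "\<And>x. 0 \<le> \<psi> x" "\<And>x. \<psi> x \<le> a x"
      have "- \<mu> (\<lambda>x. a x - \<psi> x) \<le> pos_sup (\<lambda>\<phi>. - \<mu> \<phi>) a"
        using \<psi> by (intro pos_sup_upper[OF m a(1)] Cc_diff a(1)) auto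
      then show "\<mu> \<psi> \<le> pos_sup (\<lambda>\<phi>. - \<mu> \<phi>) a + \<mu> a" using radon_diff[OF \<mu> a(1) \<psi>(1)] by simp
    qed
    ultimately show ?thesis by simp
  qed
  obtain a b where a: "a \<in> Cc" "\<And>x. 0 \<le> a x" and b: "b \<in> Cc" "\<And>x. 0 \<le> b x"
    and \<phi>: "\<phi> = (\<lambda>x. a x - b x)" using Cc_pos_neg[OF True] by blast
  show ?thesis
    unfolding neg_part_def \<phi> pos_part_diff[OF \<mu> a b] pos_part_diff[OF m a b] radon_diff[OF \<mu> a(1) b(1)]
    using *[OF a] *[OF b] by simp
qed

lemma pos_part_of_pos:
  fixes \<mu> :: "'a::t2_space functional"
  assumes lc: "locally_compact_space (euclidean :: 'a topology)" and \<mu>: "\<mu> \<in> radon_pos"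
  shows "pos_part \<mu> = \<mu>" "neg_part \<mu> = (\<lambda>_. 0)"
proof -
  have r: "\<mu> \<in> radon" using \<mu> by (rule radon_pos_radon)
  have eq: "pos_part \<mu> a = \<mu> a" if a: "a \<in> Cc" "\<And>x. 0 \<le> a x" for a
    using pos_part_le[OF r \<mu> order_refl a] pos_sup_upper[OF r a(1) a order_refl] pos_part_nonneg[OF r a] by simp
  show p: "pos_part \<mu> = \<mu>"
  proof (rule radon_eqI[OF radon_pos_radon[OF pos_part_radon_pos[OF lc r]] r])
    fix \<phi> :: "'a \<Rightarrow> real" assume \<phi>C: "\<phi> \<in> Cc"
    obtain a b where a: "a \<in> Cc" "\<And>x. 0 \<le> a x" and b: "b \<in> Cc" "\<And>x. 0 \<le> b x"
      and \<phi>: "\<phi> = (\<lambda>x. a x - b x)" using Cc_pos_neg[OF \<phi>C] by blast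
    show "pos_part \<mu> \<phi> = \<mu> \<phi>"
      unfolding \<phi> pos_part_diff[OF r a b] radon_diff[OF r a(1) b(1)]
      using eq[OF a] eq[OF b] pos_part_nonneg[OF r a] pos_part_nonneg[OF r b] by simp
  qed
  show "neg_part \<mu> = (\<lambda>_. 0)"
    using pos_part_minus_neg_part[OF r] unfolding p by (intro ext) simp
qed

section \<open>Integrals against signed measures\<close>

lemma lsc_integral_zero_measure:
  fixes g :: "'a::t2_space \<Rightarrow> ereal"
  assumes "g \<in> Phi"
  shows "lsc_integral (\<lambda>_. 0) g = 0"
  using below_directed[OF assms] by (simp add: lsc_integral_def directed_def zero_ereal_def)

lemma signed_integral_pos:
  fixes \<mu> :: "'a::t2_space functional"
  assumes lc: "locally_compact_space (euclidean :: 'a topology)" and \<mu>: "\<mu> \<in> radon_pos" and g: "g \<in> Phi"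
  shows "signed_integral_defined \<mu> g" "signed_integral \<mu> g = lsc_integral \<mu> g"
  unfolding signed_integral_defined_def signed_integral_def pos_part_of_pos[OF lc \<mu>]
    ext_integral_borel_measure(1)[OF lc \<mu> g] ext_integral_borel_measure(1)[OF lc radon_pos_zero g]
    lsc_integral_zero_measure[OF g] by simp_all

lemma signed_integral_parts:
  fixes \<mu> :: "'a::t2_space functional"
  assumes lc: "locally_compact_space (euclidean :: 'a topology)" and \<mu>: "\<mu> \<in> radon" and g: "g \<in> Phi"
  shows "signed_integral_defined \<mu> g \<longleftrightarrow> \<not> (lsc_integral (pos_part \<mu>) g = \<infinity> \<and> lsc_integral (neg_part \<mu>) g = \<infinity>)"
    and "signed_integral \<mu> g = lsc_integral (pos_part \<mu>) g - lsc_integral (neg_part \<mu>) g"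
  unfolding signed_integral_defined_def signed_integral_def
    ext_integral_borel_measure(1)[OF lc pos_part_radon_pos[OF lc \<mu>] g]
    ext_integral_borel_measure(1)[OF lc neg_part_radon_pos[OF lc \<mu>] g] by simp_all

text \<open>The two parts of \<open>P - N\<close> arise from \<open>P\<close> and \<open>N\<close> by cancelling a common positive measure.\<close>

lemma signed_integral_diff:
  fixes P N :: "'a::t2_space functional"
  assumes lc: "locally_compact_space (euclidean :: 'a topology)"
    and P: "P \<in> radon_pos" and N: "N \<in> radon_pos" and g: "g \<in> Phi"
    and T: "T = (\<lambda>\<phi>. P \<phi> - N \<phi>)" and fin: "lsc_integral P g < \<infinity>"
  shows "signed_integral_defined T g" "signed_integral T g = lsc_integral P g - lsc_integral N g"
proof -
  have Tr: "T \<in> radon" unfolding T using P N by (intro radon_diff_radon radon_pos_radon)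
  have pp: "pos_part T \<in> radon_pos" and np: "neg_part T \<in> radon_pos"
    using pos_part_radon_pos[OF lc Tr] neg_part_radon_pos[OF lc Tr] by auto
  \<comment> \<open>The common measure to be cancelled, equal to P - T^+ and to N - T^-. It is
    positive because \<open>P\<close> lies above \<open>T\<close> and T^+ is the least positive
    measure that does.\<close>
  define R where "R = (\<lambda>\<phi>. P \<phi> - pos_part T \<phi>)"
  have R: "R \<in> radon_pos"
    unfolding R_def
  proof (rule radon_pos_diff[OF lc radon_pos_radon[OF P] radon_pos_radon[OF pp]])
    fix \<phi> :: "'a \<Rightarrow> real" assume \<phi>: "\<phi> \<in> Cc" "\<And>x. 0 \<le> \<phi> x"
    show "pos_part T \<phi> \<le> P \<phi>"
      using radon_pos_nonneg[OF N] by (intro pos_part_le[OF Tr P _ \<phi>]) (auto simp: T)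
  qed
  have Peq: "P = (\<lambda>\<phi>. pos_part T \<phi> + R \<phi>)" by (auto simp: R_def)
  have "N \<phi> = neg_part T \<phi> + R \<phi>" for \<phi>
    using pos_part_minus_neg_part[OF Tr, of \<phi>] by (simp add: R_def T)
  then have Neq: "N = (\<lambda>\<phi>. neg_part T \<phi> + R \<phi>)" by auto
  have 1: "lsc_integral P g = lsc_integral (pos_part T) g + lsc_integral R g"
    by (subst Peq) (rule lsc_integral_add_measure[OF pp R g])
  have 2: "lsc_integral N g = lsc_integral (neg_part T) g + lsc_integral R g"
    by (subst Neq) (rule lsc_integral_add_measure[OF np R g])
  have nm: "lsc_integral (pos_part T) g \<noteq> -\<infinity>" "lsc_integral R g \<noteq> -\<infinity>" "lsc_integral (neg_part T) g \<noteq> -\<infinity>"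
    using lsc_integral_not_MInf[OF g] by auto
  then obtain p r where pr: "lsc_integral (pos_part T) g = ereal p" "lsc_integral R g = ereal r"
    using 1 fin by (cases "lsc_integral (pos_part T) g"; cases "lsc_integral R g") auto
  show "signed_integral_defined T g"
    unfolding signed_integral_parts(1)[OF lc Tr g] using pr by simp
  show "signed_integral T g = lsc_integral P g - lsc_integral N g"
    unfolding signed_integral_parts(2)[OF lc Tr g] 1 2 pr using nm
    by (cases "lsc_integral (neg_part T) g") auto
qed

section \<open>Tensor products\<close>

lemma locally_compact_space_prod:
  assumes "locally_compact_space (euclidean :: 'a::topological_space topology)"
    and "locally_compact_space (euclidean :: 'b::topological_space topology)"
  shows "locally_compact_space (euclidean :: ('a \<times> 'b) topology)"
  unfolding locally_compact_space_def
proof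
  fix p :: "'a \<times> 'b"
  obtain x y where p: "p = (x, y)" by fastforce
  obtain U K where U: "open U" "compact K" "x \<in> U" "U \<subseteq> K"
    using assms(1) unfolding locally_compact_space_def topspace_euclidean compactin_euclidean_iff open_openin[symmetric]
    by (meson UNIV_I)
  obtain V L where V: "open V" "compact L" "y \<in> V" "V \<subseteq> L"
    using assms(2) unfolding locally_compact_space_def topspace_euclidean compactin_euclidean_iff open_openin[symmetric]
    by (meson UNIV_I)
  have "open (U \<times> V)" "compact (K \<times> L)" "p \<in> U \<times> V" "U \<times> V \<subseteq> K \<times> L"
    using U V p by (auto intro: open_Times compact_Times)
  then show "\<exists>U K. openin euclidean U \<and> compactin euclidean K \<and> p \<in> U \<and> U \<subseteq> K"
    unfolding open_openin[symmetric] compactin_euclidean_iff by blast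
qed

text \<open>A rectangle containing the support, obtained from its projections, because cut-off
  functions are chosen separately in each variable.\<close>

lemma Cc_support_Times:
  fixes F :: "'a::t2_space \<times> 'b::t2_space \<Rightarrow> real"
  assumes "F \<in> Cc"
  obtains A B where "compact A" "compact B" "\<And>x y. x \<notin> A \<or> y \<notin> B \<Longrightarrow> F (x, y) = 0"
proof -
  obtain K where K: "compact K" "\<And>p. p \<notin> K \<Longrightarrow> F p = 0" using CcE[OF assms] by blast
  have "compact (fst ` K)" "compact (snd ` K)"
    using K(1) by (auto intro!: compact_continuous_image continuous_on_fst continuous_on_snd continuous_on_id)
  moreover have "F (x, y) = 0" if "x \<notin> fst ` K \<or> y \<notin> snd ` K" for x y
    using that K(2)[of "(x, y)"] by (metis fst_conv imageI snd_conv)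
  ultimately show ?thesis using that by blast
qed

lemma continuous_on_slice:
  assumes "continuous_on UNIV F"
  shows "continuous_on UNIV (\<lambda>y. F (x, y))"
  using continuous_on_compose2[OF assms, of UNIV "\<lambda>y. (x, y)"] by (simp add: continuous_on_Pair)

lemma Cc_slice:
  fixes F :: "'a::t2_space \<times> 'b::t2_space \<Rightarrow> real"
  assumes "F \<in> Cc"
  shows "(\<lambda>y. F (x, y)) \<in> Cc"
proof -
  obtain A B where "compact B" "\<And>y. y \<notin> B \<Longrightarrow> F (x, y) = 0" using Cc_support_Times[OF assms] by metis
  then show ?thesis by (intro CcI[OF continuous_on_slice[OF Cc_continuous[OF assms]]])
qed

lemma radon_pos_abs_le:
  fixes \<phi> \<psi> :: "'a::t2_space \<Rightarrow> real"
  assumes \<mu>: "\<mu> \<in> radon_pos" and \<phi>: "\<phi> \<in> Cc" and \<psi>: "\<psi> \<in> Cc" and le: "\<And>x. \<bar>\<phi> x\<bar> \<le> \<psi> x"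
  shows "\<bar>\<mu> \<phi>\<bar> \<le> \<mu> \<psi>"
proof -
  have "\<mu> \<phi> \<le> \<mu> \<psi>" by (rule radon_pos_mono[OF \<mu> \<phi> \<psi>]) (use le abs_le_D1 in blast)
  moreover have "\<mu> (\<lambda>x. - \<phi> x) \<le> \<mu> \<psi>"
    by (rule radon_pos_mono[OF \<mu> Cc_minus[OF \<phi>] \<psi>]) (use le abs_le_D2 in blast)
  moreover have "\<mu> (\<lambda>x. - \<phi> x) = - \<mu> \<phi>" using radon_scale[OF radon_pos_radon[OF \<mu>] \<phi>, of "-1"] by simp
  ultimately show ?thesis by simp
qed

text \<open>For x near x0 the slices are uniformly close on the compact set \<open>B\<close>, by the
  tube lemma, and vanish off it. The bump \<open>\<beta>\<close> converts this into an estimate of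
  the integrals.\<close>

lemma Cc_partial_integral:
  fixes F :: "'a::t2_space \<times> 'b::t2_space \<Rightarrow> real"
  assumes lc: "locally_compact_space (euclidean :: 'b topology)"
    and \<nu>: "\<nu> \<in> radon_pos" and F: "F \<in> Cc"
  shows "(\<lambda>x. \<nu> (\<lambda>y. F (x, y))) \<in> Cc"
proof -
  have \<nu>r: "\<nu> \<in> radon" using \<nu> by (rule radon_pos_radon)
  obtain A B where A: "compact A" and B: "compact B" and 0: "\<And>x y. x \<notin> A \<or> y \<notin> B \<Longrightarrow> F (x, y) = 0"
    using Cc_support_Times[OF F] by metis
  obtain \<beta> where \<beta>: "\<beta> \<in> Cc" "\<And>y. 0 \<le> \<beta> y" "\<And>y. y \<in> B \<Longrightarrow> \<beta> y = 1"
    using Cc_bump[OF lc B open_UNIV] by (metis UNIV_I subsetI)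
  have \<nu>\<beta>: "0 \<le> \<nu> \<beta>" using radon_pos_nonneg[OF \<nu> \<beta>(2)] .
  have "isCont (\<lambda>x. \<nu> (\<lambda>y. F (x, y))) x0" for x0
    unfolding isCont_def
  proof (rule tendstoI)
    fix e :: real assume e: "0 < e"
    define d where "d = e / (\<nu> \<beta> + 1)"
    have d: "0 < d" "d * \<nu> \<beta> < e" using e \<nu>\<beta> by (auto simp: d_def field_simps)
    obtain V where V: "x0 \<in> V" "open V" "\<forall>x\<in>V \<inter> UNIV. \<forall>y\<in>B. dist (F (x, y)) (F (x0, y)) \<le> d"
      by (rule continuous_on_prod_compactE[of UNIV B F x0 d])
        (use continuous_on_subset[OF Cc_continuous[OF F]] B d in auto)
    have "dist (\<nu> (\<lambda>y. F (x, y))) (\<nu> (\<lambda>y. F (x0, y))) < e" if x: "x \<in> V" for x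
    proof -
      have sl: "(\<lambda>y. F (x, y) - F (x0, y)) \<in> Cc" using F by (intro Cc_diff Cc_slice)
      have "\<bar>F (x, y) - F (x0, y)\<bar> \<le> d * \<beta> y" for y
      proof (cases "y \<in> B")
        case True
        then show ?thesis using V(3) x \<beta>(3) by (simp add: dist_real_def)
      next
        case False
        then show ?thesis using 0 \<beta>(2)[of y] d by simp
      qed
      then have "\<bar>\<nu> (\<lambda>y. F (x, y) - F (x0, y))\<bar> \<le> \<nu> (\<lambda>y. d * \<beta> y)"
        by (rule radon_pos_abs_le[OF \<nu> sl Cc_scale[OF \<beta>(1)]])
      then show ?thesis
        unfolding radon_diff[OF \<nu>r Cc_slice[OF F] Cc_slice[OF F]] radon_scale[OF \<nu>r \<beta>(1)]
        using d(2) by (simp add: dist_real_def)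
    qed
    then show "\<forall>\<^sub>F x in at x0. dist (\<nu> (\<lambda>y. F (x, y))) (\<nu> (\<lambda>y. F (x0, y))) < e"
      unfolding eventually_at_topological using V by blast
  qed
  then have "continuous_on UNIV (\<lambda>x. \<nu> (\<lambda>y. F (x, y)))"
    by (simp add: continuous_on_eq_continuous_at)
  then show ?thesis
    by (rule CcI[OF _ A]) (simp add: 0 radon_zero[OF \<nu>r])
qed

lemma tensor_radon_pos:
  fixes \<mu> :: "'a::t2_space functional" and \<nu> :: "'b::t2_space functional"
  assumes lca: "locally_compact_space (euclidean :: 'a topology)"
    and lcb: "locally_compact_space (euclidean :: 'b topology)"
    and \<mu>: "\<mu> \<in> radon_pos" and \<nu>: "\<nu> \<in> radon_pos"
  shows "tensor \<mu> \<nu> \<in> radon_pos"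
proof (rule radon_posI[OF locally_compact_space_prod[OF lca lcb]])
  have r: "\<mu> \<in> radon" "\<nu> \<in> radon" using \<mu> \<nu> by (auto intro: radon_pos_radon)
  note C = Cc_partial_integral[OF lcb \<nu>]
  fix F G :: "'a \<times> 'b \<Rightarrow> real" and c :: real assume F: "F \<in> Cc"
  show "tensor \<mu> \<nu> (\<lambda>p. F p + G p) = tensor \<mu> \<nu> F + tensor \<mu> \<nu> G" if G: "G \<in> Cc"
    using F G radon_add[OF r(2) Cc_slice[OF F] Cc_slice[OF G]] radon_add[OF r(1) C[OF F] C[OF G]] Cc_add[OF F G]
    by (simp add: tensor_def)
  show "tensor \<mu> \<nu> (\<lambda>p. c * F p) = c * tensor \<mu> \<nu> F"
    using F radon_scale[OF r(2) Cc_slice[OF F]] radon_scale[OF r(1) C[OF F]] Cc_scale[OF F]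
    by (simp add: tensor_def)
  show "0 \<le> tensor \<mu> \<nu> F" if "\<And>p. 0 \<le> F p"
    unfolding tensor_def using F that radon_pos_nonneg[OF \<mu>] radon_pos_nonneg[OF \<nu>] by simp
qed (simp add: tensor_def)

lemma tensor_add_left: "tensor (\<lambda>\<phi>. a \<phi> + b \<phi>) \<nu> = (\<lambda>F. tensor a \<nu> F + tensor b \<nu> F)"
  and tensor_scale_left: "tensor (\<lambda>\<phi>. c * a \<phi>) \<nu> = (\<lambda>F. c * tensor a \<nu> F)"
  by (auto simp: tensor_def)

lemma tensor_diff_right:
  fixes \<mu> :: "'a::t2_space functional" and a b :: "'b::t2_space functional"
  assumes lcb: "locally_compact_space (euclidean :: 'b topology)"
    and \<mu>: "\<mu> \<in> radon" and a: "a \<in> radon_pos" and b: "b \<in> radon_pos"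
  shows "tensor \<mu> (\<lambda>\<phi>. a \<phi> - b \<phi>) = (\<lambda>F. tensor \<mu> a F - tensor \<mu> b F)"
  using radon_diff[OF \<mu> Cc_partial_integral[OF lcb a] Cc_partial_integral[OF lcb b]]
  by (auto simp: tensor_def)

text \<open>Presents the tensor square of a signed measure as a difference of two positive measures,
  the form to which \<open>signed_integral_diff\<close> applies.\<close>

lemma tensor_diff_diff:
  fixes \<mu> \<nu> :: "'a::t2_space functional"
  assumes lc: "locally_compact_space (euclidean :: 'a topology)"
    and \<mu>: "\<mu> \<in> radon_pos" and \<nu>: "\<nu> \<in> radon_pos"
  shows "tensor (\<lambda>\<phi>. \<mu> \<phi> - \<nu> \<phi>) (\<lambda>\<phi>. \<mu> \<phi> - \<nu> \<phi>) =
    (\<lambda>F. (tensor \<mu> \<mu> F + tensor \<nu> \<nu> F) - (tensor \<mu> \<nu> F + tensor \<nu> \<mu> F))"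
proof -
  have "(\<lambda>\<phi>. \<mu> \<phi> - \<nu> \<phi>) \<in> radon" using \<mu> \<nu> by (intro radon_diff_radon radon_pos_radon)
  then have "tensor (\<lambda>\<phi>. \<mu> \<phi> - \<nu> \<phi>) (\<lambda>\<phi>. \<mu> \<phi> - \<nu> \<phi>) =
      (\<lambda>F. tensor (\<lambda>\<phi>. \<mu> \<phi> - \<nu> \<phi>) \<mu> F - tensor (\<lambda>\<phi>. \<mu> \<phi> - \<nu> \<phi>) \<nu> F)"
    by (rule tensor_diff_right[OF lc _ \<mu> \<nu>])
  then show ?thesis by (auto simp: tensor_def)
qed

section \<open>Symmetry of the tensor product\<close>

lemma Cc_prod:
  fixes \<phi> :: "'a::t2_space \<Rightarrow> real" and \<psi> :: "'b::t2_space \<Rightarrow> real"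
  assumes \<phi>: "\<phi> \<in> Cc" and \<psi>: "\<psi> \<in> Cc"
  shows "(\<lambda>p. \<phi> (fst p) * \<psi> (snd p)) \<in> Cc"
proof -
  obtain K where K: "compact K" "\<And>x. x \<notin> K \<Longrightarrow> \<phi> x = 0" using CcE[OF \<phi>] by blast
  obtain L where L: "compact L" "\<And>x. x \<notin> L \<Longrightarrow> \<psi> x = 0" using CcE[OF \<psi>] by blast
  have "continuous_on UNIV (\<lambda>p. \<phi> (fst p) * \<psi> (snd p))"
    by (intro continuous_on_mult continuous_on_compose2[OF Cc_continuous[OF \<phi>]]
        continuous_on_compose2[OF Cc_continuous[OF \<psi>]] continuous_on_fst continuous_on_snd continuous_on_id) auto
  then show ?thesis
  proof (rule CcI[OF _ compact_Times[OF K(1) L(1)]])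
    fix p assume "p \<notin> K \<times> L"
    then have "\<phi> (fst p) = 0 \<or> \<psi> (snd p) = 0" using K(2) L(2) by (metis mem_Times_iff)
    then show "\<phi> (fst p) * \<psi> (snd p) = 0" by auto
  qed
qed

lemma tensor_prod:
  fixes \<mu> :: "'a::t2_space functional" and \<nu> :: "'b::t2_space functional"
  assumes \<mu>: "\<mu> \<in> radon" and \<nu>: "\<nu> \<in> radon" and \<phi>: "\<phi> \<in> Cc" and \<psi>: "\<psi> \<in> Cc"
  shows "tensor \<mu> \<nu> (\<lambda>p. \<phi> (fst p) * \<psi> (snd p)) = \<mu> \<phi> * \<nu> \<psi>"
  using Cc_prod[OF \<phi> \<psi>] radon_scale[OF \<nu> \<psi>] radon_scale[OF \<mu> \<phi>, of "\<nu> \<psi>"]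
  by (simp add: tensor_def mult.commute)

text \<open>The algebra for the Stone--Weierstrass theorem. The factors are arbitrary continuous
  functions, so that constants belong to it; compact support is restored later by a cut-off
  factor.\<close>

inductive_set product_sums :: "('a::topological_space \<times> 'b::topological_space \<Rightarrow> real) set" where
  product: "continuous_on UNIV a \<Longrightarrow> continuous_on UNIV b \<Longrightarrow> (\<lambda>p. a (fst p) * b (snd p)) \<in> product_sums"
| sum: "f \<in> product_sums \<Longrightarrow> g \<in> product_sums \<Longrightarrow> (\<lambda>p. f p + g p) \<in> product_sums"

lemma product_sums_continuous: "f \<in> product_sums \<Longrightarrow> continuous_on UNIV f"
proof (induction rule: product_sums.induct)
  case (product a b)
  then show ?case
    by (intro continuous_on_mult continuous_on_compose2[OF product(1)]
        continuous_on_compose2[OF product(2)] continuous_on_fst continuous_on_snd continuous_on_id) auto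
next
  case (sum f g)
  then show ?case by (intro continuous_on_add)
qed

lemma product_sums_mult:
  assumes f: "f \<in> product_sums" and g: "g \<in> product_sums"
  shows "(\<lambda>p. f p * g p) \<in> product_sums"
  using f
proof (induction rule: product_sums.induct)
  case (product a b)
  show ?case
    using g
  proof (induction rule: product_sums.induct)
    case p2: (product c d)
    have "(\<lambda>p. (a (fst p) * c (fst p)) * (b (snd p) * d (snd p))) \<in> product_sums"
      by (rule product_sums.product[of "\<lambda>x. a x * c x" "\<lambda>y. b y * d y"])
        (intro continuous_on_mult product p2)+
    then show ?case by (simp add: mult_ac)
  next
    case (sum f g)
    then show ?case using product_sums.sum by (simp add: distrib_left) 
  qed
next
  case (sum f h)
  then show ?case using product_sums.sum by (simp add: distrib_right)
qed

lemma Cc_separates: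
  fixes x y :: "'a::t2_space"
  assumes lc: "locally_compact_space (euclidean :: 'a topology)" and "x \<noteq> y"
  shows "\<exists>\<beta>\<in>Cc. \<beta> x = 1 \<and> \<beta> y = 0"
proof -
  have c: "compact {x}" "open (- {y})" "{x} \<subseteq> - {y}" using assms(2) by auto
  show ?thesis
  proof (rule Cc_bump[OF lc c])
    fix \<beta> L assume \<beta>: "\<beta> \<in> Cc" "\<And>z. z \<in> {x} \<Longrightarrow> \<beta> z = 1" "L \<subseteq> - {y}" "\<And>z. z \<notin> L \<Longrightarrow> \<beta> z = 0"
    have "y \<notin> L" using \<beta>(3) by blast
    then show ?thesis using \<beta> by (intro bexI[of _ \<beta>]) simp_all
  qed
qed

lemma product_sums_dense:
  fixes F :: "'a::t2_space \<times> 'b::t2_space \<Rightarrow> real"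
  assumes lca: "locally_compact_space (euclidean :: 'a topology)"
    and lcb: "locally_compact_space (euclidean :: 'b topology)"
    and S: "compact S" and F: "continuous_on S F" and e: "0 < e"
  obtains g where "g \<in> product_sums" "\<And>p. p \<in> S \<Longrightarrow> \<bar>F p - g p\<bar> < e"
proof -
  have const: "(\<lambda>p::'a\<times>'b. c) \<in> product_sums" for c
    using product_sums.product[of "\<lambda>_. c" "\<lambda>_. 1"] by simp
  interpret function_ring_on "product_sums :: ('a \<times> 'b \<Rightarrow> real) set" S
  proof
    show "continuous_on S f" if "f \<in> product_sums" for f :: "'a \<times> 'b \<Rightarrow> real"
      using continuous_on_subset[OF product_sums_continuous[OF that]] by simp
    show "\<exists>f\<in>product_sums. f p \<noteq> f q" if "p \<noteq> q" for p q :: "'a \<times> 'b"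
    proof (cases "fst p = fst q")
      case False
      obtain \<beta> where \<beta>: "\<beta> \<in> Cc" "\<beta> (fst p) = 1" "\<beta> (fst q) = 0"
        using Cc_separates[OF lca False] by blast
      have "(\<lambda>p. \<beta> (fst p) * 1) \<in> product_sums"
        using product_sums.product[OF Cc_continuous[OF \<beta>(1)], of "\<lambda>_. 1"] by simp
      then show ?thesis by (rule bexI[rotated]) (simp add: \<beta>)
    next
      case True
      then have ne: "snd p \<noteq> snd q" using that by (simp add: prod_eq_iff)
      obtain \<beta> where \<beta>: "\<beta> \<in> Cc" "\<beta> (snd p) = 1" "\<beta> (snd q) = 0"
        using Cc_separates[OF lcb ne] by blast
      have "(\<lambda>p. 1 * \<beta> (snd p)) \<in> product_sums"
        using product_sums.product[OF _ Cc_continuous[OF \<beta>(1)], of "\<lambda>_. 1"] by simp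
      then show ?thesis by (rule bexI[rotated]) (simp add: \<beta>)
    qed
  qed (fact S product_sums.sum product_sums_mult const)+
  show ?thesis using Stone_Weierstrass_basic[OF F e] that by blast
qed

lemma Cc_swap:
  fixes F :: "'a::t2_space \<times> 'b::t2_space \<Rightarrow> real"
  assumes "F \<in> Cc"
  shows "(\<lambda>p. F (snd p, fst p)) \<in> Cc"
proof -
  obtain A B where A: "compact A" and B: "compact B" and 0: "\<And>x y. x \<notin> A \<or> y \<notin> B \<Longrightarrow> F (x, y) = 0"
    using Cc_support_Times[OF assms] by metis
  have "continuous_on UNIV (\<lambda>p. F (snd p, fst p))"
    by (intro continuous_on_compose2[OF Cc_continuous[OF assms]] continuous_intros) auto
  then show ?thesis
    by (rule CcI[OF _ compact_Times[OF B A]]) (metis 0 mem_Times_iff)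
qed

text \<open>Both iterated integrals are positive Radon measures on the product, and they agree on
  products a(x) b(y). The Stone--Weierstrass theorem extends this to all \<open>F\<close>,
  positivity turning uniform closeness into closeness of the integrals.\<close>

lemma tensor_commute:
  fixes \<mu> :: "'a::t2_space functional" and \<nu> :: "'b::t2_space functional"
  assumes lca: "locally_compact_space (euclidean :: 'a topology)"
    and lcb: "locally_compact_space (euclidean :: 'b topology)"
    and \<mu>: "\<mu> \<in> radon_pos" and \<nu>: "\<nu> \<in> radon_pos" and F: "F \<in> Cc"
  shows "tensor \<mu> \<nu> F = tensor \<nu> \<mu> (\<lambda>p. F (snd p, fst p))"
proof -
  have r: "\<mu> \<in> radon" "\<nu> \<in> radon" using \<mu> \<nu> by (auto intro: radon_pos_radon)
  define T where "T = tensor \<mu> \<nu>"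
  define T' where "T' G = tensor \<nu> \<mu> (\<lambda>p. G (snd p, fst p))" for G
  have T: "T \<in> radon_pos" unfolding T_def by (rule tensor_radon_pos[OF lca lcb \<mu> \<nu>])
  have \<nu>\<mu>: "tensor \<nu> \<mu> \<in> radon_pos" by (rule tensor_radon_pos[OF lcb lca \<nu> \<mu>])
  have swap: "(\<lambda>p. G (snd p, fst p)) \<in> Cc \<longleftrightarrow> G \<in> Cc" for G :: "'a \<times> 'b \<Rightarrow> real"
    using Cc_swap[of G] Cc_swap[of "\<lambda>p. G (snd p, fst p)"] by auto
  have T': "T' \<in> radon_pos"
  proof (rule radon_posI[OF locally_compact_space_prod[OF lca lcb]])
    fix G H :: "'a \<times> 'b \<Rightarrow> real" and c :: real assume G: "G \<in> Cc"
    show "T' (\<lambda>p. G p + H p) = T' G + T' H" if H: "H \<in> Cc"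
      unfolding T'_def using G H by (intro radon_add[OF radon_pos_radon[OF \<nu>\<mu>]] Cc_swap)
    show "T' (\<lambda>p. c * G p) = c * T' G"
      unfolding T'_def using G by (intro radon_scale[OF radon_pos_radon[OF \<nu>\<mu>]] Cc_swap)
    show "0 \<le> T' G" if "\<And>p. 0 \<le> G p"
      unfolding T'_def using that by (intro radon_pos_nonneg[OF \<nu>\<mu>])
  qed (simp add: T'_def radon_outside[OF radon_pos_radon[OF \<nu>\<mu>]] swap)
  obtain A B where A: "compact A" and B: "compact B" and 0: "\<And>x y. x \<notin> A \<or> y \<notin> B \<Longrightarrow> F (x, y) = 0"
    using Cc_support_Times[OF F] by metis
  obtain \<alpha> K where \<alpha>: "\<alpha> \<in> Cc" "\<And>y. 0 \<le> \<alpha> y" "\<And>y. \<alpha> y \<le> 1" "\<And>y. y \<in> A \<Longrightarrow> \<alpha> y = 1" "compact K" "\<And>y. y \<notin> K \<Longrightarrow> \<alpha> y = 0"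
    using Cc_bump[OF lca A open_UNIV subset_UNIV] by metis
  obtain \<beta> L where \<beta>: "\<beta> \<in> Cc" "\<And>y. 0 \<le> \<beta> y" "\<And>y. \<beta> y \<le> 1" "\<And>y. y \<in> B \<Longrightarrow> \<beta> y = 1" "compact L" "\<And>y. y \<notin> L \<Longrightarrow> \<beta> y = 0"
    using Cc_bump[OF lcb B open_UNIV subset_UNIV] by metis
  \<comment> \<open>The cut-off is 1 on a rectangle carrying \<open>F\<close>. It brings
    approximants into \<open>Cc\<close> without changing \<open>F\<close>, and its integral
    \<mu>(\<alpha>) \<nu>(\<beta>) is the same for both iterated integrals.\<close>
  let ?w = "\<lambda>p. \<alpha> (fst p) * \<beta> (snd p)"
  have w: "?w \<in> Cc" using \<alpha>(1) \<beta>(1) by (rule Cc_prod)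
  have Tw: "T ?w = \<mu> \<alpha> * \<nu> \<beta>" unfolding T_def by (rule tensor_prod[OF r \<alpha>(1) \<beta>(1)])
  have T'prod: "T' (\<lambda>p. a (fst p) * b (snd p)) = \<mu> a * \<nu> b" if "a \<in> Cc" "b \<in> Cc" for a b
    unfolding T'_def using tensor_prod[OF r(2,1) that(2,1)] by (simp add: mult.commute)
  have wC: "(\<lambda>p. g p * ?w p) \<in> Cc" if "continuous_on UNIV g" for g
    using w that by (rule Cc_mult)
  have eq: "T (\<lambda>p. g p * ?w p) = T' (\<lambda>p. g p * ?w p)" if "g \<in> product_sums" for g
    using that
  proof (induction rule: product_sums.induct)
    case (product a b)
    have ab: "(\<lambda>x. a x * \<alpha> x) \<in> Cc" "(\<lambda>y. b y * \<beta> y) \<in> Cc"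
      using product \<alpha>(1) \<beta>(1) by (auto intro: Cc_mult)
    have "(\<lambda>p. a (fst p) * b (snd p) * ?w p) = (\<lambda>p. (a (fst p) * \<alpha> (fst p)) * (b (snd p) * \<beta> (snd p)))"
      by (auto simp: mult_ac)
    then show ?case
      using tensor_prod[OF r ab] T'prod[OF ab] by (simp add: T_def)
  next
    case (sum f g)
    have C: "(\<lambda>p. f p * ?w p) \<in> Cc" "(\<lambda>p. g p * ?w p) \<in> Cc"
      using sum(1,2) by (auto intro!: wC product_sums_continuous)
    show ?case
      unfolding distrib_right radon_add[OF radon_pos_radon[OF T] C] radon_add[OF radon_pos_radon[OF T'] C]
      using sum by simp
  qed
  have "\<bar>T F - T' F\<bar> \<le> e" if e: "0 < e" for e
  proof -
    \<comment> \<open>Each of the two functionals contributes an error of at most \<open>d\<close>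
      times the integral of the cut-off.\<close>
    define d where "d = e / (2 * (\<mu> \<alpha> * \<nu> \<beta>) + 1)"
    have m: "0 \<le> \<mu> \<alpha> * \<nu> \<beta>"
      using radon_pos_nonneg[OF \<mu> \<alpha>(2)] radon_pos_nonneg[OF \<nu> \<beta>(2)] by simp
    have d: "0 < d" "2 * (d * (\<mu> \<alpha> * \<nu> \<beta>)) \<le> e" using e m by (auto simp: d_def field_simps)
    obtain g where g: "g \<in> product_sums" "\<And>p. p \<in> K \<times> L \<Longrightarrow> \<bar>F p - g p\<bar> < d"
      using product_sums_dense[OF lca lcb compact_Times[OF \<alpha>(5) \<beta>(5)]
          continuous_on_subset[OF Cc_continuous[OF F] subset_UNIV] d(1)] by blast
    let ?G = "\<lambda>p. g p * ?w p"
    have G: "?G \<in> Cc" by (rule wC[OF product_sums_continuous[OF g(1)]])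
    have FG: "(\<lambda>p. F p - ?G p) \<in> Cc" using F G by (rule Cc_diff)
    have le: "\<bar>F p - ?G p\<bar> \<le> d * ?w p" for p
    proof -
      obtain x y where p: "p = (x, y)" by fastforce
      have "F p = F p * ?w p"
        using 0[of x y] \<alpha>(4)[of x] \<beta>(4)[of y] by (cases "x \<in> A \<and> y \<in> B") (auto simp: p)
      then have "\<bar>F p - ?G p\<bar> = \<bar>(F p - g p) * ?w p\<bar>" by (metis left_diff_distrib)
      also have "\<dots> = \<bar>F p - g p\<bar> * ?w p" using \<alpha>(2) \<beta>(2) by (simp add: abs_mult)
      also have "\<dots> \<le> d * ?w p"
      proof (cases "p \<in> K \<times> L")
        case True
        then show ?thesis using g(2)[OF True] \<alpha>(2) \<beta>(2) by (intro mult_right_mono) auto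
      next
        case False
        then have "?w p = 0" using \<alpha>(6) \<beta>(6) by (auto simp: p)
        then show ?thesis by auto
      qed
      finally show ?thesis .
    qed
    have "\<bar>T F - T ?G\<bar> \<le> d * (\<mu> \<alpha> * \<nu> \<beta>)"
      using radon_pos_abs_le[OF T FG Cc_scale[OF w] le] unfolding radon_scale[OF radon_pos_radon[OF T] w] Tw
        radon_diff[OF radon_pos_radon[OF T] F G] .
    moreover have "\<bar>T' F - T' ?G\<bar> \<le> d * (\<mu> \<alpha> * \<nu> \<beta>)"
      using radon_pos_abs_le[OF T' FG Cc_scale[OF w] le] unfolding radon_scale[OF radon_pos_radon[OF T'] w]
        T'prod[OF \<alpha>(1) \<beta>(1)] radon_diff[OF radon_pos_radon[OF T'] F G] .
    ultimately show ?thesis using eq[OF g(1)] d(2) by linarith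
  qed
  then have "T F = T' F" by (metis abs_le_zero_iff dense_le_bounded eq_iff_diff_eq_0 field_le_epsilon add_0)
  then show ?thesis by (simp add: T_def T'_def)
qed

lemma lsc_integral_tensor_commute:
  fixes \<mu> :: "'a::t2_space functional" and \<nu> :: "'b::t2_space functional"
  assumes lca: "locally_compact_space (euclidean :: 'a topology)"
    and lcb: "locally_compact_space (euclidean :: 'b topology)"
    and \<mu>: "\<mu> \<in> radon_pos" and \<nu>: "\<nu> \<in> radon_pos"
  shows "lsc_integral (tensor \<mu> \<nu>) g = lsc_integral (tensor \<nu> \<mu>) (\<lambda>p. g (snd p, fst p))"
proof (rule antisym)
  show "lsc_integral (tensor \<mu> \<nu>) g \<le> lsc_integral (tensor \<nu> \<mu>) (\<lambda>p. g (snd p, fst p))"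
  proof (rule lsc_integral_least)
    fix F assume F: "F \<in> Cc" "\<And>p. ereal (F p) \<le> g p"
    show "ereal (tensor \<mu> \<nu> F) \<le> lsc_integral (tensor \<nu> \<mu>) (\<lambda>p. g (snd p, fst p))"
      unfolding tensor_commute[OF lca lcb \<mu> \<nu> F(1)] using F by (intro lsc_integral_upper Cc_swap)
  qed
  show "lsc_integral (tensor \<nu> \<mu>) (\<lambda>p. g (snd p, fst p)) \<le> lsc_integral (tensor \<mu> \<nu>) g"
  proof (rule lsc_integral_least)
    fix F assume F: "F \<in> Cc" "\<And>p. ereal (F p) \<le> g (snd p, fst p)"
    have le: "ereal (F (snd p, fst p)) \<le> g p" for p using F(2)[of "(snd p, fst p)"] by simp
    show "ereal (tensor \<nu> \<mu> F) \<le> lsc_integral (tensor \<mu> \<nu>) g"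
      unfolding tensor_commute[OF lcb lca \<nu> \<mu> F(1)] using F(1) le by (intro lsc_integral_upper Cc_swap)
  qed
qed

section \<open>Fubini's theorem for lower semicontinuous kernels\<close>

lemma compact_UNIV_prod:
  assumes "compact (UNIV :: ('a::topological_space \<times> 'b::topological_space) set)"
  shows "compact (UNIV :: 'a set)" "compact (UNIV :: 'b set)"
  using compact_continuous_image[OF continuous_on_fst[OF continuous_on_id] assms]
    compact_continuous_image[OF continuous_on_snd[OF continuous_on_id] assms] by (auto simp: surj_def)

lemma Phi_slice:
  fixes \<kappa> :: "'a::topological_space \<times> 'b::topological_space \<Rightarrow> ereal"
  assumes "\<kappa> \<in> Phi"
  shows "(\<lambda>y. \<kappa> (x, y)) \<in> Phi"
proof -
  have "open ((\<lambda>y. (x, y)) -` {p. a < \<kappa> p})" for a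
    using Phi_lsc[OF assms] by (intro open_vimage continuous_on_Pair continuous_on_const continuous_on_id)
  then show ?thesis
    using assms compact_UNIV_prod by (auto simp: Phi_def vimage_def)
qed

lemma directed_image:
  assumes "directed D" "\<And>a b x. a \<in> D \<Longrightarrow> b \<in> D \<Longrightarrow> (\<And>y. a y \<le> b y) \<Longrightarrow> h a x \<le> h b x"
  shows "directed (h ` D)"
  unfolding directed_def
proof (intro conjI ballI)
  show "h ` D \<noteq> {}" using assms(1) by (simp add: directed_def)
  fix u v assume "u \<in> h ` D" "v \<in> h ` D"
  then obtain a b where ab: "a \<in> D" "b \<in> D" "u = h a" "v = h b" by blast
  then obtain c where c: "c \<in> D" "\<And>y. a y \<le> c y" "\<And>y. b y \<le> c y"
    using assms(1) unfolding directed_def by metis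
  have "u x \<le> h c x \<and> v x \<le> h c x" for x
    unfolding ab(3,4) using assms(2)[OF ab(1) c(1,2)] assms(2)[OF ab(2) c(1,3)] by simp
  then show "\<exists>w\<in>h ` D. \<forall>x. u x \<le> w x \<and> v x \<le> w x" using c(1) by blast
qed

text \<open>Test functions below \<open>\<kappa>\<close> form a directed family; so do their slices
  at \<open>x\<close>, with supremum \<open>\<kappa> (x, y)\<close>, and their partial integrals,
  whose supremum is thereby the inner integral. Evaluating an integral along a directed family twice
  gives the iterated integral, with no \<sigma>-finiteness involved.\<close>

lemma
  fixes \<mu> :: "'a::t2_space functional" and \<nu> :: "'b::t2_space functional"
    and \<kappa> :: "'a \<times> 'b \<Rightarrow> ereal"
  assumes lca: "locally_compact_space (euclidean :: 'a topology)"
    and lcb: "locally_compact_space (euclidean :: 'b topology)"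
    and \<nu>: "\<nu> \<in> radon_pos" and \<kappa>: "\<kappa> \<in> Phi"
  shows Phi_partial_integral: "(\<lambda>x. lsc_integral \<nu> (\<lambda>y. \<kappa> (x, y))) \<in> Phi"
    and lsc_integral_Fubini: "\<mu> \<in> radon_pos \<Longrightarrow>
      lsc_integral \<mu> (\<lambda>x. lsc_integral \<nu> (\<lambda>y. \<kappa> (x, y))) = lsc_integral (tensor \<mu> \<nu>) \<kappa>"
proof -
  let ?D = "{F \<in> Cc. \<forall>p. ereal (F p) \<le> \<kappa> p}"
  have lc: "locally_compact_space (euclidean :: ('a \<times> 'b) topology)"
    by (rule locally_compact_space_prod[OF lca lcb])
  have dir: "directed ?D" by (rule below_directed[OF \<kappa>])
  have inner: "lsc_integral \<nu> (\<lambda>y. \<kappa> (x, y)) = (SUP F\<in>?D. ereal (\<nu> (\<lambda>y. F (x, y))))" for x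
  proof -
    have "lsc_integral \<nu> (\<lambda>y. \<kappa> (x, y)) = (SUP d\<in>(\<lambda>F y. F (x, y)) ` ?D. ereal (\<nu> d))"
    proof (rule lsc_integral_directed[OF lcb \<nu>])
      show "(\<lambda>F y. F (x, y)) ` ?D \<subseteq> Cc" by (auto intro: Cc_slice)
      show "directed ((\<lambda>F y. F (x, y)) ` ?D)"
        using dir by (rule directed_image)
      show "\<kappa> (x, y) = (SUP d\<in>(\<lambda>F y. F (x, y)) ` ?D. ereal (d y))" for y
        unfolding image_image by (rule Phi_eq_SUP[OF lc \<kappa>])
    qed
    then show ?thesis by (simp add: image_image)
  qed
  show "(\<lambda>x. lsc_integral \<nu> (\<lambda>y. \<kappa> (x, y))) \<in> Phi"
  proof -
    have "open {x. a < lsc_integral \<nu> (\<lambda>y. \<kappa> (x, y))}" for a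
    proof -
      have "{x. a < lsc_integral \<nu> (\<lambda>y. \<kappa> (x, y))} = (\<Union>F\<in>?D. {x. a < ereal (\<nu> (\<lambda>y. F (x, y)))})"
        unfolding inner less_SUP_iff by blast
      moreover have "open {x. a < ereal (\<nu> (\<lambda>y. F (x, y)))}" if "F \<in> ?D" for F
        using Cc_continuous[OF Cc_partial_integral[OF lcb \<nu>, of F]] that
        by (intro open_Collect_less continuous_on_const continuous_on_ereal) auto
      ultimately show ?thesis by auto
    qed
    moreover have "lsc_integral \<nu> (\<lambda>y. \<kappa> (x, y)) \<noteq> -\<infinity>" for x
      by (rule lsc_integral_not_MInf[OF Phi_slice[OF \<kappa>]])
    moreover have "0 \<le> lsc_integral \<nu> (\<lambda>y. \<kappa> (x, y))" if "\<not> compact (UNIV :: 'a set)" for x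
      using that \<kappa> compact_UNIV_prod(1) by (intro lsc_integral_nonneg[OF \<nu>]) (auto simp: Phi_def)
    ultimately show ?thesis by (simp add: Phi_def)
  qed
  assume \<mu>: "\<mu> \<in> radon_pos"
  let ?h = "\<lambda>F x. \<nu> (\<lambda>y. F (x, y))"
  have "lsc_integral \<mu> (\<lambda>x. lsc_integral \<nu> (\<lambda>y. \<kappa> (x, y))) = (SUP d\<in>?h ` ?D. ereal (\<mu> d))"
  proof (rule lsc_integral_directed[OF lca \<mu>])
    show "?h ` ?D \<subseteq> Cc" by (auto intro: Cc_partial_integral[OF lcb \<nu>])
    show "directed (?h ` ?D)"
      using dir
    proof (rule directed_image)
      show "?h F x \<le> ?h G x" if "F \<in> ?D" "G \<in> ?D" "\<And>p. F p \<le> G p" for F G x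
        using that by (intro radon_pos_mono[OF \<nu>] Cc_slice) auto
    qed
    show "lsc_integral \<nu> (\<lambda>y. \<kappa> (x, y)) = (SUP d\<in>?h ` ?D. ereal (d x))" for x
      unfolding image_image by (rule inner)
  qed
  also have "\<dots> = lsc_integral (tensor \<mu> \<nu>) \<kappa>"
    unfolding lsc_integral_def image_image by (intro SUP_cong refl) (simp add: tensor_def)
  finally show "lsc_integral \<mu> (\<lambda>x. lsc_integral \<nu> (\<lambda>y. \<kappa> (x, y))) = lsc_integral (tensor \<mu> \<nu>) \<kappa>" .
qed

text \<open>Mutual singularity of the two parts, in the form that survives without a Hahn decomposition:
  a bump function splits into a piece almost negligible for \<open>\<mu>\<^sup>-\<close> and one almost negligible for
  \<open>\<mu>\<^sup>+\<close>.\<close>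

lemma almost_singular:
  fixes \<mu> :: "'a::t2_space functional"
  assumes \<mu>: "\<mu> \<in> radon" and \<phi>: "\<phi> \<in> Cc" "\<And>x. 0 \<le> \<phi> x" and e: "0 < e"
  shows "\<exists>\<psi>\<in>Cc. (\<forall>x. 0 \<le> \<psi> x \<and> \<psi> x \<le> \<phi> x) \<and> pos_part \<mu> \<phi> - pos_part \<mu> \<psi> + neg_part \<mu> \<psi> < e"
proof (rule ccontr)
  assume "\<not> ?thesis"
  then have *: "e \<le> pos_part \<mu> \<phi> - pos_part \<mu> \<psi> + neg_part \<mu> \<psi>"
    if "\<psi> \<in> Cc" "\<And>x. 0 \<le> \<psi> x" "\<And>x. \<psi> x \<le> \<phi> x" for \<psi>
    using that not_less by blast
  have "pos_sup \<mu> \<phi> \<le> pos_part \<mu> \<phi> - e"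
  proof (rule pos_sup_least[OF \<phi>(2)])
    fix \<psi> assume "\<psi> \<in> Cc" "\<And>x. 0 \<le> \<psi> x" "\<And>x. \<psi> x \<le> \<phi> x"
    then show "\<mu> \<psi> \<le> pos_part \<mu> \<phi> - e"
      using * pos_part_minus_neg_part[OF \<mu>, of \<psi>] by fastforce
  qed
  then show False using e pos_part_nonneg[OF \<mu> \<phi>] by simp
qed

lemma tensor_parts_le:
  fixes \<mu> :: "'a::t2_space functional"
  assumes lc: "locally_compact_space (euclidean :: 'a topology)" and \<mu>: "\<mu> \<in> radon"
    and F: "F \<in> Cc" "\<And>p. 0 \<le> F p"
  shows "tensor (pos_part \<mu>) (pos_part \<mu>) F + tensor (neg_part \<mu>) (neg_part \<mu>) F
    \<le> pos_part (tensor \<mu> \<mu>) F"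
proof -
  let ?p = "pos_part \<mu>" and ?n = "neg_part \<mu>"
  have p: "?p \<in> radon_pos" and n: "?n \<in> radon_pos"
    using pos_part_radon_pos[OF lc \<mu>] neg_part_radon_pos[OF lc \<mu>] by auto
  have pr: "?p \<in> radon" and nr: "?n \<in> radon" using p n by (auto intro: radon_pos_radon)
  note tp = tensor_radon_pos[OF lc lc]
  note lc2 = locally_compact_space_prod[OF lc lc]
  define P where "P = (\<lambda>F. tensor ?p ?p F + tensor ?n ?n F)"
  define N where "N = (\<lambda>F. tensor ?p ?n F + tensor ?n ?p F)"
  have P: "P \<in> radon_pos" unfolding P_def by (intro radon_pos_add[OF lc2] tp p n)
  have N: "N \<in> radon_pos" unfolding N_def by (intro radon_pos_add[OF lc2] tp p n)
  have "(\<lambda>\<phi>. ?p \<phi> - ?n \<phi>) = \<mu>" using pos_part_minus_neg_part[OF \<mu>] by auto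
  then have T: "tensor \<mu> \<mu> = (\<lambda>F. P F - N F)"
    using tensor_diff_diff[OF lc p n] by (simp add: P_def N_def)
  have Tr: "tensor \<mu> \<mu> \<in> radon" unfolding T using P N by (intro radon_diff_radon radon_pos_radon)
  obtain A B where A: "compact A" and B: "compact B" and 0: "\<And>x y. x \<notin> A \<or> y \<notin> B \<Longrightarrow> F (x, y) = 0"
    using Cc_support_Times[OF F(1)] by metis
  obtain \<beta> where \<beta>: "\<beta> \<in> Cc" "\<And>x. 0 \<le> \<beta> x" "\<And>x. \<beta> x \<le> 1" "\<And>x. x \<in> A \<union> B \<Longrightarrow> \<beta> x = 1"
    using Cc_bump[OF lc compact_Un[OF A B] open_UNIV subset_UNIV] by metis
  obtain M where M: "0 \<le> M" "\<And>p. \<bar>F p\<bar> \<le> M" using Cc_bounded[OF F(1)] by blast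
  have b: "0 \<le> ?p \<beta>" "0 \<le> ?n \<beta>" using radon_pos_nonneg[OF p \<beta>(2)] radon_pos_nonneg[OF n \<beta>(2)] by auto
  have "P F \<le> pos_part (tensor \<mu> \<mu>) F + e" if e: "0 < e" for e
  proof -
    \<comment> \<open>The loss in \<open>P\<close> and the remainder in \<open>N\<close> each amount
      to at most 2 M (p(\<beta>) + n(\<beta>)) d, where p and n are the two parts of \<mu>; together
      they have to stay below \<open>e\<close>.\<close>
    define d where "d = e / (4 * M * (?p \<beta> + ?n \<beta>) + 1)"
    have "0 \<le> 4 * M * (?p \<beta> + ?n \<beta>)" using M b by simp
    then have d: "0 < d" "4 * M * (?p \<beta> + ?n \<beta>) * d \<le> e" using e by (auto simp: d_def field_simps)
    obtain \<psi> where \<psi>: "\<psi> \<in> Cc" "\<And>x. 0 \<le> \<psi> x" "\<And>x. \<psi> x \<le> \<beta> x" "?p \<beta> - ?p \<psi> + ?n \<psi> < d"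
      using almost_singular[OF \<mu> \<beta>(1,2) d(1)] by blast
    define \<eta> where "\<eta> = (\<lambda>x. \<beta> x - \<psi> x)"
    have \<eta>: "\<eta> \<in> Cc" "\<And>x. 0 \<le> \<eta> x" "\<And>x. \<eta> x \<le> \<beta> x" using \<psi> \<beta> by (auto simp: \<eta>_def intro: Cc_diff)
    have e1: "?p \<eta> = ?p \<beta> - ?p \<psi>" unfolding \<eta>_def by (rule radon_diff[OF pr \<beta>(1) \<psi>(1)])
    have nonneg: "0 \<le> ?p \<psi>" "0 \<le> ?n \<psi>" "0 \<le> ?p \<eta>" "0 \<le> ?n \<eta>"
      using radon_pos_nonneg[OF p] radon_pos_nonneg[OF n] \<psi>(2) \<eta>(2) by auto
    have small: "?n \<psi> \<le> d" "?p \<eta> \<le> d" using \<psi>(4) e1 nonneg by auto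
    have big: "?p \<psi> \<le> ?p \<beta>" "?n \<eta> \<le> ?n \<beta>"
      using radon_pos_mono[OF p \<psi>(1) \<beta>(1) \<psi>(3)] radon_pos_mono[OF n \<eta>(1) \<beta>(1) \<eta>(3)] by auto
    \<comment> \<open>Since \<beta> = \<psi> + \<eta>, the diagonal part \<open>?u\<close> and the
      cross part \<open>?v\<close> add up to \<beta> \<otimes> \<beta>, which is 1 where
      \<open>F\<close> does not vanish. In \<open>P ?v\<close> and \<open>N ?u\<close> each product
      contains a factor at most \<open>d\<close>.\<close>
    let ?u = "\<lambda>p. \<psi> (fst p) * \<psi> (snd p) + \<eta> (fst p) * \<eta> (snd p)"
    let ?v = "\<lambda>p. \<psi> (fst p) * \<eta> (snd p) + \<eta> (fst p) * \<psi> (snd p)"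
    have u: "?u \<in> Cc" and v: "?v \<in> Cc" by (intro Cc_add Cc_prod \<psi>(1) \<eta>(1))+
    have u0: "0 \<le> ?u q" and v0: "0 \<le> ?v q" for q using \<psi>(2) \<eta>(2) by (auto intro!: add_nonneg_nonneg)
    have uv: "?u q + ?v q = \<beta> (fst q) * \<beta> (snd q)" for q by (simp add: \<eta>_def algebra_simps)
    let ?G = "\<lambda>q. ?u q * F q"
    have G: "?G \<in> Cc" using F(1) Cc_continuous[OF u] by (rule Cc_mult)
    have FG: "F q - ?G q = ?v q * F q" for q
    proof -
      obtain x y where q: "q = (x, y)" by fastforce
      have "F q = (\<beta> (fst q) * \<beta> (snd q)) * F q"
        using 0[of x y] \<beta>(4)[of x] \<beta>(4)[of y] by (cases "x \<in> A \<and> y \<in> B") (auto simp: q)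
      also have "\<dots> = ?u q * F q + ?v q * F q" unfolding uv[of q, symmetric] by (rule distrib_right)
      finally show ?thesis by simp
    qed
    have v_le: "?v q * F q \<le> M * ?v q" and G_le: "?G q \<le> M * ?u q" for q
      using mult_left_mono[of "F q" M "?v q"] mult_left_mono[of "F q" M "?u q"] M(2)[of q] u0[of q] v0[of q]
      by (auto simp: mult.commute)
    have Gle: "?G q \<le> F q" for q using FG[of q] mult_nonneg_nonneg[OF v0[of q] F(2)[of q]] by simp
    have G0: "0 \<le> ?G q" for q using u0[of q] F(2)[of q] by simp
    have Puv: "P ?v = ?p \<psi> * ?p \<eta> + ?p \<eta> * ?p \<psi> + (?n \<psi> * ?n \<eta> + ?n \<eta> * ?n \<psi>)"
      unfolding P_def radon_add[OF radon_pos_radon[OF tp[OF p p]] Cc_prod[OF \<psi>(1) \<eta>(1)] Cc_prod[OF \<eta>(1) \<psi>(1)]]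
        radon_add[OF radon_pos_radon[OF tp[OF n n]] Cc_prod[OF \<psi>(1) \<eta>(1)] Cc_prod[OF \<eta>(1) \<psi>(1)]]
        tensor_prod[OF pr pr \<psi>(1) \<eta>(1)] tensor_prod[OF pr pr \<eta>(1) \<psi>(1)]
        tensor_prod[OF nr nr \<psi>(1) \<eta>(1)] tensor_prod[OF nr nr \<eta>(1) \<psi>(1)] by simp
    have Nu: "N ?u = ?p \<psi> * ?n \<psi> + ?p \<eta> * ?n \<eta> + (?n \<psi> * ?p \<psi> + ?n \<eta> * ?p \<eta>)"
      unfolding N_def radon_add[OF radon_pos_radon[OF tp[OF p n]] Cc_prod[OF \<psi>(1) \<psi>(1)] Cc_prod[OF \<eta>(1) \<eta>(1)]]
        radon_add[OF radon_pos_radon[OF tp[OF n p]] Cc_prod[OF \<psi>(1) \<psi>(1)] Cc_prod[OF \<eta>(1) \<eta>(1)]]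
        tensor_prod[OF pr nr \<psi>(1) \<psi>(1)] tensor_prod[OF pr nr \<eta>(1) \<eta>(1)]
        tensor_prod[OF nr pr \<psi>(1) \<psi>(1)] tensor_prod[OF nr pr \<eta>(1) \<eta>(1)] by simp
    have prods: "?p \<psi> * ?p \<eta> \<le> ?p \<beta> * d" "?n \<psi> * ?n \<eta> \<le> d * ?n \<beta>" "?p \<psi> * ?n \<psi> \<le> ?p \<beta> * d" "?p \<eta> * ?n \<eta> \<le> d * ?n \<beta>"
      using small big nonneg b d(1) by (auto intro!: mult_mono)
    have Pv2: "P ?v \<le> 2 * ((?p \<beta> + ?n \<beta>) * d)" and Nu2: "N ?u \<le> 2 * ((?p \<beta> + ?n \<beta>) * d)"
      using prods unfolding Puv Nu by (auto simp: algebra_simps)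
    have "P F - P ?G = P (\<lambda>q. F q - ?G q)" by (rule radon_diff[OF radon_pos_radon[OF P] F(1) G, symmetric])
    also have "\<dots> \<le> P (\<lambda>q. M * ?v q)"
      unfolding FG using v_le by (intro radon_pos_mono[OF P Cc_mult[OF F(1) Cc_continuous[OF v]] Cc_scale[OF v]])
    also have "\<dots> = M * P ?v" by (rule radon_scale[OF radon_pos_radon[OF P] v])
    finally have 1: "P F \<le> P ?G + M * P ?v" by simp
    have "N ?G \<le> N (\<lambda>q. M * ?u q)" using G_le by (intro radon_pos_mono[OF N G Cc_scale[OF u]])
    also have "\<dots> = M * N ?u" by (rule radon_scale[OF radon_pos_radon[OF N] u])
    finally have 2: "N ?G \<le> M * N ?u" .
    have "P ?G - N ?G \<le> pos_part (tensor \<mu> \<mu>) F"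
      using pos_sup_upper[OF Tr F(1) G G0 Gle] pos_part_nonneg[OF Tr F] unfolding T by linarith
    then have "P F \<le> pos_part (tensor \<mu> \<mu>) F + M * N ?u + M * P ?v" using 1 2 by linarith
    also have "\<dots> \<le> pos_part (tensor \<mu> \<mu>) F + M * (2 * ((?p \<beta> + ?n \<beta>) * d)) + M * (2 * ((?p \<beta> + ?n \<beta>) * d))"
      using Pv2 Nu2 M(1) by (intro add_mono mult_left_mono order_refl)
    also have "\<dots> \<le> pos_part (tensor \<mu> \<mu>) F + e" using d(2) by (simp add: algebra_simps)
    finally show ?thesis .
  qed
  then show ?thesis unfolding P_def by (rule field_le_epsilon)
qed

section \<open>Energy\<close>

locale energy_kernel =
  fixes \<kappa> :: "'a::t2_space \<times> 'a \<Rightarrow> ereal"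
  assumes lc: "locally_compact_space (euclidean :: 'a topology)"
    and kernel: "is_kernel \<kappa>"
    and energy_principle: "energy_principle \<kappa>"
begin

abbreviation I :: "'a functional \<Rightarrow> 'a functional \<Rightarrow> ereal" where
  "I \<mu> \<nu> \<equiv> lsc_integral (tensor \<mu> \<nu>) \<kappa>"

abbreviation E :: "'a functional set" where
  "E \<equiv> finite_energy_pos \<kappa>"

definition inner_energy :: "'a functional \<Rightarrow> 'a functional \<Rightarrow> real" where
  "inner_energy \<mu> \<nu> = real_of_ereal (I \<mu> \<nu>)"

text \<open>The squared norm of \<mu> - \<nu>, expanded so that only positive measures occur:
  \<open>E\<close> is a cone and contains no differences.\<close>

definition energy_dist_sq :: "'a functional \<Rightarrow> 'a functional \<Rightarrow> real" where
  "energy_dist_sq \<mu> \<nu> = inner_energy \<mu> \<mu> + inner_energy \<nu> \<nu> - 2 * inner_energy \<mu> \<nu>"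

lemma kernel_Phi: "\<kappa> \<in> Phi"
  using kernel by (simp add: is_kernel_def)

lemma kernel_sym: "\<kappa> (x, y) = \<kappa> (y, x)"
  using kernel by (simp add: is_kernel_def)

lemmas lc_prod = locally_compact_space_prod[OF lc lc]
lemmas tensor_pos = tensor_radon_pos[OF lc lc]

lemma I_not_MInf: "I \<mu> \<nu> \<noteq> -\<infinity>"
  by (rule lsc_integral_not_MInf[OF kernel_Phi])

lemma I_commute: "\<mu> \<in> radon_pos \<Longrightarrow> \<nu> \<in> radon_pos \<Longrightarrow> I \<mu> \<nu> = I \<nu> \<mu>"
  using lsc_integral_tensor_commute[OF lc lc, of \<mu> \<nu> \<kappa>] kernel_sym by simp

lemma energy_radon_pos:
  assumes "\<mu> \<in> radon_pos"
  shows "energy_defined \<kappa> \<mu>" "energy \<kappa> \<mu> = I \<mu> \<mu>"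
  unfolding energy_defined_def energy_def mutual_energy_def
  using signed_integral_pos[OF lc_prod tensor_pos[OF assms assms] kernel_Phi] by simp_all

lemma E_iff: "\<mu> \<in> E \<longleftrightarrow> \<mu> \<in> radon_pos \<and> I \<mu> \<mu> < \<infinity>"
  unfolding finite_energy_pos_def finite_energy_def
  using energy_radon_pos radon_pos_radon by auto

lemma E_radon_pos: "\<mu> \<in> E \<Longrightarrow> \<mu> \<in> radon_pos"
  by (simp add: E_iff)

lemma I_add_left:
  assumes "\<mu> \<in> radon_pos" "\<nu> \<in> radon_pos" "\<rho> \<in> radon_pos"
  shows "I (\<lambda>\<phi>. \<mu> \<phi> + \<nu> \<phi>) \<rho> = I \<mu> \<rho> + I \<nu> \<rho>"
  unfolding tensor_add_left
  by (rule lsc_integral_add_measure[OF tensor_pos tensor_pos kernel_Phi]) fact+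

lemma I_scale_left: "0 \<le> c \<Longrightarrow> I (\<lambda>\<phi>. c * \<mu> \<phi>) \<rho> = ereal c * I \<mu> \<rho>"
  unfolding tensor_scale_left by (rule lsc_integral_scale_measure[OF kernel_Phi])

text \<open>If the mutual energy of \<open>\<mu>\<close> and \<open>\<nu>\<close> were infinite, \<open>\<mu> - \<nu>\<close> would have energy \<open>-\<infinity>\<close>.\<close>

lemma I_diff:
  assumes \<mu>: "\<mu> \<in> E" and \<nu>: "\<nu> \<in> E"
  shows "I \<mu> \<nu> < \<infinity>"
    and "energy \<kappa> (\<lambda>\<phi>. \<mu> \<phi> - \<nu> \<phi>) = (I \<mu> \<mu> + I \<nu> \<nu>) - (I \<mu> \<nu> + I \<nu> \<mu>)"
    and "energy_defined \<kappa> (\<lambda>\<phi>. \<mu> \<phi> - \<nu> \<phi>)"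
    and "0 \<le> energy \<kappa> (\<lambda>\<phi>. \<mu> \<phi> - \<nu> \<phi>)"
proof -
  have r: "\<mu> \<in> radon_pos" "\<nu> \<in> radon_pos" using \<mu> \<nu> by (auto simp: E_iff)
  let ?P = "\<lambda>F. tensor \<mu> \<mu> F + tensor \<nu> \<nu> F" and ?N = "\<lambda>F. tensor \<mu> \<nu> F + tensor \<nu> \<mu> F"
  have P: "?P \<in> radon_pos" and N: "?N \<in> radon_pos"
    by (intro radon_pos_add[OF lc_prod] tensor_pos r)+
  have JP: "lsc_integral ?P \<kappa> = I \<mu> \<mu> + I \<nu> \<nu>" and JN: "lsc_integral ?N \<kappa> = I \<mu> \<nu> + I \<nu> \<mu>"
    by (intro lsc_integral_add_measure tensor_pos r kernel_Phi)+
  have fin: "lsc_integral ?P \<kappa> < \<infinity>" using \<mu> \<nu> unfolding JP by (simp add: E_iff)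
  note d = signed_integral_diff[OF lc_prod P N kernel_Phi tensor_diff_diff[OF lc r] fin]
  show ed: "energy_defined \<kappa> (\<lambda>\<phi>. \<mu> \<phi> - \<nu> \<phi>)"
    unfolding energy_defined_def by (rule d)
  show eq: "energy \<kappa> (\<lambda>\<phi>. \<mu> \<phi> - \<nu> \<phi>) = (I \<mu> \<mu> + I \<nu> \<nu>) - (I \<mu> \<nu> + I \<nu> \<mu>)"
    unfolding energy_def mutual_energy_def d(2) JP JN ..
  have "(\<lambda>\<phi>. \<mu> \<phi> - \<nu> \<phi>) \<in> radon" using r by (intro radon_diff_radon radon_pos_radon)
  then show 0: "0 \<le> energy \<kappa> (\<lambda>\<phi>. \<mu> \<phi> - \<nu> \<phi>)"
    using ed energy_principle unfolding energy_principle_def by blast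
  show "I \<mu> \<nu> < \<infinity>"
  proof (rule ccontr)
    assume "\<not> I \<mu> \<nu> < \<infinity>"
    then have "I \<mu> \<nu> + I \<nu> \<mu> = \<infinity>" by simp
    then have "energy \<kappa> (\<lambda>\<phi>. \<mu> \<phi> - \<nu> \<phi>) = -\<infinity>"
      unfolding eq using fin I_not_MInf[of \<mu> \<mu>] I_not_MInf[of \<nu> \<nu>] unfolding JP
      by (cases "I \<mu> \<mu>"; cases "I \<nu> \<nu>") auto
    then show False using 0 by simp
  qed
qed

lemma I_eq:
  assumes "\<mu> \<in> E" "\<nu> \<in> E"
  shows "I \<mu> \<nu> = ereal (inner_energy \<mu> \<nu>)"
  unfolding inner_energy_def using I_diff(1)[OF assms] I_not_MInf[of \<mu> \<nu>] by (cases "I \<mu> \<nu>") auto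

lemma inner_energy_commute: "\<mu> \<in> E \<Longrightarrow> \<nu> \<in> E \<Longrightarrow> inner_energy \<mu> \<nu> = inner_energy \<nu> \<mu>"
  unfolding inner_energy_def using I_commute[of \<mu> \<nu>] by (simp add: E_iff)

lemma E_zero: "(\<lambda>_. 0) \<in> E"
proof -
  have "tensor (\<lambda>_. 0 :: real) (\<lambda>_. 0 :: real) = (\<lambda>_ :: 'a \<times> 'a \<Rightarrow> real. 0)" by (auto simp: tensor_def)
  then show ?thesis using lsc_integral_zero_measure[OF kernel_Phi] by (simp add: E_iff)
qed

lemma inner_energy_zero_left: "inner_energy (\<lambda>_. 0) \<nu> = 0"
proof -
  have "tensor (\<lambda>_. 0 :: real) \<nu> = (\<lambda>_ :: 'a \<times> 'a \<Rightarrow> real. 0)" by (auto simp: tensor_def)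
  then show ?thesis using lsc_integral_zero_measure[OF kernel_Phi] by (simp add: inner_energy_def)
qed

lemma E_add:
  assumes \<mu>: "\<mu> \<in> E" and \<nu>: "\<nu> \<in> E"
  shows "(\<lambda>\<phi>. \<mu> \<phi> + \<nu> \<phi>) \<in> E"
proof -
  have r: "\<mu> \<in> radon_pos" "\<nu> \<in> radon_pos" using \<mu> \<nu> by (auto simp: E_iff)
  let ?s = "\<lambda>\<phi>. \<mu> \<phi> + \<nu> \<phi>"
  have s: "?s \<in> radon_pos" using r by (rule radon_pos_add[OF lc])
  have "I ?s ?s = I ?s \<mu> + I ?s \<nu>"
    unfolding I_add_left[OF r s] using I_commute s r by simp
  also have "\<dots> = ereal (inner_energy \<mu> \<mu> + inner_energy \<nu> \<mu> + (inner_energy \<mu> \<nu> + inner_energy \<nu> \<nu>))"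
    unfolding I_add_left[OF r r(1)] I_add_left[OF r r(2)] by (simp add: I_eq \<mu> \<nu>)
  finally show ?thesis using s by (simp add: E_iff)
qed

lemma inner_energy_add_left:
  assumes "\<mu> \<in> E" "\<nu> \<in> E" "\<rho> \<in> E"
  shows "inner_energy (\<lambda>\<phi>. \<mu> \<phi> + \<nu> \<phi>) \<rho> = inner_energy \<mu> \<rho> + inner_energy \<nu> \<rho>"
  using I_add_left[of \<mu> \<nu> \<rho>] assms E_radon_pos I_eq[OF E_add[OF assms(1,2)] assms(3)] by (simp add: I_eq)

lemma E_scale:
  assumes \<mu>: "\<mu> \<in> E" and c: "0 \<le> c"
  shows "(\<lambda>\<phi>. c * \<mu> \<phi>) \<in> E"
proof -
  have r: "\<mu> \<in> radon_pos" using \<mu> by (rule E_radon_pos)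
  have s: "(\<lambda>\<phi>. c * \<mu> \<phi>) \<in> radon_pos" using r c by (rule radon_pos_scale[OF lc])
  have "I (\<lambda>\<phi>. c * \<mu> \<phi>) (\<lambda>\<phi>. c * \<mu> \<phi>) = ereal c * (ereal c * I \<mu> \<mu>)"
    using I_scale_left[OF c] I_commute[OF r s] by simp
  then show ?thesis using s I_eq[OF \<mu> \<mu>] by (simp add: E_iff)
qed

lemma inner_energy_scale_left:
  assumes "0 \<le> c"
  shows "inner_energy (\<lambda>\<phi>. c * \<mu> \<phi>) \<rho> = c * inner_energy \<mu> \<rho>"
  unfolding inner_energy_def I_scale_left[OF assms] by simp

lemma inner_energy_add_scale_left:
  assumes "\<mu> \<in> E" "\<nu> \<in> E" "\<rho> \<in> E" "0 \<le> c"
  shows "inner_energy (\<lambda>\<phi>. \<mu> \<phi> + c * \<nu> \<phi>) \<rho> = inner_energy \<mu> \<rho> + c * inner_energy \<nu> \<rho>"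
  using inner_energy_add_left[OF assms(1) E_scale[OF assms(2,4)] assms(3)] inner_energy_scale_left[OF assms(4)] by simp

lemma inner_energy_add_scale_right:
  assumes "\<mu> \<in> E" "\<nu> \<in> E" "\<rho> \<in> E" "0 \<le> c"
  shows "inner_energy \<rho> (\<lambda>\<phi>. \<mu> \<phi> + c * \<nu> \<phi>) = inner_energy \<rho> \<mu> + c * inner_energy \<rho> \<nu>"
  using inner_energy_add_scale_left[OF assms] inner_energy_commute assms E_add[OF assms(1) E_scale[OF assms(2,4)]] by simp

section \<open>The strong metric on the cone of positive measures of finite energy\<close>

lemma energy_dist_sq_nonneg:
  assumes \<mu>: "\<mu> \<in> E" and \<nu>: "\<nu> \<in> E"
  shows "0 \<le> energy_dist_sq \<mu> \<nu>" "energy \<kappa> (\<lambda>\<phi>. \<mu> \<phi> - \<nu> \<phi>) = ereal (energy_dist_sq \<mu> \<nu>)" "energy_dist_sq \<mu> \<nu> = 0 \<Longrightarrow> \<mu> = \<nu>"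
proof -
  show eq: "energy \<kappa> (\<lambda>\<phi>. \<mu> \<phi> - \<nu> \<phi>) = ereal (energy_dist_sq \<mu> \<nu>)"
    unfolding I_diff(2)[OF \<mu> \<nu>] energy_dist_sq_def using inner_energy_commute[OF \<mu> \<nu>] by (simp add: I_eq \<mu> \<nu>)
  show "0 \<le> energy_dist_sq \<mu> \<nu>" using I_diff(4)[OF \<mu> \<nu>] unfolding eq by simp
  assume "energy_dist_sq \<mu> \<nu> = 0"
  then have "energy \<kappa> (\<lambda>\<phi>. \<mu> \<phi> - \<nu> \<phi>) = 0" using eq by simp
  moreover have "(\<lambda>\<phi>. \<mu> \<phi> - \<nu> \<phi>) \<in> radon" using \<mu> \<nu> by (intro radon_diff_radon radon_pos_radon E_radon_pos)
  ultimately have "(\<lambda>\<phi>. \<mu> \<phi> - \<nu> \<phi>) = (\<lambda>_. 0)"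
    using I_diff(3)[OF \<mu> \<nu>] energy_principle unfolding energy_principle_def by blast
  then show "\<mu> = \<nu>" by (auto simp: fun_eq_iff)
qed

lemma energy_dist_sq_add_scale:
  assumes a: "a \<in> E" and b: "b \<in> E" and c: "c \<in> E" and d: "d \<in> E" and t: "0 \<le> t"
  shows "energy_dist_sq (\<lambda>\<phi>. a \<phi> + t * c \<phi>) (\<lambda>\<phi>. b \<phi> + t * d \<phi>) =
    energy_dist_sq a b + 2 * t * (inner_energy a c - inner_energy a d - inner_energy b c + inner_energy b d) + t\<^sup>2 * energy_dist_sq c d"
proof -
  note C = E_add[OF a E_scale[OF c t]] E_add[OF b E_scale[OF d t]]
  show ?thesis
    unfolding energy_dist_sq_def inner_energy_add_scale_left[OF a c C(1) t] inner_energy_add_scale_left[OF b d C(2) t] inner_energy_add_scale_left[OF a c C(2) t]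
      inner_energy_add_scale_right[OF a c a t] inner_energy_add_scale_right[OF a c c t] inner_energy_add_scale_right[OF b d a t]
      inner_energy_add_scale_right[OF b d b t] inner_energy_add_scale_right[OF b d c t] inner_energy_add_scale_right[OF b d d t]
    using inner_energy_commute[OF a c] inner_energy_commute[OF b d] inner_energy_commute[OF b c]
    by (simp add: algebra_simps power2_eq_square)
qed

lemma discriminant_le:
  fixes p B r :: real
  assumes "\<And>t. 0 \<le> p + 2 * t * B + t\<^sup>2 * r" "0 \<le> r"
  shows "B\<^sup>2 \<le> p * r"
proof (cases "r = 0")
  case True
  have "B = 0"
  proof (rule ccontr)
    assume "B \<noteq> 0"
    \<comment> \<open>For r = 0 the polynomial is linear, and at this point it takes the value
      -1.\<close>
    then show False using assms(1)[of "- (p + 1) / (2 * B)"] True by (simp add: field_simps)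
  qed
  then show ?thesis using True by simp
next
  case False
  then have r: "0 < r" using assms(2) by simp
  have "0 \<le> p - B\<^sup>2 / r"
    using assms(1)[of "- B / r"] r by (simp add: field_simps power2_eq_square)
  then show ?thesis using r by (simp add: field_simps)
qed

text \<open>The squared norm of (a - b) + t (c - d) is a nonnegative quadratic polynomial in t. The
  inequality is phrased with differences because \<open>E\<close> is only a cone; for the same
  reason a negative t is treated by exchanging \<open>c\<close> and \<open>d\<close>.\<close>

lemma Cauchy_Schwarz:
  assumes a: "a \<in> E" and b: "b \<in> E" and c: "c \<in> E" and d: "d \<in> E"
  shows "(inner_energy a c - inner_energy a d - inner_energy b c + inner_energy b d)\<^sup>2 \<le> energy_dist_sq a b * energy_dist_sq c d"
proof (rule discriminant_le)
  fix t :: real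
  show "0 \<le> energy_dist_sq a b + 2 * t * (inner_energy a c - inner_energy a d - inner_energy b c + inner_energy b d) + t\<^sup>2 * energy_dist_sq c d"
  proof (cases "0 \<le> t")
    case True
    then show ?thesis
      using energy_dist_sq_nonneg(1)[OF E_add[OF a E_scale[OF c True]] E_add[OF b E_scale[OF d True]]]
      by (simp add: energy_dist_sq_add_scale[OF a b c d])
  next
    case False
    then have t: "0 \<le> - t" by simp
    have "energy_dist_sq d c = energy_dist_sq c d" using inner_energy_commute[OF c d] by (simp add: energy_dist_sq_def)
    then show ?thesis
      using energy_dist_sq_nonneg(1)[OF E_add[OF a E_scale[OF d t]] E_add[OF b E_scale[OF c t]]]
      unfolding energy_dist_sq_add_scale[OF a b d c t] by (simp add: algebra_simps)
  qed
qed (rule energy_dist_sq_nonneg(1)[OF c d])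

lemma energy_dist_eq:
  assumes "\<mu> \<in> E" "\<nu> \<in> E"
  shows "energy_dist \<kappa> \<mu> \<nu> = sqrt (energy_dist_sq \<mu> \<nu>)"
  using assms energy_dist_sq_nonneg(2)[OF assms] by (simp add: energy_dist_def energy_norm_def)

lemma energy_dist_triangle:
  assumes a: "a \<in> E" and b: "b \<in> E" and c: "c \<in> E"
  shows "sqrt (energy_dist_sq a c) \<le> sqrt (energy_dist_sq a b) + sqrt (energy_dist_sq b c)"
proof (rule real_le_lsqrt)
  let ?B = "inner_energy a b - inner_energy a c - inner_energy b b + inner_energy b c"
  have 0: "0 \<le> energy_dist_sq a b" "0 \<le> energy_dist_sq b c" "0 \<le> energy_dist_sq a c" using energy_dist_sq_nonneg(1) a b c by auto
  have "\<bar>?B\<bar> \<le> sqrt (energy_dist_sq a b * energy_dist_sq b c)"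
    using Cauchy_Schwarz[OF a b b c] by (intro real_le_rsqrt) simp
  then have "?B \<le> sqrt (energy_dist_sq a b) * sqrt (energy_dist_sq b c)" by (simp add: real_sqrt_mult)
  moreover have "energy_dist_sq a c = energy_dist_sq a b + energy_dist_sq b c + 2 * ?B" by (simp add: energy_dist_sq_def)
  ultimately show "energy_dist_sq a c \<le> (sqrt (energy_dist_sq a b) + sqrt (energy_dist_sq b c))\<^sup>2"
    using 0 by (simp add: power2_sum)
  show "0 \<le> sqrt (energy_dist_sq a b) + sqrt (energy_dist_sq b c)" using 0 by simp
qed

lemma Metric_space_E: "Metric_space E (energy_dist \<kappa>)"
proof
  fix \<mu> \<nu> \<rho> :: "'a functional"
  have energy_dist_sq_sym: "energy_dist_sq \<mu> \<nu> = energy_dist_sq \<nu> \<mu>" if "\<mu> \<in> E" "\<nu> \<in> E" using inner_energy_commute[OF that] by (simp add: energy_dist_sq_def)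
  show "0 \<le> energy_dist \<kappa> \<mu> \<nu>"
    by (cases "\<mu> \<in> E \<and> \<nu> \<in> E") (auto simp: energy_dist_eq energy_dist_sq_nonneg(1), simp add: energy_dist_def, simp add: energy_dist_def)
  show "energy_dist \<kappa> \<mu> \<nu> = energy_dist \<kappa> \<nu> \<mu>"
    by (cases "\<mu> \<in> E \<and> \<nu> \<in> E") (auto simp: energy_dist_eq energy_dist_sq_sym, auto simp: energy_dist_def)
  show "energy_dist \<kappa> \<mu> \<nu> = 0 \<longleftrightarrow> \<mu> = \<nu>" if "\<mu> \<in> E" "\<nu> \<in> E"
    using that energy_dist_sq_nonneg(3)[OF that] by (auto simp: energy_dist_eq) (simp add: energy_dist_sq_def)
  show "energy_dist \<kappa> \<mu> \<rho> \<le> energy_dist \<kappa> \<mu> \<nu> + energy_dist \<kappa> \<nu> \<rho>"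
    if "\<mu> \<in> E" "\<nu> \<in> E" "\<rho> \<in> E"
    using that energy_dist_triangle[OF that] by (simp add: energy_dist_eq)
qed

lemma inner_energy_nonneg: "\<mu> \<in> E \<Longrightarrow> 0 \<le> inner_energy \<mu> \<mu>"
  using energy_dist_sq_nonneg(1)[OF _ E_zero, of \<mu>] inner_energy_commute[OF _ E_zero, of \<mu>] by (simp add: energy_dist_sq_def inner_energy_zero_left)

text \<open>The Cauchy--Schwarz inequality with \<theta> written as \<theta> - 0: the mutual energy
  with a fixed measure is Lipschitz for the strong metric.\<close>

lemma inner_energy_diff_le:
  assumes \<mu>: "\<mu> \<in> E" and \<nu>: "\<nu> \<in> E" and \<theta>: "\<theta> \<in> E"
  shows "\<bar>inner_energy \<mu> \<theta> - inner_energy \<nu> \<theta>\<bar> \<le> energy_dist \<kappa> \<mu> \<nu> * sqrt (inner_energy \<theta> \<theta>)"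
proof -
  have z: "inner_energy \<rho> (\<lambda>_. 0) = 0" if "\<rho> \<in> E" for \<rho> using inner_energy_commute[OF that E_zero] inner_energy_zero_left by simp
  have "(inner_energy \<mu> \<theta> - inner_energy \<nu> \<theta>)\<^sup>2 \<le> energy_dist_sq \<mu> \<nu> * inner_energy \<theta> \<theta>"
    using Cauchy_Schwarz[OF \<mu> \<nu> \<theta> E_zero] by (simp add: z \<mu> \<nu> \<theta> energy_dist_sq_def inner_energy_zero_left)
  then have "\<bar>inner_energy \<mu> \<theta> - inner_energy \<nu> \<theta>\<bar> \<le> sqrt (energy_dist_sq \<mu> \<nu> * inner_energy \<theta> \<theta>)" by (intro real_le_rsqrt) simp
  then show ?thesis by (simp add: energy_dist_eq \<mu> \<nu> real_sqrt_mult)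
qed

text \<open>Energy is defined through the Jordan parts of \<open>tensor \<theta> \<theta>\<close>,
  potentials through those of \<theta>. The bridge is \<open>tensor_parts_le\<close>: the positive
  part of the tensor square dominates the tensor squares of both parts of \<theta>.\<close>

lemma finite_energy_parts:
  assumes \<theta>: "\<theta> \<in> finite_energy \<kappa>"
  shows "pos_part \<theta> \<in> E" "neg_part \<theta> \<in> E"
proof -
  have r: "\<theta> \<in> radon" and def: "energy_defined \<kappa> \<theta>" and fin: "energy \<kappa> \<theta> < \<infinity>"
    using \<theta> by (auto simp: finite_energy_def)
  let ?p = "pos_part \<theta>" and ?n = "neg_part \<theta>" and ?T = "tensor \<theta> \<theta>"
  have p: "?p \<in> radon_pos" and n: "?n \<in> radon_pos"
    using pos_part_radon_pos[OF lc r] neg_part_radon_pos[OF lc r] by auto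
  let ?P = "\<lambda>F. tensor ?p ?p F + tensor ?n ?n F" and ?N = "\<lambda>F. tensor ?p ?n F + tensor ?n ?p F"
  have P: "?P \<in> radon_pos" and N: "?N \<in> radon_pos"
    by (intro radon_pos_add[OF lc_prod] tensor_pos p n)+
  have "(\<lambda>\<phi>. ?p \<phi> - ?n \<phi>) = \<theta>" using pos_part_minus_neg_part[OF r] by auto
  then have T: "?T = (\<lambda>F. ?P F - ?N F)" using tensor_diff_diff[OF lc p n] by simp
  have Tr: "?T \<in> radon" unfolding T using P N by (intro radon_diff_radon radon_pos_radon)
  have eq: "energy \<kappa> \<theta> = lsc_integral (pos_part ?T) \<kappa> - lsc_integral (neg_part ?T) \<kappa>"
    unfolding energy_def mutual_energy_def by (rule signed_integral_parts(2)[OF lc_prod Tr kernel_Phi])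
  have pos_fin: "lsc_integral (pos_part ?T) \<kappa> < \<infinity>"
  proof (rule ccontr)
    assume "\<not> lsc_integral (pos_part ?T) \<kappa> < \<infinity>"
    then have 1: "lsc_integral (pos_part ?T) \<kappa> = \<infinity>" by simp
    then have "lsc_integral (neg_part ?T) \<kappa> \<noteq> \<infinity>"
      using def unfolding energy_defined_def signed_integral_parts(1)[OF lc_prod Tr kernel_Phi] by simp
    then show False using fin 1 unfolding eq by (simp add: minus_ereal_def)
  qed
  \<comment> \<open>The kernel may be negative, so domination of measures does not compare the
    integrals directly. The difference is a positive measure whose integral is at least not
    -\<infinity>, which suffices for finiteness.\<close>
  have R: "(\<lambda>F. pos_part ?T F - ?P F) \<in> radon_pos"
    by (rule radon_pos_diff[OF lc_prod radon_pos_radon[OF pos_part_radon_pos[OF lc_prod Tr]] radon_pos_radon[OF P]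
          tensor_parts_le[OF lc r]])
  have "lsc_integral (pos_part ?T) \<kappa> = lsc_integral (\<lambda>F. ?P F + (pos_part ?T F - ?P F)) \<kappa>" by simp
  also have "\<dots> = lsc_integral ?P \<kappa> + lsc_integral (\<lambda>F. pos_part ?T F - ?P F) \<kappa>"
    by (rule lsc_integral_add_measure[OF P R kernel_Phi])
  also have "lsc_integral ?P \<kappa> = I ?p ?p + I ?n ?n"
    by (intro lsc_integral_add_measure tensor_pos p n kernel_Phi)
  finally have "lsc_integral (pos_part ?T) \<kappa> = I ?p ?p + I ?n ?n + lsc_integral (\<lambda>F. pos_part ?T F - ?P F) \<kappa>" .
  moreover have "lsc_integral (\<lambda>F. pos_part ?T F - ?P F) \<kappa> \<noteq> -\<infinity>"
    by (rule lsc_integral_not_MInf[OF kernel_Phi])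
  ultimately have "I ?p ?p < \<infinity> \<and> I ?n ?n < \<infinity>"
    using pos_fin I_not_MInf[of ?p ?p] I_not_MInf[of ?n ?n] by auto
  then show "?p \<in> E" "?n \<in> E" using p n by (auto simp: E_iff)
qed

end

section \<open>Capacity estimates\<close>

lemma emeasure_UNIV_eq_1_iff:
  fixes \<mu> :: "'a::t2_space functional"
  assumes lc: "locally_compact_space (euclidean :: 'a topology)" and \<mu>: "\<mu> \<in> radon_pos"
  shows "emeasure (borel_measure \<mu>) UNIV = 1 \<longleftrightarrow> lsc_integral \<mu> (\<lambda>x. 1) = 1"
proof -
  have "0 \<le> lsc_integral \<mu> (\<lambda>x. 1)" by (rule lsc_integral_nonneg[OF \<mu>]) simp
  then have "enn2ereal (e2ennreal (lsc_integral \<mu> (\<lambda>x. 1))) = lsc_integral \<mu> (\<lambda>x. 1)"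
    by (rule enn2ereal_e2ennreal)
  then show ?thesis
    unfolding emeasure_borel_measure_UNIV[OF lc \<mu>]
    by (metis e2ennreal_enn2ereal one_ennreal.rep_eq)
qed

lemma Phi_one: "(\<lambda>x::'a::topological_space. 1) \<in> Phi"
  using Phi_const[of 1] by (simp add: one_ereal_def)

text \<open>A single open neighbourhood must be small for both measures, whence the intersection of
  two. This keeps midpoints concentrated on \<open>A\<close>.\<close>

lemma outer_mass_add_null:
  fixes \<mu> \<nu> :: "'a::t2_space functional"
  assumes \<mu>: "\<mu> \<in> radon_pos" and \<nu>: "\<nu> \<in> radon_pos"
    and null: "outer_mass \<mu> N = 0" "outer_mass \<nu> N = 0" and c: "0 \<le> c" "c \<le> 1" "0 \<le> d" "d \<le> 1"
  shows "outer_mass (\<lambda>\<phi>. c * \<mu> \<phi> + d * \<nu> \<phi>) N = 0"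
proof -
  have "outer_mass (\<lambda>\<phi>. c * \<mu> \<phi> + d * \<nu> \<phi>) N \<le> 0 + ennreal \<epsilon>" if \<epsilon>: "0 < \<epsilon>" for \<epsilon>
  proof -
    have h: "0 < ennreal (\<epsilon> / 2)" using \<epsilon> by simp
    obtain U where U: "open U" "N \<subseteq> U" "open_mass \<mu> U < ennreal (\<epsilon> / 2)"
      using outer_mass_less[of \<mu> N] null(1) h by metis
    obtain V where V: "open V" "N \<subseteq> V" "open_mass \<nu> V < ennreal (\<epsilon> / 2)"
      using outer_mass_less[of \<nu> N] null(2) h by metis
    have "outer_mass (\<lambda>\<phi>. c * \<mu> \<phi> + d * \<nu> \<phi>) N \<le> open_mass (\<lambda>\<phi>. c * \<mu> \<phi> + d * \<nu> \<phi>) (U \<inter> V)"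
      using U V by (intro outer_mass_le) auto
    also have "\<dots> \<le> open_mass \<mu> (U \<inter> V) + open_mass \<nu> (U \<inter> V)"
      unfolding open_mass_def[of "\<lambda>\<phi>. c * \<mu> \<phi> + d * \<nu> \<phi>"]
    proof (rule SUP_least)
      fix \<phi> assume \<phi>: "\<phi> \<in> {\<phi> \<in> Cc. \<forall>x. 0 \<le> \<phi> x \<and> \<phi> x \<le> indicator (U \<inter> V) x}"
      then have 0: "0 \<le> \<mu> \<phi>" "0 \<le> \<nu> \<phi>"
        using radon_pos_nonneg[OF \<mu>, of \<phi>] radon_pos_nonneg[OF \<nu>, of \<phi>] by auto
      have "c * \<mu> \<phi> + d * \<nu> \<phi> \<le> \<mu> \<phi> + \<nu> \<phi>"
        using 0 c by (intro add_mono mult_left_le_one_le) auto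
      then have "ennreal (c * \<mu> \<phi> + d * \<nu> \<phi>) \<le> ennreal (\<mu> \<phi>) + ennreal (\<nu> \<phi>)"
        using 0 by (simp flip: ennreal_plus)
      also have "\<dots> \<le> open_mass \<mu> (U \<inter> V) + open_mass \<nu> (U \<inter> V)"
        unfolding open_mass_def using \<phi> by (intro add_mono SUP_upper)
      finally show "ennreal (c * \<mu> \<phi> + d * \<nu> \<phi>) \<le> open_mass \<mu> (U \<inter> V) + open_mass \<nu> (U \<inter> V)" .
    qed
    also have "\<dots> \<le> open_mass \<mu> U + open_mass \<nu> V" by (intro add_mono open_mass_mono) auto
    also have "\<dots> \<le> ennreal (\<epsilon> / 2) + ennreal (\<epsilon> / 2)" using U V by (intro add_mono less_imp_le)
    also have "\<dots> = ennreal \<epsilon>" using \<epsilon> by (simp flip: ennreal_plus)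
    finally show ?thesis by simp
  qed
  then have "outer_mass (\<lambda>\<phi>. c * \<mu> \<phi> + d * \<nu> \<phi>) N \<le> 0" by (rule ennreal_le_epsilon)
  then show ?thesis by simp
qed

context energy_kernel
begin

lemma unit_measures_iff:
  "\<mu> \<in> unit_measures \<kappa> A \<longleftrightarrow>
    \<mu> \<in> E \<and> (\<forall>K. compact K \<longrightarrow> outer_mass \<mu> (K - A) = 0) \<and> lsc_integral \<mu> (\<lambda>x. 1) = 1"
  using emeasure_UNIV_eq_1_iff[OF lc, of \<mu>] concentrated_on_iff[OF lc, of \<mu> A] E_radon_pos[of \<mu>]
  unfolding unit_measures_def by auto

lemma kernel_bounded_below:
  obtains c where "0 \<le> c" "c = 0 \<or> compact (UNIV :: 'a set)" "\<And>p. ereal (- c) \<le> \<kappa> p"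
  using Phi_bounded_below[OF kernel_Phi] compact_UNIV_prod(1) by metis

text \<open>The energy for the constant kernel \<open>c\<close>, used to shift the kernel to a
  nonnegative one; as before, \<open>\<mu> (\<lambda>_. 1)\<close> is meaningful only where
  \<open>c\<close> is nonzero.\<close>

lemma tensor_const:
  fixes \<mu> :: "'a functional"
  assumes "\<mu> \<in> radon_pos" "c = 0 \<or> compact (UNIV :: 'a set)"
  shows "(\<lambda>_ :: 'a \<times> 'a. c) \<in> Cc" "tensor \<mu> \<mu> (\<lambda>_. c) = c * (\<mu> (\<lambda>_. 1))\<^sup>2"
proof -
  have r: "\<mu> \<in> radon" using assms(1) by (rule radon_pos_radon)
  show "(\<lambda>_ :: 'a \<times> 'a. c) \<in> Cc"
    using assms(2) Cc_const[of c, where 'a="'a \<times> 'a"] compact_Times[of "UNIV :: 'a set" "UNIV :: 'a set"] by auto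
  show "tensor \<mu> \<mu> (\<lambda>_. c) = c * (\<mu> (\<lambda>_. 1))\<^sup>2"
  proof (cases "c = 0")
    case True
    then show ?thesis using radon_zero[OF r] by (simp add: tensor_def)
  next
    case False
    then have 1: "(\<lambda>_ :: 'a. 1) \<in> Cc" "(\<lambda>_ :: 'a. c) \<in> Cc" using assms(2) Cc_const by auto
    have "tensor \<mu> \<mu> (\<lambda>_. c) = \<mu> (\<lambda>_. 1) * \<mu> (\<lambda>_. c)"
      using tensor_prod[OF r r 1] by simp
    also have "\<mu> (\<lambda>_. c) = c * \<mu> (\<lambda>_. 1)" using radon_scale[OF r 1(1), of c] by simp
    finally show ?thesis by (simp add: power2_eq_square)
  qed
qed

text \<open>Since \<eta> \<otimes> \<eta> \<le> 1, passing to the density does not increase the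
  energy for the nonnegative kernel \<kappa> + c. Undoing the shift costs at most the energy of
  \<mu> for the constant \<open>c\<close>.\<close>

lemma density_energy:
  assumes \<mu>: "\<mu> \<in> E" and \<eta>: "\<eta> \<in> Cc" "\<And>x. 0 \<le> \<eta> x" "\<And>x. \<eta> x \<le> 1"
    and c: "0 \<le> c" "c = 0 \<or> compact (UNIV :: 'a set)" "\<And>p. ereal (- c) \<le> \<kappa> p"
  defines "\<nu> \<equiv> (\<lambda>\<phi>. if \<phi> \<in> Cc then \<mu> (\<lambda>x. \<eta> x * \<phi> x) else 0)"
  shows "\<nu> \<in> E" "inner_energy \<nu> \<nu> \<le> inner_energy \<mu> \<mu> + c * (\<mu> (\<lambda>_. 1))\<^sup>2"
proof -
  have r: "\<mu> \<in> radon_pos" using \<mu> by (rule E_radon_pos)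
  have \<nu>: "\<nu> \<in> radon_pos" unfolding \<nu>_def by (rule radon_pos_density[OF lc r \<eta>(1,2)])
  note T = tensor_pos[OF r r]
  let ?w = "\<lambda>p. \<eta> (fst p) * \<eta> (snd p)"
  have w: "?w \<in> Cc" using \<eta>(1) by (intro Cc_prod)
  have w01: "0 \<le> ?w p" "?w p \<le> 1" for p using \<eta>(2,3) by (auto intro: mult_le_one)
  have eq: "tensor \<nu> \<nu> F = tensor \<mu> \<mu> (\<lambda>p. ?w p * F p)" if F: "F \<in> Cc" for F
  proof -
    have wF: "(\<lambda>p. ?w p * F p) \<in> Cc" using F Cc_continuous[OF w] by (rule Cc_mult)
    have "(\<lambda>y. \<eta> y * F (x, y)) \<in> Cc" for x using Cc_slice[OF F] Cc_continuous[OF \<eta>(1)] by (rule Cc_mult)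
    then have "\<eta> x * \<mu> (\<lambda>y. \<eta> y * F (x, y)) = \<mu> (\<lambda>y. ?w (x, y) * F (x, y))" for x
      using radon_scale[OF radon_pos_radon[OF r], of "\<lambda>y. \<eta> y * F (x, y)" "\<eta> x"] by (simp add: mult.assoc)
    moreover have "\<nu> (\<lambda>y. F (x, y)) = \<mu> (\<lambda>y. \<eta> y * F (x, y))" for x
      using Cc_slice[OF F] by (simp add: \<nu>_def)
    moreover have "\<nu> (\<lambda>x. \<nu> (\<lambda>y. F (x, y))) = \<mu> (\<lambda>x. \<eta> x * \<nu> (\<lambda>y. F (x, y)))"
      using Cc_partial_integral[OF lc \<nu> F] unfolding \<nu>_def by (subst if_P) auto
    ultimately show ?thesis using F wF by (simp add: tensor_def)
  qed
  have "I \<nu> \<nu> \<le> I \<mu> \<mu> + ereal (c * (\<mu> (\<lambda>_. 1))\<^sup>2)"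
  proof (rule lsc_integral_least)
    fix F assume F: "F \<in> Cc" "\<And>p. ereal (F p) \<le> \<kappa> p"
    note cC = tensor_const[OF r c(2)]
    \<comment> \<open>Replaces \<open>F\<close> by its maximum with -c, still below \<kappa>. Now
      \<open>?H + c\<close> is nonnegative, so multiplication by a weight in [0, 1] can only
      decrease it.\<close>
    let ?H = "\<lambda>p. max 0 (F p + c) - c"
    have H: "?H \<in> Cc" using Cc_diff[OF Cc_pos[OF Cc_add[OF F(1) cC(1)]] cC(1)] .
    have "ereal (?H p) \<le> \<kappa> p" for p using F(2)[of p] c(3)[of p] by (auto simp: max_def)
    then have H\<kappa>: "ereal (tensor \<mu> \<mu> ?H) \<le> I \<mu> \<mu>" using H by (intro lsc_integral_upper)
    have wF: "(\<lambda>p. ?w p * F p) \<in> Cc" using F(1) Cc_continuous[OF w] by (rule Cc_mult)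
    have "?w p * F p \<le> ?H p + c" for p
    proof -
      have "?w p * (F p + c) \<le> ?w p * max 0 (F p + c)" using w01(1)[of p] by (intro mult_left_mono) auto
      also have "\<dots> \<le> max 0 (F p + c)" using w01[of p] by (intro mult_left_le_one_le) auto
      finally have "?w p * F p + ?w p * c \<le> max 0 (F p + c)" by (simp only: distrib_left)
      moreover have "0 \<le> ?w p * c" using w01(1)[of p] c(1) by simp
      ultimately show ?thesis by simp
    qed
    then have "tensor \<mu> \<mu> (\<lambda>p. ?w p * F p) \<le> tensor \<mu> \<mu> (\<lambda>p. ?H p + c)"
      by (intro radon_pos_mono[OF T wF Cc_add[OF H cC(1)]])
    also have "\<dots> = tensor \<mu> \<mu> ?H + c * (\<mu> (\<lambda>_. 1))\<^sup>2"
      unfolding radon_add[OF radon_pos_radon[OF T] H cC(1)] cC(2) ..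
    finally have "ereal (tensor \<nu> \<nu> F) \<le> ereal (tensor \<mu> \<mu> ?H) + ereal (c * (\<mu> (\<lambda>_. 1))\<^sup>2)"
      unfolding eq[OF F(1)] by simp
    also have "\<dots> \<le> I \<mu> \<mu> + ereal (c * (\<mu> (\<lambda>_. 1))\<^sup>2)" using H\<kappa> by (rule add_right_mono)
    finally show "ereal (tensor \<nu> \<nu> F) \<le> I \<mu> \<mu> + ereal (c * (\<mu> (\<lambda>_. 1))\<^sup>2)" .
  qed
  then have le: "I \<nu> \<nu> \<le> ereal (inner_energy \<mu> \<mu> + c * (\<mu> (\<lambda>_. 1))\<^sup>2)" by (simp add: I_eq[OF \<mu> \<mu>])
  then have "I \<nu> \<nu> < \<infinity>" by (rule le_less_trans) simp
  then show E: "\<nu> \<in> E" using \<nu> by (simp add: E_iff)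
  show "inner_energy \<nu> \<nu> \<le> inner_energy \<mu> \<mu> + c * (\<mu> (\<lambda>_. 1))\<^sup>2" using le unfolding I_eq[OF E E] by simp
qed

text \<open>The normalized measure \<open>\<phi>\<mu> / \<mu>(\<phi>)\<close> competes for the capacity of \<open>D\<close>.\<close>

lemma capacity_mass_bound:
  assumes D: "open D" "inner_capacity \<kappa> D < ereal \<epsilon>" "0 < \<epsilon>" and \<mu>: "\<mu> \<in> E"
    and \<phi>: "\<phi> \<in> Cc" "\<And>x. 0 \<le> \<phi> x" "\<And>x. \<phi> x \<le> indicator D x"
    and c: "0 \<le> c" "c = 0 \<or> compact (UNIV :: 'a set)" "\<And>p. ereal (- c) \<le> \<kappa> p"
  shows "(\<mu> \<phi>)\<^sup>2 \<le> \<epsilon> * (inner_energy \<mu> \<mu> + c * (\<mu> (\<lambda>_. 1))\<^sup>2)"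
proof (cases "\<mu> \<phi> = 0")
  case True
  then show ?thesis using inner_energy_nonneg[OF \<mu>] c(1) D(3) by simp
next
  case False
  have r: "\<mu> \<in> radon_pos" using \<mu> by (rule E_radon_pos)
  define m where "m = \<mu> \<phi>"
  have m: "0 < m" using False radon_pos_nonneg[of \<mu> \<phi>, OF r \<phi>(2)] by (simp add: m_def)
  have \<phi>1: "\<phi> x \<le> 1" for x using \<phi>(3)[of x] by (cases "x \<in> D") auto
  define \<nu> where "\<nu> = (\<lambda>\<psi>. if \<psi> \<in> Cc then \<mu> (\<lambda>x. \<phi> x * \<psi> x) else 0)"
  define \<rho> where "\<rho> = (\<lambda>\<psi>. 1 / m * \<nu> \<psi>)"
  have \<nu>E: "\<nu> \<in> E" and e\<nu>: "inner_energy \<nu> \<nu> \<le> inner_energy \<mu> \<mu> + c * (\<mu> (\<lambda>_. 1))\<^sup>2"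
    unfolding \<nu>_def using density_energy[OF \<mu> \<phi>(1,2) \<phi>1 c] by auto
  have \<rho>E: "\<rho> \<in> E" unfolding \<rho>_def using \<nu>E m by (intro E_scale) auto
  have m0: "0 \<le> 1 / m" using m by simp
  have \<phi>C: "(\<lambda>x. \<phi> x * \<psi> x) \<in> Cc" if "\<psi> \<in> Cc" for \<psi>
    using that Cc_continuous[OF \<phi>(1)] by (rule Cc_mult)
  \<comment> \<open>Division by \<open>m\<close> therefore yields a unit measure. The lower bound is
    attained by a bump equal to 1 wherever \<phi> is nonzero.\<close>
  have "lsc_integral \<nu> (\<lambda>x. 1) = ereal m"
  proof (rule antisym)
    show "lsc_integral \<nu> (\<lambda>x. 1) \<le> ereal m"
    proof (rule lsc_integral_least)
      fix \<psi> :: "'a \<Rightarrow> real" assume \<psi>: "\<psi> \<in> Cc" "\<And>x. ereal (\<psi> x) \<le> 1"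
      have "\<phi> x * \<psi> x \<le> \<phi> x" for x
        using mult_left_mono[of "\<psi> x" 1 "\<phi> x"] \<psi>(2)[of x] \<phi>(2)[of x] by simp
      then have "\<mu> (\<lambda>x. \<phi> x * \<psi> x) \<le> \<mu> \<phi>" by (rule radon_pos_mono[OF r \<phi>C[OF \<psi>(1)] \<phi>(1)])
      then show "ereal (\<nu> \<psi>) \<le> ereal m" using \<psi>(1) by (simp add: \<nu>_def m_def)
    qed
    obtain K where K: "compact K" "\<And>x. x \<notin> K \<Longrightarrow> \<phi> x = 0" using CcE[OF \<phi>(1)] by blast
    obtain \<beta> where \<beta>: "\<beta> \<in> Cc" "\<And>x. \<beta> x \<le> 1" "\<And>x. x \<in> K \<Longrightarrow> \<beta> x = 1"
      using Cc_bump[OF lc K(1) open_UNIV subset_UNIV] by metis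
    have "\<phi> x * \<beta> x = \<phi> x" for x using K(2)[of x] \<beta>(3)[of x] by (cases "x \<in> K") auto
    then have "(\<lambda>x. \<phi> x * \<beta> x) = \<phi>" by blast
    then have "\<nu> \<beta> = m" using \<beta>(1) by (simp add: \<nu>_def m_def)
    then show "ereal m \<le> lsc_integral \<nu> (\<lambda>x. 1)"
      using lsc_integral_upper[OF \<beta>(1), of "\<lambda>x. 1" \<nu>] \<beta>(2) by simp
  qed
  then have mass: "lsc_integral \<rho> (\<lambda>x. 1) = 1"
    unfolding \<rho>_def lsc_integral_scale_measure[OF Phi_one m0] using m by (simp add: one_ereal_def)
  have conc: "outer_mass \<rho> (K - D) = 0" if K: "compact K" for K
  proof -
    obtain \<beta> where \<beta>: "\<beta> \<in> Cc" "\<And>x. 0 \<le> \<beta> x" "\<And>x. x \<in> K \<Longrightarrow> \<beta> x = 1"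
      using Cc_bump[OF lc K open_UNIV subset_UNIV] by metis
    have \<mu>\<beta>: "0 \<le> \<mu> \<beta>" by (rule radon_pos_nonneg[OF r \<beta>(2)])
    have "outer_mass \<rho> (K - D) \<le> 0 + ennreal \<delta>" if \<delta>: "0 < \<delta>" for \<delta>
    proof -
      \<comment> \<open>On \<open>K - D\<close> the density vanishes, but outer mass is tested on
        open sets, hence the enlargement to {\<phi> < d}. There a test function \<psi> satisfies
        \<phi> \<psi> \<le> d \<le> 2 d \<beta>, and \<open>d\<close> makes 2 d \<mu>(\<beta>) / m
        at most \<delta>.\<close>
      define d where "d = \<delta> * m / (2 * \<mu> \<beta> + 1)"
      have d: "0 < d" "1 / m * (d * 2 * \<mu> \<beta>) \<le> \<delta>" using \<delta> m \<mu>\<beta> by (auto simp: d_def field_simps)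
      define U where "U = {x. \<phi> x < d} \<inter> {x. 1/2 < \<beta> x}"
      have U: "open U"
        unfolding U_def
        by (intro open_Int open_Collect_less Cc_continuous \<phi>(1) \<beta>(1) continuous_on_const)
      have KD: "K - D \<subseteq> U"
      proof
        fix x assume "x \<in> K - D"
        then have "\<phi> x = 0" "\<beta> x = 1" using \<phi>(2)[of x] \<phi>(3)[of x] \<beta>(3) by auto
        then show "x \<in> U" using d(1) by (simp add: U_def)
      qed
      have "open_mass \<rho> U \<le> ennreal \<delta>"
        unfolding open_mass_def
      proof (rule SUP_least)
        fix \<psi> assume "\<psi> \<in> {\<phi> \<in> Cc. \<forall>x. 0 \<le> \<phi> x \<and> \<phi> x \<le> indicator U x}"
        then have \<psi>: "\<psi> \<in> Cc" "\<And>x. 0 \<le> \<psi> x" "\<And>x. \<psi> x \<le> indicator U x" by auto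
        have "\<phi> x * \<psi> x \<le> (d * 2) * \<beta> x" for x
        proof (cases "x \<in> U")
          case True
          then have "\<phi> x * \<psi> x \<le> d * (2 * \<beta> x)"
            using \<psi>(2)[of x] \<psi>(3)[of x] d(1) \<phi>(2)[of x] by (intro mult_mono) (auto simp: U_def)
          then show ?thesis by simp
        next
          case False
          then have "\<psi> x = 0" using \<psi>(2)[of x] \<psi>(3)[of x] by simp
          then show ?thesis using d(1) \<beta>(2)[of x] by simp
        qed
        then have "\<mu> (\<lambda>x. \<phi> x * \<psi> x) \<le> \<mu> (\<lambda>x. (d * 2) * \<beta> x)"
          by (rule radon_pos_mono[OF r \<phi>C[OF \<psi>(1)] Cc_scale[OF \<beta>(1)]])
        then have "1 / m * \<mu> (\<lambda>x. \<phi> x * \<psi> x) \<le> 1 / m * (d * 2 * \<mu> \<beta>)"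
          unfolding radon_scale[OF radon_pos_radon[OF r] \<beta>(1)] using m0 by (rule mult_left_mono)
        then have "\<rho> \<psi> \<le> \<delta>" using d(2) \<psi>(1) by (simp add: \<rho>_def \<nu>_def)
        then show "ennreal (\<rho> \<psi>) \<le> ennreal \<delta>" by (rule ennreal_leI)
      qed
      then show ?thesis using outer_mass_le[OF U KD, of \<rho>] by simp
    qed
    then have "outer_mass \<rho> (K - D) \<le> 0" by (rule ennreal_le_epsilon)
    then show ?thesis by simp
  qed
  have \<rho>u: "\<rho> \<in> unit_measures \<kappa> D" using \<rho>E conc mass by (simp add: unit_measures_iff)
  have "inner_energy \<rho> \<rho> = 1 / m * (1 / m * inner_energy \<nu> \<nu>)"
    using inner_energy_scale_left[OF m0, of \<nu> \<rho>] inner_energy_scale_left[OF m0, of \<nu> \<nu>] inner_energy_commute[OF \<nu>E \<rho>E] by (simp add: \<rho>_def)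
  then have e\<rho>: "inner_energy \<rho> \<rho> = inner_energy \<nu> \<nu> / m\<^sup>2" by (simp add: power2_eq_square)
  have "energy \<kappa> \<rho> = ereal (inner_energy \<rho> \<rho>)" using energy_radon_pos(2)[OF E_radon_pos[OF \<rho>E]] I_eq[OF \<rho>E \<rho>E] by simp
  then have le: "min_energy \<kappa> D \<le> ereal (inner_energy \<rho> \<rho>)"
    unfolding min_energy_def using \<rho>u by (metis INF_lower)
  have ge: "0 \<le> min_energy \<kappa> D"
    unfolding min_energy_def
  proof (rule INF_greatest)
    fix \<tau> assume "\<tau> \<in> unit_measures \<kappa> D"
    then have "\<tau> \<in> E" by (simp add: unit_measures_iff)
    then show "0 \<le> energy \<kappa> \<tau>"
      using energy_radon_pos(2)[OF E_radon_pos] I_eq[of \<tau> \<tau>] inner_energy_nonneg[of \<tau>] by simp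
  qed
  obtain w where w: "min_energy \<kappa> D = ereal w" "0 \<le> w" "w \<le> inner_energy \<rho> \<rho>"
    using le ge by (cases "min_energy \<kappa> D") auto
  \<comment> \<open>The value w = 0 is excluded because it would make the capacity infinite.\<close>
  have "0 < w" "inverse w < \<epsilon>"
    using D(2) w(2) unfolding inner_capacity_def w(1) by (auto split: if_splits)
  then have "1 < \<epsilon> * w" by (simp add: field_simps)
  also have "\<dots> \<le> \<epsilon> * (inner_energy \<nu> \<nu> / m\<^sup>2)" using w(3) D(3) unfolding e\<rho> by (intro mult_left_mono) auto
  finally have "m\<^sup>2 \<le> \<epsilon> * inner_energy \<nu> \<nu>" using m by (simp add: field_simps)
  also have "\<dots> \<le> \<epsilon> * (inner_energy \<mu> \<mu> + c * (\<mu> (\<lambda>_. 1))\<^sup>2)" using e\<nu> D(3) by simp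
  finally show ?thesis by (simp add: m_def)
qed

lemma open_mass_capacity:
  assumes D: "open D" "inner_capacity \<kappa> D < ereal \<epsilon>" "0 < \<epsilon>" and \<mu>: "\<mu> \<in> E"
    and c: "0 \<le> c" "c = 0 \<or> compact (UNIV :: 'a set)" "\<And>p. ereal (- c) \<le> \<kappa> p"
    and C: "inner_energy \<mu> \<mu> + c * (\<mu> (\<lambda>_. 1))\<^sup>2 \<le> C"
  shows "open_mass \<mu> D \<le> ennreal (sqrt (\<epsilon> * C))"
  unfolding open_mass_def
proof (rule SUP_least)
  fix \<phi> assume "\<phi> \<in> {\<phi> \<in> Cc. \<forall>x. 0 \<le> \<phi> x \<and> \<phi> x \<le> indicator D x}"
  then have "(\<mu> \<phi>)\<^sup>2 \<le> \<epsilon> * (inner_energy \<mu> \<mu> + c * (\<mu> (\<lambda>_. 1))\<^sup>2)"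
    by (intro capacity_mass_bound[OF D \<mu> _ _ _ c]) auto
  also have "\<dots> \<le> \<epsilon> * C" using C D(3) by simp
  finally show "ennreal (\<mu> \<phi>) \<le> ennreal (sqrt (\<epsilon> * C))" by (intro ennreal_leI real_le_rsqrt)
qed

section \<open>Consequences of quasicompactness\<close>

text \<open>The two inclusions play different roles: A \<subseteq> F \<union> D keeps measures on
  \<open>A\<close> close to the compact set \<open>F\<close>, and F - A \<subseteq> D shows that a
  limit carried mostly by \<open>F\<close> hardly charges the complement of
  \<open>A\<close>.\<close>

lemma quasicompact_cover:
  assumes "quasicompact \<kappa> A" "0 < \<epsilon>"
  obtains F D where "compact F" "open D" "A \<subseteq> F \<union> D" "F - A \<subseteq> D" "inner_capacity \<kappa> D < ereal \<epsilon>"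
proof -
  have "(INF F\<in>{F. compact F}. outer_capacity \<kappa> (sym_diff A F)) < ereal \<epsilon>"
    using assms unfolding quasicompact_def by simp
  then obtain F where F: "compact F" "outer_capacity \<kappa> (sym_diff A F) < ereal \<epsilon>"
    unfolding INF_less_iff by blast
  then obtain D where "open D" "sym_diff A F \<subseteq> D" "inner_capacity \<kappa> D < ereal \<epsilon>"
    unfolding outer_capacity_def INF_less_iff by blast
  then show ?thesis using F(1) by (intro that[of F D]) auto
qed

text \<open>A test function off \<open>F\<close> vanishes outside a compact set L, and L \<subseteq>
  D \<union> (L - A) with L - A negligible. Compactness of L is essential, as concentration is only
  a local condition.\<close>

lemma open_mass_off_compact:
  assumes \<mu>: "\<mu> \<in> unit_measures \<kappa> A" and F: "compact F" and D: "open D" "A \<subseteq> F \<union> D"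
  shows "open_mass \<mu> (- F) \<le> open_mass \<mu> D"
proof -
  have r: "\<mu> \<in> radon_pos" using \<mu> by (simp add: unit_measures_iff E_iff)
  have oF: "open (- F)" using compact_imp_closed[OF F] by (simp add: open_Compl)
  show ?thesis
    unfolding open_mass_compact_support[OF lc r oF]
  proof (rule SUP_least)
    fix \<phi> assume "\<phi> \<in> {\<phi> \<in> Cc. (\<forall>x. 0 \<le> \<phi> x \<and> \<phi> x \<le> 1) \<and>
      (\<exists>L. compact L \<and> L \<subseteq> - F \<and> (\<forall>x. x \<notin> L \<longrightarrow> \<phi> x = 0))}"
    then obtain L where \<phi>: "\<phi> \<in> Cc" "\<And>x. 0 \<le> \<phi> x" "\<And>x. \<phi> x \<le> 1"
      and L: "compact L" "L \<subseteq> - F" "\<And>x. x \<notin> L \<Longrightarrow> \<phi> x = 0" by blast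
    have null: "outer_mass \<mu> (L - A) = 0" using \<mu> L(1) by (simp add: unit_measures_iff)
    show "ennreal (\<mu> \<phi>) \<le> open_mass \<mu> D"
    proof (rule ennreal_le_epsilon)
      fix \<delta> :: real assume \<delta>: "0 < \<delta>"
      have "outer_mass \<mu> (L - A) < ennreal \<delta>" using null \<delta> by simp
      then obtain U where U: "open U" "L - A \<subseteq> U" "open_mass \<mu> U < ennreal \<delta>"
        using outer_mass_less by blast
      have "\<phi> x \<le> indicator (D \<union> U) x" for x
      proof (cases "x \<in> L")
        case True
        then have "x \<in> D \<union> U" using U(2) L(2) D(2) by blast
        then show ?thesis using \<phi>(3) by simp
      next
        case False
        then show ?thesis using L(3) by simp
      qed
      then have "ennreal (\<mu> \<phi>) \<le> open_mass \<mu> (D \<union> U)"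
        unfolding open_mass_def using \<phi> by (intro SUP_upper) auto
      also have "\<dots> \<le> open_mass \<mu> D + open_mass \<mu> U" by (rule open_mass_Un[OF lc r D(1) U(1)])
      also have "\<dots> \<le> open_mass \<mu> D + ennreal \<delta>" using U(3) by (intro add_left_mono less_imp_le)
      finally show "ennreal (\<mu> \<phi>) \<le> open_mass \<mu> D + ennreal \<delta>" .
    qed
  qed
qed

text \<open>A test function \<psi> \<le> 1 is at most \<beta> + (\<psi> - \<beta>)^+. The second
  term vanishes on \<open>F\<close>, where \<beta> = 1, so its integral is bounded by the mass off
  \<open>F\<close>.\<close>

lemma mass_near_compact:
  assumes \<mu>: "\<mu> \<in> unit_measures \<kappa> A" and F: "compact F" and D: "open D" "A \<subseteq> F \<union> D"
    and s: "open_mass \<mu> D \<le> ennreal s" "0 \<le> s"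
    and \<beta>: "\<beta> \<in> Cc" "\<And>x. 0 \<le> \<beta> x" "\<And>x. x \<in> F \<Longrightarrow> \<beta> x = 1"
  shows "1 \<le> \<mu> \<beta> + s"
proof -
  have r: "\<mu> \<in> radon_pos" using \<mu> by (simp add: unit_measures_iff E_iff)
  have "lsc_integral \<mu> (\<lambda>x. 1) \<le> ereal (\<mu> \<beta> + s)"
  proof (rule lsc_integral_least)
    fix \<psi> :: "'a \<Rightarrow> real" assume \<psi>: "\<psi> \<in> Cc" "\<And>x. ereal (\<psi> x) \<le> 1"
    let ?h = "\<lambda>x. max 0 (\<psi> x - \<beta> x)"
    have h: "?h \<in> Cc" using \<psi>(1) \<beta>(1) by (intro Cc_pos Cc_diff)
    have "?h x \<le> indicator (- F) x" for x
      using \<psi>(2)[of x] \<beta>(2)[of x] \<beta>(3)[of x] by (auto simp: indicator_def)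
    then have "ennreal (\<mu> ?h) \<le> open_mass \<mu> (- F)"
      unfolding open_mass_def using h by (intro SUP_upper) auto
    also have "\<dots> \<le> open_mass \<mu> D" by (rule open_mass_off_compact[OF \<mu> F D])
    also have "\<dots> \<le> ennreal s" by (rule s(1))
    finally have hs: "\<mu> ?h \<le> s" using s(2) by simp
    have "\<mu> \<psi> \<le> \<mu> (\<lambda>x. \<beta> x + ?h x)"
      by (rule radon_pos_mono[OF r \<psi>(1) Cc_add[OF \<beta>(1) h]]) simp
    then show "ereal (\<mu> \<psi>) \<le> ereal (\<mu> \<beta> + s)"
      using hs unfolding radon_add[OF radon_pos_radon[OF r] \<beta>(1) h] by simp
  qed
  then show ?thesis using \<mu> by (simp add: unit_measures_iff one_ereal_def)
qed

end

section \<open>The Gauss variational problem\<close>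

context energy_kernel
begin

lemma potential_eq:
  assumes "\<theta> \<in> radon"
  shows "potential \<kappa> \<theta> x =
    lsc_integral (pos_part \<theta>) (\<lambda>y. \<kappa> (x, y)) - lsc_integral (neg_part \<theta>) (\<lambda>y. \<kappa> (x, y))"
  unfolding potential_def by (rule signed_integral_parts(2)[OF lc assms Phi_slice[OF kernel_Phi]])

text \<open>Reciprocity has been built in: the integral of the potential appears as a difference of
  mutual energies. When the integral of \<psi> is infinite, \<open>real_of_ereal\<close> gives 0, so
  the value is meaningful only if that integral is finite.\<close>

definition field_integral :: "('a \<Rightarrow> ereal) \<Rightarrow> 'a functional \<Rightarrow> 'a functional \<Rightarrow> real" where
  "field_integral \<psi> \<theta> \<mu> = real_of_ereal (lsc_integral \<mu> \<psi>) + inner_energy \<mu> (pos_part \<theta>) - inner_energy \<mu> (neg_part \<theta>)"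

definition gauss_value :: "('a \<Rightarrow> ereal) \<Rightarrow> 'a functional \<Rightarrow> 'a functional \<Rightarrow> real" where
  "gauss_value \<psi> \<theta> \<mu> = inner_energy \<mu> \<mu> + 2 * field_integral \<psi> \<theta> \<mu>"

text \<open>By Fubini's theorem the two halves of the potential are functions in \<open>Phi\<close>
  whose \<mu>-integrals are the finite mutual energies with the parts of \<theta>. Off a null set
  the field thus differs from \<psi> by an integrable function, and integrability depends on \<psi>
  alone.\<close>

lemma
  assumes \<psi>: "\<psi> \<in> Phi" and \<theta>: "\<theta> \<in> finite_energy \<kappa>" and f: "f = external_field \<kappa> \<psi> \<theta>"
    and \<mu>: "\<mu> \<in> E"
  shows ext_integrable_field: "ext_integrable (borel_measure \<mu>) f \<longleftrightarrow> lsc_integral \<mu> \<psi> < \<infinity>"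
    and gauss_functional_eq: "lsc_integral \<mu> \<psi> < \<infinity> \<Longrightarrow> gauss_functional \<kappa> f \<mu> = ereal (gauss_value \<psi> \<theta> \<mu>)"
proof -
  let ?M = "borel_measure \<mu>" and ?p = "pos_part \<theta>" and ?n = "neg_part \<theta>"
  have \<theta>r: "\<theta> \<in> radon" using \<theta> by (simp add: finite_energy_def)
  have r: "\<mu> \<in> radon_pos" using \<mu> by (rule E_radon_pos)
  have p: "?p \<in> E" and n: "?n \<in> E" using finite_energy_parts[OF \<theta>] by auto
  define u where "u x = lsc_integral ?p (\<lambda>y. \<kappa> (x, y))" for x
  define v where "v x = lsc_integral ?n (\<lambda>y. \<kappa> (x, y))" for x
  have uP: "u \<in> Phi" and vP: "v \<in> Phi"
    unfolding u_def v_def using Phi_partial_integral[OF lc lc E_radon_pos kernel_Phi] p n by auto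
  have Ju: "lsc_integral \<mu> u = ereal (inner_energy \<mu> ?p)"
    unfolding u_def lsc_integral_Fubini[OF lc lc E_radon_pos[OF p] kernel_Phi r] by (rule I_eq[OF \<mu> p])
  have Jv: "lsc_integral \<mu> v = ereal (inner_energy \<mu> ?n)"
    unfolding v_def lsc_integral_Fubini[OF lc lc E_radon_pos[OF n] kernel_Phi r] by (rule I_eq[OF \<mu> n])
  have fx: "f x = \<psi> x + (u x - v x)" for x
    unfolding f external_field_def potential_eq[OF \<theta>r] u_def v_def ..
  have m: "\<psi> \<in> borel_measurable ?M" "u \<in> borel_measurable ?M" "v \<in> borel_measurable ?M"
    using Phi_measurable[OF \<psi>] Phi_measurable[OF uP] Phi_measurable[OF vP]
    by (simp_all add: measurable_cong_sets[OF sets_borel_measure refl])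
  have fm: "f \<in> borel_measurable ?M"
    unfolding fx[abs_def] using m by (intro borel_measurable_ereal_add borel_measurable_ereal_diff)
  have rfm: "(\<lambda>x. real_of_ereal (f x)) \<in> borel_measurable ?M" "(\<lambda>x. real_of_ereal (\<psi> x)) \<in> borel_measurable ?M"
    using fm m(1) by auto
  have "lsc_integral \<mu> u < \<infinity>" "lsc_integral \<mu> v < \<infinity>" using Ju Jv by auto
  note U = integrable_Phi[OF lc r uP this(1)] and V = integrable_Phi[OF lc r vP this(2)]
  have Uint: "(LINT x|?M. real_of_ereal (u x)) = inner_energy \<mu> ?p" and Vint: "(LINT x|?M. real_of_ereal (v x)) = inner_energy \<mu> ?n"
    using U(3) V(3) unfolding Ju Jv by simp_all
  have ei: "ext_integrable ?M f \<longleftrightarrow> (AE x in ?M. \<bar>f x\<bar> \<noteq> \<infinity>) \<and> integrable ?M (\<lambda>x. real_of_ereal (f x))"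
    unfolding ext_integrable_def AE_completion_iff integrable_completion[OF rfm(1)] ..
  \<comment> \<open>Almost everywhere \<open>u\<close> and \<open>v\<close> are finite; the points
    where the convention \<infinity> - \<infinity> = \<infinity> intervenes form a null set.\<close>
  have fin_iff: "AE x in ?M. \<bar>f x\<bar> \<noteq> \<infinity> \<longleftrightarrow> \<bar>\<psi> x\<bar> \<noteq> \<infinity>"
    using U(1) V(1)
  proof eventually_elim
    case (elim x)
    then show ?case unfolding fx by (cases "\<psi> x"; cases "u x"; cases "v x") auto
  qed
  have sum_eq: "AE x in ?M. \<bar>\<psi> x\<bar> \<noteq> \<infinity> \<longrightarrow>
      real_of_ereal (f x) = real_of_ereal (\<psi> x) + (real_of_ereal (u x) - real_of_ereal (v x))"
    using U(1) V(1)
  proof eventually_elim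
    case (elim x)
    then show ?case unfolding fx by (cases "\<psi> x"; cases "u x"; cases "v x") auto
  qed
  have fwd: "integrable ?M (\<lambda>x. real_of_ereal (f x)) \<and> (LINT x|?M. real_of_ereal (f x)) = field_integral \<psi> \<theta> \<mu>"
    and AEf: "AE x in ?M. \<bar>f x\<bar> \<noteq> \<infinity>" if fin: "lsc_integral \<mu> \<psi> < \<infinity>"
  proof -
    note S = integrable_Phi[OF lc r \<psi> fin]
    show "AE x in ?M. \<bar>f x\<bar> \<noteq> \<infinity>" using S(1) fin_iff by eventually_elim simp
    have AE: "AE x in ?M. real_of_ereal (f x) = real_of_ereal (\<psi> x) + (real_of_ereal (u x) - real_of_ereal (v x))"
      using S(1) sum_eq by eventually_elim simp
    have i: "integrable ?M (\<lambda>x. real_of_ereal (\<psi> x) + (real_of_ereal (u x) - real_of_ereal (v x)))"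
      using S(2) U(2) V(2) by (intro Bochner_Integration.integrable_add Bochner_Integration.integrable_diff)
    have "integrable ?M (\<lambda>x. real_of_ereal (f x))"
      by (rule integrable_cong_AE_imp[OF i rfm(1)]) (use AE in eventually_elim, simp)
    moreover have "(LINT x|?M. real_of_ereal (f x)) =
        (LINT x|?M. real_of_ereal (\<psi> x) + (real_of_ereal (u x) - real_of_ereal (v x)))"
      using rfm(1) borel_measurable_integrable[OF i] AE by (rule integral_cong_AE)
    moreover have "\<dots> = (LINT x|?M. real_of_ereal (\<psi> x)) + (inner_energy \<mu> ?p - inner_energy \<mu> ?n)"
      using S(2) U(2) V(2) Uint Vint by simp
    moreover have "(LINT x|?M. real_of_ereal (\<psi> x)) = real_of_ereal (lsc_integral \<mu> \<psi>)"
      unfolding S(3)[symmetric] by simp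
    ultimately show "integrable ?M (\<lambda>x. real_of_ereal (f x)) \<and> (LINT x|?M. real_of_ereal (f x)) = field_integral \<psi> \<theta> \<mu>"
      by (simp add: field_integral_def)
  qed
  have bwd: "lsc_integral \<mu> \<psi> < \<infinity>"
    if AEf: "AE x in ?M. \<bar>f x\<bar> \<noteq> \<infinity>" and i: "integrable ?M (\<lambda>x. real_of_ereal (f x))"
  proof (rule lsc_integral_finite_if_integrable[OF lc r \<psi>])
    show AE\<psi>: "AE x in ?M. \<bar>\<psi> x\<bar> \<noteq> \<infinity>" using AEf fin_iff by eventually_elim simp
    have j: "integrable ?M (\<lambda>x. real_of_ereal (f x) - (real_of_ereal (u x) - real_of_ereal (v x)))"
      using i U(2) V(2) by (intro Bochner_Integration.integrable_diff)
    have "AE x in ?M. real_of_ereal (f x) - (real_of_ereal (u x) - real_of_ereal (v x)) = real_of_ereal (\<psi> x)"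
      using AE\<psi> sum_eq by eventually_elim simp
    then show "integrable ?M (\<lambda>x. real_of_ereal (\<psi> x))" by (rule integrable_cong_AE_imp[OF j rfm(2)])
  qed
  show "ext_integrable ?M f \<longleftrightarrow> lsc_integral \<mu> \<psi> < \<infinity>"
    unfolding ei using fwd AEf bwd by blast
  show "gauss_functional \<kappa> f \<mu> = ereal (gauss_value \<psi> \<theta> \<mu>)" if "lsc_integral \<mu> \<psi> < \<infinity>"
    unfolding gauss_functional_def energy_radon_pos(2)[OF r] I_eq[OF \<mu> \<mu>] integral_completion[OF rfm(1)]
    using fwd[OF that] by (simp add: gauss_value_def)
qed

section \<open>Midpoints and vague limits of unit measures\<close>

definition midpoint :: "'a functional \<Rightarrow> 'a functional \<Rightarrow> 'a functional" where
  "midpoint \<mu> \<nu> = (\<lambda>\<phi>. 1/2 * \<mu> \<phi> + 1/2 * \<nu> \<phi>)"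

lemma lsc_integral_midpoint:
  assumes "\<mu> \<in> radon_pos" "\<nu> \<in> radon_pos" "g \<in> Phi"
  shows "lsc_integral (midpoint \<mu> \<nu>) g = ereal (1/2) * lsc_integral \<mu> g + ereal (1/2) * lsc_integral \<nu> g"
proof -
  have "lsc_integral (midpoint \<mu> \<nu>) g = lsc_integral (\<lambda>\<phi>. 1/2 * \<mu> \<phi>) g + lsc_integral (\<lambda>\<phi>. 1/2 * \<nu> \<phi>) g"
    unfolding midpoint_def using assms by (intro lsc_integral_add_measure radon_pos_scale[OF lc]) auto
  then show ?thesis using assms by (simp only: lsc_integral_scale_measure[OF assms(3)])
qed

lemma midpoint_unit_measures:
  assumes \<mu>: "\<mu> \<in> unit_measures \<kappa> A" and \<nu>: "\<nu> \<in> unit_measures \<kappa> A"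
  shows "midpoint \<mu> \<nu> \<in> unit_measures \<kappa> A"
proof -
  have E: "\<mu> \<in> E" "\<nu> \<in> E" using \<mu> \<nu> by (auto simp: unit_measures_iff)
  note r = E[THEN E_radon_pos]
  have "midpoint \<mu> \<nu> \<in> E" unfolding midpoint_def using E by (intro E_add E_scale) auto
  moreover have "outer_mass (midpoint \<mu> \<nu>) (K - A) = 0" if "compact K" for K
    unfolding midpoint_def using \<mu> \<nu> that by (intro outer_mass_add_null[OF r]) (auto simp: unit_measures_iff)
  moreover have "lsc_integral (midpoint \<mu> \<nu>) (\<lambda>x. 1) = 1"
    using \<mu> \<nu> unfolding lsc_integral_midpoint[OF r Phi_one] by (simp add: unit_measures_iff one_ereal_def)
  ultimately show ?thesis by (simp add: unit_measures_iff)
qed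

text \<open>The integral of the field is affine in the measure, so the convexity defect comes from
  the energy alone and is the squared strong distance.\<close>

lemma gauss_value_midpoint:
  assumes \<mu>: "\<mu> \<in> E" "lsc_integral \<mu> \<psi> < \<infinity>" and \<nu>: "\<nu> \<in> E" "lsc_integral \<nu> \<psi> < \<infinity>"
    and \<psi>: "\<psi> \<in> Phi" and \<theta>: "\<theta> \<in> finite_energy \<kappa>"
  shows "lsc_integral (midpoint \<mu> \<nu>) \<psi> < \<infinity>"
    and "4 * gauss_value \<psi> \<theta> (midpoint \<mu> \<nu>) = 2 * gauss_value \<psi> \<theta> \<mu> + 2 * gauss_value \<psi> \<theta> \<nu> - energy_dist_sq \<mu> \<nu>"
proof -
  have p: "pos_part \<theta> \<in> E" and n: "neg_part \<theta> \<in> E" using finite_energy_parts[OF \<theta>] by auto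
  have s: "(\<lambda>\<phi>. 1/2 * \<mu> \<phi>) \<in> E" "(\<lambda>\<phi>. 1/2 * \<nu> \<phi>) \<in> E" using \<mu> \<nu> by (intro E_scale; simp)+
  have mid: "midpoint \<mu> \<nu> \<in> E" unfolding midpoint_def using s by (rule E_add)
  obtain a b where ab: "lsc_integral \<mu> \<psi> = ereal a" "lsc_integral \<nu> \<psi> = ereal b"
    using \<mu>(2) \<nu>(2) lsc_integral_not_MInf[OF \<psi>, of \<mu>] lsc_integral_not_MInf[OF \<psi>, of \<nu>]
    by (cases "lsc_integral \<mu> \<psi>"; cases "lsc_integral \<nu> \<psi>") auto
  have J: "lsc_integral (midpoint \<mu> \<nu>) \<psi> = ereal (1/2 * a + 1/2 * b)"
    using lsc_integral_midpoint[OF E_radon_pos[OF \<mu>(1)] E_radon_pos[OF \<nu>(1)] \<psi>] by (simp add: ab)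
  then show "lsc_integral (midpoint \<mu> \<nu>) \<psi> < \<infinity>" by simp
  have el: "inner_energy (midpoint \<mu> \<nu>) \<rho> = 1/2 * inner_energy \<mu> \<rho> + 1/2 * inner_energy \<nu> \<rho>" if "\<rho> \<in> E" for \<rho>
    unfolding midpoint_def inner_energy_add_left[OF s that] by (simp only: inner_energy_scale_left[of "1/2"])
  have "inner_energy (midpoint \<mu> \<nu>) (midpoint \<mu> \<nu>) = (inner_energy \<mu> \<mu> + 2 * inner_energy \<mu> \<nu> + inner_energy \<nu> \<nu>) / 4"
    unfolding el[OF mid] inner_energy_commute[OF \<mu>(1) mid] inner_energy_commute[OF \<nu>(1) mid] el[OF \<mu>(1)] el[OF \<nu>(1)]
    using inner_energy_commute[OF \<mu>(1) \<nu>(1)] by (simp add: field_simps)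
  then show "4 * gauss_value \<psi> \<theta> (midpoint \<mu> \<nu>) = 2 * gauss_value \<psi> \<theta> \<mu> + 2 * gauss_value \<psi> \<theta> \<nu> - energy_dist_sq \<mu> \<nu>"
    unfolding gauss_value_def field_integral_def energy_dist_sq_def el[OF p] el[OF n] J ab by simp
qed

text \<open>Strong convergence alone would not do: vaguely, mass may disappear at infinity, and
  \<open>A\<close> is not closed. Both defects are controlled by one pair \<open>F\<close>,
  \<open>D\<close>, with bounds uniform along the sequence and valid for the limit.\<close>

lemma vague_limit_unit_measures:
  assumes qc: "quasicompact \<kappa> A" and \<sigma>: "\<And>n. \<sigma> n \<in> unit_measures \<kappa> A" and l: "l \<in> E"
    and vague: "\<And>\<phi>. \<phi> \<in> Cc \<Longrightarrow> (\<lambda>n. \<sigma> n \<phi>) \<longlonglongrightarrow> l \<phi>"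
    and bounded: "\<And>n. inner_energy (\<sigma> n) (\<sigma> n) \<le> B"
  shows "l \<in> unit_measures \<kappa> A"
proof -
  have \<sigma>E: "\<sigma> n \<in> E" for n using \<sigma> by (simp add: unit_measures_iff)
  have \<sigma>r: "\<sigma> n \<in> radon_pos" for n using \<sigma>E by (rule E_radon_pos)
  have lr: "l \<in> radon_pos" using l by (rule E_radon_pos)
  have mass: "lsc_integral (\<sigma> n) (\<lambda>x. 1) = 1" for n using \<sigma> by (simp add: unit_measures_iff)
  obtain c where c: "0 \<le> c" "c = 0 \<or> compact (UNIV :: 'a set)" "\<And>p. ereal (- c) \<le> \<kappa> p"
    using kernel_bounded_below by blast
  \<comment> \<open>One constant for the whole sequence and its limit. For c \<noteq> 0 the space is
    compact and \<open>\<sigma> n (\<lambda>_. 1)\<close> is the total mass 1, which gives B + c;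
    the mass of \<open>l\<close> is not yet known.\<close>
  define C where "C = max (B + c) (inner_energy l l + c * (l (\<lambda>_. 1))\<^sup>2)"
  have \<sigma>C: "inner_energy (\<sigma> n) (\<sigma> n) + c * (\<sigma> n (\<lambda>_. 1))\<^sup>2 \<le> C" for n
  proof -
    have "c * (\<sigma> n (\<lambda>_. 1))\<^sup>2 \<le> c"
    proof (cases "c = 0")
      case False
      then have "lsc_integral (\<sigma> n) (\<lambda>x. ereal 1) = ereal (1 * \<sigma> n (\<lambda>x. 1))"
        using c(2) by (intro lsc_integral_const[OF \<sigma>r]) auto
      then have "\<sigma> n (\<lambda>x. 1) = 1" using mass[of n] by (simp add: one_ereal_def)
      then show ?thesis by simp
    qed simp
    then show ?thesis using bounded[of n] unfolding C_def by linarith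
  qed
  have lC: "inner_energy l l + c * (l (\<lambda>_. 1))\<^sup>2 \<le> C" unfolding C_def by simp
  have C0: "0 \<le> C" using lC inner_energy_nonneg[OF l] c(1) by (meson add_nonneg_nonneg mult_nonneg_nonneg order_trans zero_le_power2)
  have cover: "\<exists>F D. compact F \<and> open D \<and> A \<subseteq> F \<union> D \<and> F - A \<subseteq> D \<and>
      (\<forall>n. open_mass (\<sigma> n) D \<le> ennreal s) \<and> open_mass l D \<le> ennreal s" if s: "0 < s" for s
  proof -
    \<comment> \<open>A set of capacity below \<epsilon> has mass at most sqrt (\<epsilon> C), which
      this choice keeps below \<open>s\<close>.\<close>
    define \<epsilon> where "\<epsilon> = s\<^sup>2 / (C + 1)"
    have \<epsilon>: "0 < \<epsilon>" using s C0 by (simp add: \<epsilon>_def)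
    have "\<epsilon> * C \<le> s\<^sup>2" using s C0 by (simp add: \<epsilon>_def field_simps)
    then have "sqrt (\<epsilon> * C) \<le> sqrt (s\<^sup>2)" by (rule real_sqrt_le_mono)
    then have "ennreal (sqrt (\<epsilon> * C)) \<le> ennreal s" using s by (intro ennreal_leI) simp
    moreover obtain F D where FD: "compact F" "open D" "A \<subseteq> F \<union> D" "F - A \<subseteq> D" "inner_capacity \<kappa> D < ereal \<epsilon>"
      using quasicompact_cover[OF qc \<epsilon>] by blast
    ultimately show ?thesis
      using open_mass_capacity[OF FD(2,5) \<epsilon> \<sigma>E c \<sigma>C] open_mass_capacity[OF FD(2,5) \<epsilon> l c lC]
      by (intro exI[of _ F] exI[of _ D] conjI allI) (auto intro: order_trans)
  qed
  have "lsc_integral l (\<lambda>x. 1) \<le> 1"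
  proof (rule lsc_integral_least)
    fix \<psi> :: "'a \<Rightarrow> real" assume \<psi>: "\<psi> \<in> Cc" "\<And>x. ereal (\<psi> x) \<le> 1"
    have "\<sigma> n \<psi> \<le> 1" for n
      using lsc_integral_upper[of \<psi> "\<lambda>x. 1" "\<sigma> n", OF \<psi>] unfolding mass by simp
    then have "l \<psi> \<le> 1" by (intro LIMSEQ_le_const2[OF vague[OF \<psi>(1)]]) auto
    then show "ereal (l \<psi>) \<le> 1" by simp
  qed
  moreover have "1 \<le> lsc_integral l (\<lambda>x. 1)"
  proof (rule ereal_le_epsilon2)
    fix s :: real assume s: "0 < s"
    obtain F D where FD: "compact F" "open D" "A \<subseteq> F \<union> D" "\<And>n. open_mass (\<sigma> n) D \<le> ennreal s"
      using cover[OF s] by blast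
    obtain \<beta> where \<beta>: "\<beta> \<in> Cc" "\<And>x. 0 \<le> \<beta> x" "\<And>x. \<beta> x \<le> 1" "\<And>x. x \<in> F \<Longrightarrow> \<beta> x = 1"
      using Cc_bump[OF lc FD(1) open_UNIV subset_UNIV] by metis
    have "1 \<le> \<sigma> n \<beta> + s" for n
      using s by (intro mass_near_compact[OF \<sigma> FD \<open>0 < s\<close>[THEN less_imp_le] \<beta>(1,2,4)])
    then have "1 - s \<le> \<sigma> n \<beta>" for n by (simp add: algebra_simps)
    then have "1 - s \<le> l \<beta>" by (intro LIMSEQ_le_const[OF vague[OF \<beta>(1)]]) auto
    moreover have "ereal (l \<beta>) \<le> lsc_integral l (\<lambda>x. 1)"
      using \<beta>(3) by (intro lsc_integral_upper[OF \<beta>(1)]) simp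
    ultimately have "ereal (1 - s) \<le> lsc_integral l (\<lambda>x. 1)" by (meson ereal_less_eq(3) order_trans)
    then have "ereal (1 - s) + ereal s \<le> lsc_integral l (\<lambda>x. 1) + ereal s" by (rule add_right_mono)
    then show "1 \<le> lsc_integral l (\<lambda>x. 1) + ereal s" by (simp add: one_ereal_def)
  qed
  moreover have "outer_mass l (K - A) = 0" for K
  proof -
    have "outer_mass l (K - A) \<le> 0 + ennreal \<delta>" if \<delta>: "0 < \<delta>" for \<delta>
    proof -
      have s: "0 < \<delta> / 2" using \<delta> by simp
      obtain F D where FD: "compact F" "open D" "A \<subseteq> F \<union> D" "F - A \<subseteq> D"
        "\<And>n. open_mass (\<sigma> n) D \<le> ennreal (\<delta> / 2)" "open_mass l D \<le> ennreal (\<delta> / 2)"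
        using cover[OF s] by blast
      have oF: "open (- F)" using compact_imp_closed[OF FD(1)] by (simp add: open_Compl)
      \<comment> \<open>Off \<open>F\<close> the bound passes from the sequence to \<open>l\<close>,
        one test function at a time. On \<open>D\<close> no limit is taken: \<open>l\<close> has
        finite energy, so the capacity estimate applies to it directly.\<close>
      have "open_mass l (- F) \<le> ennreal (\<delta> / 2)"
        unfolding open_mass_def
      proof (rule SUP_least)
        fix \<phi> assume \<phi>: "\<phi> \<in> {\<phi> \<in> Cc. \<forall>x. 0 \<le> \<phi> x \<and> \<phi> x \<le> indicator (- F) x}"
        have "\<sigma> n \<phi> \<le> \<delta> / 2" for n
        proof -
          have "ennreal (\<sigma> n \<phi>) \<le> open_mass (\<sigma> n) (- F)" unfolding open_mass_def using \<phi> by (rule SUP_upper)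
          also have "\<dots> \<le> open_mass (\<sigma> n) D" by (rule open_mass_off_compact[OF \<sigma> FD(1-3)])
          also have "\<dots> \<le> ennreal (\<delta> / 2)" by (rule FD(5))
          finally show ?thesis using \<delta> by simp
        qed
        then have "l \<phi> \<le> \<delta> / 2" using \<phi> by (intro LIMSEQ_le_const2[OF vague]) auto
        then show "ennreal (l \<phi>) \<le> ennreal (\<delta> / 2)" by (rule ennreal_leI)
      qed
      moreover have "outer_mass l (K - A) \<le> open_mass l (- F \<union> D)"
        using FD oF by (intro outer_mass_le) auto
      moreover have "open_mass l (- F \<union> D) \<le> open_mass l (- F) + open_mass l D"
        by (rule open_mass_Un[OF lc lr oF FD(2)])
      ultimately have "outer_mass l (K - A) \<le> ennreal (\<delta> / 2) + ennreal (\<delta> / 2)"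
        using FD(6) by (meson add_mono order_trans)
      then show ?thesis using \<delta> by (simp flip: ennreal_plus)
    qed
    then have "outer_mass l (K - A) \<le> 0" by (rule ennreal_le_epsilon)
    then show ?thesis by simp
  qed
  ultimately show ?thesis using l by (simp add: unit_measures_iff)
qed

end

section \<open>Existence and uniqueness of the minimizing measure\<close>

theorem corollary1p3:
  fixes \<kappa> :: "'a::t2_space \<times> 'a \<Rightarrow> ereal"
    and \<psi> :: "'a \<Rightarrow> ereal"
    and \<theta> :: "'a functional"
    and f :: "'a \<Rightarrow> ereal"
    and A :: "'a set"
  assumes "locally_compact_space (euclidean :: 'a topology)"
    and "is_kernel \<kappa>"
    and "perfect \<kappa>"
    and "\<psi> \<in> Phi"
    and "\<theta> \<in> finite_energy \<kappa>"
    and "f = external_field \<kappa> \<psi> \<theta>"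
    and "quasicompact \<kappa> A"
    and "-\<infinity> < min_gauss \<kappa> f A"
    and "min_gauss \<kappa> f A < \<infinity>"
  shows "\<exists>!\<mu>. \<mu> \<in> unit_measures_field \<kappa> f A \<and> gauss_functional \<kappa> f \<mu> = min_gauss \<kappa> f A"
proof -
  interpret energy_kernel \<kappa>
    using assms(1-3) by unfold_locales (auto simp: perfect_def)
  interpret M: Metric_space E "energy_dist \<kappa>" by (rule Metric_space_E)
  note \<psi> = assms(4) and \<theta> = assms(5)
  let ?G = "gauss_value \<psi> \<theta>" and ?p = "pos_part \<theta>" and ?n = "neg_part \<theta>"
  have pn: "?p \<in> E" "?n \<in> E" using finite_energy_parts[OF \<theta>] by auto
  let ?S = "unit_measures_field \<kappa> f A"
  have S_iff: "\<mu> \<in> ?S \<longleftrightarrow> \<mu> \<in> unit_measures \<kappa> A \<and> lsc_integral \<mu> \<psi> < \<infinity>" for \<mu>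
    using ext_integrable_field[OF \<psi> \<theta> assms(6), of \<mu>] by (auto simp: unit_measures_field_def unit_measures_iff)
  have SE: "\<mu> \<in> E" if "\<mu> \<in> ?S" for \<mu> using that by (simp add: S_iff unit_measures_iff)
  have S_gauss: "gauss_functional \<kappa> f \<mu> = ereal (?G \<mu>)" if "\<mu> \<in> ?S" for \<mu>
    using gauss_functional_eq[OF \<psi> \<theta> assms(6) SE[OF that]] that by (simp add: S_iff)
  obtain w where w: "min_gauss \<kappa> f A = ereal w" using assms(8,9) by (cases "min_gauss \<kappa> f A") auto
  have w_le: "w \<le> ?G \<mu>" if "\<mu> \<in> ?S" for \<mu>
    using INF_lower[OF that, of "gauss_functional \<kappa> f"] S_gauss[OF that] w by (simp add: min_gauss_def)
  \<comment> \<open>The midpoint is itself a competitor, so its value is at least \<open>w\<close>.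
    The estimate serves twice, for the Cauchy property and for uniqueness.\<close>
  have energy_dist_sq_le: "energy_dist_sq \<mu> \<nu> \<le> 2 * ?G \<mu> + 2 * ?G \<nu> - 4 * w" if "\<mu> \<in> ?S" "\<nu> \<in> ?S" for \<mu> \<nu>
  proof -
    have u: "\<mu> \<in> unit_measures \<kappa> A" "lsc_integral \<mu> \<psi> < \<infinity>" "\<nu> \<in> unit_measures \<kappa> A" "lsc_integral \<nu> \<psi> < \<infinity>"
      using that by (auto simp: S_iff)
    note mid = gauss_value_midpoint[OF SE[OF that(1)] u(2) SE[OF that(2)] u(4) \<psi> \<theta>]
    have "midpoint \<mu> \<nu> \<in> ?S"
      using midpoint_unit_measures[OF u(1,3)] mid(1) by (simp add: S_iff)
    then show ?thesis using w_le[of "midpoint \<mu> \<nu>"] mid(2) by simp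
  qed
  have "\<exists>\<mu>\<in>?S. ?G \<mu> < w + 1 / real (Suc n)" for n
  proof -
    have "(INF \<mu>\<in>?S. gauss_functional \<kappa> f \<mu>) < ereal (w + 1 / real (Suc n))"
      using w by (simp add: min_gauss_def)
    then show ?thesis unfolding INF_less_iff using S_gauss by auto
  qed
  then obtain \<sigma> where \<sigma>: "\<And>n. \<sigma> n \<in> ?S" "\<And>n. ?G (\<sigma> n) < w + 1 / real (Suc n)" by metis
  have \<sigma>E: "\<sigma> n \<in> E" for n using SE[OF \<sigma>(1)] .
  have "M.MCauchy \<sigma>"
    unfolding M.MCauchy_def
  proof (intro conjI allI impI)
    show "range \<sigma> \<subseteq> E" using \<sigma>E by blast
    fix \<epsilon> :: real assume \<epsilon>: "0 < \<epsilon>"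
    \<comment> \<open>Two members beyond N have values within 1/(N+1) of \<open>w\<close>, so their
      squared distance is at most 4/(N+1).\<close>
    then obtain N where N: "1 / real (Suc N) < \<epsilon>\<^sup>2 / 4"
      using nat_approx_posE[of "\<epsilon>\<^sup>2 / 4"] by auto
    have "energy_dist \<kappa> (\<sigma> m) (\<sigma> n) < \<epsilon>" if "N \<le> m" "N \<le> n" for m n
    proof -
      have "1 / real (Suc m) \<le> 1 / real (Suc N)" "1 / real (Suc n) \<le> 1 / real (Suc N)"
        using that by (auto simp: frac_le)
      then have "energy_dist_sq (\<sigma> m) (\<sigma> n) < \<epsilon>\<^sup>2"
        using energy_dist_sq_le[OF \<sigma>(1)[of m] \<sigma>(1)[of n]] \<sigma>(2)[of m] \<sigma>(2)[of n] N by linarith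
      then have "sqrt (energy_dist_sq (\<sigma> m) (\<sigma> n)) < sqrt (\<epsilon>\<^sup>2)" by (rule real_sqrt_less_mono)
      then show ?thesis using \<epsilon> by (simp add: energy_dist_eq \<sigma>E)
    qed
    then show "\<exists>N. \<forall>n n'. N \<le> n \<longrightarrow> N \<le> n' \<longrightarrow> energy_dist \<kappa> (\<sigma> n) (\<sigma> n') < \<epsilon>" by blast
  qed
  moreover have "M.mcomplete" using assms(3) by (simp add: perfect_def)
  ultimately obtain l where lim: "limitin M.mtopology \<sigma> l sequentially"
    unfolding M.mcomplete_def by blast
  then have l: "l \<in> E" and conv: "(\<lambda>n. energy_dist \<kappa> (\<sigma> n) l) \<longlonglongrightarrow> 0"
    by (auto simp: M.limitin_metric_dist_null)
  have vague: "(\<lambda>n. \<sigma> n \<phi>) \<longlonglongrightarrow> l \<phi>" if \<phi>: "\<phi> \<in> Cc" for \<phi>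
  proof (rule topological_tendstoI)
    fix V :: "real set" assume V: "open V" "l \<phi> \<in> V"
    let ?W = "{\<mu> \<in> radon. \<mu> \<phi> \<in> V}"
    \<comment> \<open>A subbasic vague neighbourhood of \<open>l\<close>; perfectness makes its
      trace on \<open>E\<close> strongly open.\<close>
    have "openin vague_topology ?W"
      unfolding vague_topology_def using \<phi> V by (intro topology_generated_by_Basis) blast
    then have "openin (subtopology vague_topology E) (?W \<inter> E)"
      by (auto simp: openin_subtopology)
    then have "openin M.mtopology (?W \<inter> E)" using assms(3) unfolding perfect_def by blast
    moreover have "l \<in> ?W \<inter> E" using l V E_radon_pos radon_pos_radon by blast
    ultimately have "\<forall>\<^sub>F n in sequentially. \<sigma> n \<in> ?W \<inter> E" using lim unfolding limitin_def by blast
    then show "\<forall>\<^sub>F n in sequentially. \<sigma> n \<phi> \<in> V" by eventually_elim simp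
  qed
  have linear: "(\<lambda>n. inner_energy (\<sigma> n) \<rho>) \<longlonglongrightarrow> inner_energy l \<rho>" if \<rho>: "\<rho> \<in> E" for \<rho>
  proof (rule LIM_zero_cancel, rule Lim_null_comparison)
    show "\<forall>\<^sub>F n in sequentially. norm (inner_energy (\<sigma> n) \<rho> - inner_energy l \<rho>) \<le> energy_dist \<kappa> (\<sigma> n) l * sqrt (inner_energy \<rho> \<rho>)"
      using inner_energy_diff_le[OF \<sigma>E l \<rho>] by simp
    show "(\<lambda>n. energy_dist \<kappa> (\<sigma> n) l * sqrt (inner_energy \<rho> \<rho>)) \<longlonglongrightarrow> 0"
      using tendsto_mult_left_zero[OF conv] .
  qed
  have quad: "(\<lambda>n. inner_energy (\<sigma> n) (\<sigma> n)) \<longlonglongrightarrow> inner_energy l l"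
  proof -
    \<comment> \<open>The energy of \<sigma> n is expanded around \<open>l\<close>, so that only the
      distance and a mutual energy with a fixed measure remain.\<close>
    have "(\<lambda>n. (energy_dist \<kappa> (\<sigma> n) l)\<^sup>2 + 2 * inner_energy (\<sigma> n) l - inner_energy l l) \<longlonglongrightarrow> 0\<^sup>2 + 2 * inner_energy l l - inner_energy l l"
      by (intro tendsto_intros conv linear l)
    moreover have "(energy_dist \<kappa> (\<sigma> n) l)\<^sup>2 + 2 * inner_energy (\<sigma> n) l - inner_energy l l = inner_energy (\<sigma> n) (\<sigma> n)" for n
      using energy_dist_sq_nonneg(1)[OF \<sigma>E l, of n] by (simp add: energy_dist_eq \<sigma>E l energy_dist_sq_def)
    ultimately show ?thesis by simp
  qed
  have "Bseq (\<lambda>n. inner_energy (\<sigma> n) (\<sigma> n))" using quad convergent_imp_Bseq convergentI by blast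
  then obtain B where "\<And>n. norm (inner_energy (\<sigma> n) (\<sigma> n)) \<le> B" by (rule BseqE) blast
  then have B: "inner_energy (\<sigma> n) (\<sigma> n) \<le> B" for n using abs_le_D1[of "inner_energy (\<sigma> n) (\<sigma> n)" B] by simp
  have lu: "l \<in> unit_measures \<kappa> A"
    using \<sigma>(1) by (intro vague_limit_unit_measures[OF assms(7) _ l vague B]) (auto simp: S_iff)
  have G_lim: "(\<lambda>n. ?G (\<sigma> n)) \<longlonglongrightarrow> w"
  proof (rule tendsto_sandwich)
    show "\<forall>\<^sub>F n in sequentially. w \<le> ?G (\<sigma> n)" using w_le[OF \<sigma>(1)] by simp
    show "\<forall>\<^sub>F n in sequentially. ?G (\<sigma> n) \<le> w + 1 / real (Suc n)" using \<sigma>(2) by (simp add: less_imp_le)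
    show "(\<lambda>n. w + 1 / real (Suc n)) \<longlonglongrightarrow> w"
      using tendsto_add[OF tendsto_const[of w] LIMSEQ_inverse_real_of_nat] by (simp add: inverse_eq_divide)
  qed simp
  \<comment> \<open>The equation \<open>?G l = w\<close> solved for the integral of \<psi>. All
    other terms of \<open>?G\<close> converge strongly, so the integrals of \<psi> along the
    sequence tend to \<open>r\<close>.\<close>
  define r where "r = (w - inner_energy l l) / 2 - inner_energy l ?p + inner_energy l ?n"
  have J_lim: "(\<lambda>n. real_of_ereal (lsc_integral (\<sigma> n) \<psi>)) \<longlonglongrightarrow> r"
  proof -
    have "(\<lambda>n. (?G (\<sigma> n) - inner_energy (\<sigma> n) (\<sigma> n)) / 2 - inner_energy (\<sigma> n) ?p + inner_energy (\<sigma> n) ?n) \<longlonglongrightarrow> r"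
      unfolding r_def by (intro tendsto_intros G_lim quad linear pn) simp
    moreover have "(?G (\<sigma> n) - inner_energy (\<sigma> n) (\<sigma> n)) / 2 - inner_energy (\<sigma> n) ?p + inner_energy (\<sigma> n) ?n =
        real_of_ereal (lsc_integral (\<sigma> n) \<psi>)" for n
      by (simp add: gauss_value_def field_integral_def field_simps)
    ultimately show ?thesis by simp
  qed
  have lsc: "lsc_integral l \<psi> \<le> ereal r"
  proof (rule lsc_integral_least)
    fix \<phi> :: "'a \<Rightarrow> real" assume \<phi>: "\<phi> \<in> Cc" "\<And>x. ereal (\<phi> x) \<le> \<psi> x"
    have "\<sigma> n \<phi> \<le> real_of_ereal (lsc_integral (\<sigma> n) \<psi>)" for n
      using lsc_integral_upper[of \<phi> \<psi> "\<sigma> n", OF \<phi>] \<sigma>(1)[of n]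
      by (cases "lsc_integral (\<sigma> n) \<psi>") (auto simp: S_iff)
    then show "ereal (l \<phi>) \<le> ereal r"
      using LIMSEQ_le[OF vague[OF \<phi>(1)] J_lim] by auto
  qed
  then have lS: "l \<in> ?S" using lu by (auto simp: S_iff intro: le_less_trans)
  have "real_of_ereal (lsc_integral l \<psi>) \<le> r"
    using lsc lsc_integral_not_MInf[OF \<psi>, of l] by (cases "lsc_integral l \<psi>") auto
  then have "?G l \<le> w" by (simp add: gauss_value_def field_integral_def r_def field_simps)
  then have lG: "?G l = w" using w_le[OF lS] by simp
  show ?thesis
  proof (rule ex1I)
    show "l \<in> ?S \<and> gauss_functional \<kappa> f l = min_gauss \<kappa> f A"
      using lS lG S_gauss w by simp
    fix \<mu> assume \<mu>: "\<mu> \<in> ?S \<and> gauss_functional \<kappa> f \<mu> = min_gauss \<kappa> f A"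
    then have "?G \<mu> = w" using S_gauss[of \<mu>] w by auto
    \<comment> \<open>With both values equal to \<open>w\<close> the bound reads 2w + 2w - 4w =
      0.\<close>
    then have "energy_dist_sq \<mu> l \<le> 0" using energy_dist_sq_le[of \<mu> l] \<mu> lS lG by simp
    then show "\<mu> = l" using energy_dist_sq_nonneg(1,3)[of \<mu> l] SE \<mu> l by fastforce
  qed
qed

end
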